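(* Let $N\ge1$, $0<s<1$, $\mu>0$, let $\Omega\subset\mathbb{R}^N$ be a bounded domain and let $H:\mathbb{R}^N\times\mathbb{R}\to\mathbb{R}$, $(x,p)\mapsto H(x,p)$, be continuous. Let $u_1,u_2:\mathbb{R}^N\to\mathbb{R}$ be bounded on $\mathbb{R}^N$ and continuous on $\overline\Omega$, with $u_1\le u_2$ in $\Omega^c=\mathbb{R}^N\setminus\Omega$. Assume that one of the following holds. (a) $u_1$ and $u_2$ are, respectively, a viscosity sub solution and a viscosity super solution of $$\mu u+H(x,D_su)=0\quad\text{in }\Omega,$$ and there is a modulus of continuity $\omega_1$ such that $$|H(x,D_sv(x))-H(y,D_sv(x))|\le\omega_1\big(|x-y|(1+D_sv(x))\big)$$ for all $x,y\in\Omega$ and all $v\in C^1(\Omega)\cap L^1_w(\mathbb{R}^N)$ (with $D_sv(x)$ finite). (b) $h:\mathbb{R}^N\to\mathbb{R}$ is a smooth function in $L^1_w(\mathbb{R}^N)$, $u_1$ and $u_2$ are, respectively, a viscosity sub solution and a viscosity super solution of $$\mu u+H(x,\mathcal{B}(u,h))=0\quad\text{in }\Omega,$$ and there is a modulus of continuity $\tilde\omega_1$ such that $$|H(x,\mathcal{B}(v,h_1)(x))-H(y,\mathcal{B}(v,h_2)(y))|\le\tilde\omega_1\big(|x-y|+|\mathcal{B}(v,h_1)(x)-\mathcal{B}(v,h_2)(y)|\big)$$ for all $x,y\in\Omega$, all $v\in C^1(\Omega)\cap L^1_w(\mathbb{R}^N)$ and all smooth $h_1,h_2\in L^1_w(\mathbb{R}^N)$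 (for which the quantities involved are well defined and finite). Then $u_1\le u_2$ in $\Omega$.
   Context: Fix $0<s<1$ and let $c_{N,s}>0$ be the normalization constant of the fractional Laplacian $(-\Delta)^su(x)=\mathrm{P.V.}\,c_{N,s}\int_{\mathbb{R}^N}\frac{u(x)-u(y)}{|x-y|^{N+2s}}dy$, chosen so that $(-\Delta)^su\to-\Delta u$ as $s\to1$ for smooth $u$. Define $$\mathcal{B}(u,v)(x)=\frac{c_{N,s}}{2}\int_{\mathbb{R}^N}\frac{(u(x)-u(y))(v(x)-v(y))}{|x-y|^{N+2s}}\,dy,\qquad D_su(x)=\sqrt{\mathcal{B}(u,u)(x)} .$$ Let $w(x)=\frac{1}{1+|x|^{N+2s}}$; $L^1_w(\mathbb{R}^N)$ is the set of functions $u$ on $\mathbb{R}^N$ with $\|uw\|_{L^1(\mathbb{R}^N)}<\infty$. For an open set $\Omega$, $C^1(\Omega)\cap L^1_w(\mathbb{R}^N)$ denotes functions on $\mathbb{R}^N$ that belong to $L^1_w(\mathbb{R}^N)$ and are of class $C^1$ in $\Omega$. A modulus of continuity is a continuous nondecreasing function $\omega:[0,\infty)\to[0,\infty)$ with $\omega(0)=0$. Viscosity solutions. Let $\mathcal{G}u(x)$ denote $D_su(x)$ or $\mathcal{B}(u,h)(x)$, according to the equation considered. A function $u:\mathbb{R}^N\to\mathbb{R}$ that is upper (respectively lower) semicontinuous in $\overline\Omega$ is a viscosity sub solution (respectively super solution) of $\mu u+H(x,\mathcal{G}u)=0$ in $\Omega$ if for every test function $\varphi\in C^1(\Omega)\cap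 L^1_w(\mathbb{R}^N)$ and every $x_0\in\Omega$ such that $u-\varphi$ has a global maximum (respectively global minimum) over $\mathbb{R}^N$ at $x_0$ (and $\mathcal{G}\varphi(x_0)$ is well defined and finite) one has $$\mu u(x_0)+H(x_0,\mathcal{G}\varphi(x_0))\le0\quad(\text{respectively }\ge0).$$
   Formalization: In case (b) the functions u_1 and u_2 are additionally assumed Lebesgue measurable on R^N; without this the claim fails for non-measurable exterior values. *)

theory Defs
  imports "HOL-Analysis.Analysis"
begin

text \<open>Meant for an open set \<open>S\<close>: all iterated partial derivatives up to order \<open>k\<close>
  exist and are continuous on \<open>S\<close>; \<open>f\<close> is unconstrained outside \<open>S\<close>.\<close>

primrec Ck_on :: "nat \<Rightarrow> 'a::euclidean_space set \<Rightarrow> ('a \<Rightarrow> real) \<Rightarrow> bool" where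
  "Ck_on 0 S f \<longleftrightarrow> continuous_on S f"
| "Ck_on (Suc k) S f \<longleftrightarrow>
     (\<forall>x\<in>S. f differentiable (at x)) \<and>
     (\<forall>i\<in>Basis. Ck_on k S (\<lambda>x. frechet_derivative f (at x) i))"

definition smooth :: "('a::euclidean_space \<Rightarrow> real) \<Rightarrow> bool" where
  "smooth f \<longleftrightarrow> (\<forall>k. Ck_on k UNIV f)"

definition usc_on :: "'a::topological_space set \<Rightarrow> ('a \<Rightarrow> real) \<Rightarrow> bool" where
  "usc_on S u \<longleftrightarrow> (\<forall>x\<in>S. \<forall>a > u x. eventually (\<lambda>y. u y < a) (at x within S))"

definition lsc_on :: "'a::topological_space set \<Rightarrow> ('a \<Rightarrow> real) \<Rightarrow> bool" where
  "lsc_on S u \<longleftrightarrow> (\<forall>x\<in>S. \<forall>a < u x. eventually (\<lambda>y. a < u y) (at x within S))"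

text \<open>Only the values of \<open>\<omega>\<close> on \<open>[0,\<infinity>)\<close> matter.\<close>

definition modulus_of_continuity :: "(real \<Rightarrow> real) \<Rightarrow> bool" where
  "modulus_of_continuity \<omega> \<longleftrightarrow>
     continuous_on {0..} \<omega> \<and> mono_on {0..} \<omega> \<and> (\<forall>t\<ge>0. 0 \<le> \<omega> t) \<and> \<omega> 0 = 0"

text \<open>The usual constant making \<open>(-\<Delta>)\<^sup>s\<close> the Fourier multiplier \<open>\<bar>\<xi>\<bar>\<^bsup>2s\<^esup>\<close>:
  \<open>4\<^sup>s \<Gamma>(N/2 + s) / (\<pi>\<^bsup>N/2\<^esup> \<bar>\<Gamma>(-s)\<bar>)\<close>, where \<open>\<bar>\<Gamma>(-s)\<bar> = \<Gamma>(1 - s) / s\<close> for \<open>0 < s < 1\<close>.\<close>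

definition frac_lap_const :: "nat \<Rightarrow> real \<Rightarrow> real" where
  "frac_lap_const N s =
     s * 4 powr s * Gamma (real N / 2 + s) / (pi powr (real N / 2) * Gamma (1 - s))"

definition weight :: "real \<Rightarrow> 'a::euclidean_space \<Rightarrow> real" where
  "weight s x = 1 / (1 + norm x powr (real DIM('a) + 2 * s))"

definition L1w :: "real \<Rightarrow> ('a::euclidean_space \<Rightarrow> real) set" where
  "L1w s = {u. integrable lebesgue (\<lambda>x. u x * weight s x)}"

definition C1_L1w :: "real \<Rightarrow> 'a::euclidean_space set \<Rightarrow> ('a \<Rightarrow> real) set" where
  "C1_L1w s \<Omega> = {u. Ck_on 1 \<Omega> u} \<inter> L1w s"

text \<open>At \<open>y = x\<close> the integrand takes the value 0, since division by 0 yields 0.\<close>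

definition B_integrand ::
  "real \<Rightarrow> ('a::euclidean_space \<Rightarrow> real) \<Rightarrow> ('a \<Rightarrow> real) \<Rightarrow> 'a \<Rightarrow> 'a \<Rightarrow> real" where
  "B_integrand s u v x y =
     (u x - u y) * (v x - v y) / norm (x - y) powr (real DIM('a) + 2 * s)"

text \<open>The Bochner integral of a non-integrable function is 0, so well-definedness and
  finiteness of \<open>\<B>(u,v)(x)\<close> has to be tracked separately.\<close>

definition B_finite ::
  "real \<Rightarrow> ('a::euclidean_space \<Rightarrow> real) \<Rightarrow> ('a \<Rightarrow> real) \<Rightarrow> 'a \<Rightarrow> bool" where
  "B_finite s u v x \<longleftrightarrow> integrable lebesgue (B_integrand s u v x)"

definition Bform ::
  "real \<Rightarrow> ('a::euclidean_space \<Rightarrow> real) \<Rightarrow> ('a \<Rightarrow> real) \<Rightarrow> 'a \<Rightarrow> real" where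
  "Bform s u v x =
     frac_lap_const DIM('a) s / 2 * (LINT y|lebesgue. B_integrand s u v x y)"

definition Ds :: "real \<Rightarrow> ('a::euclidean_space \<Rightarrow> real) \<Rightarrow> 'a \<Rightarrow> real" where
  "Ds s u x = sqrt (Bform s u u x)"

definition Ds_finite :: "real \<Rightarrow> ('a::euclidean_space \<Rightarrow> real) \<Rightarrow> 'a \<Rightarrow> bool" where
  "Ds_finite s u x \<longleftrightarrow> B_finite s u u x"

text \<open>Viscosity sub and super solutions of \<open>\<mu> u + H(x, \<G>u) = 0\<close> in \<open>\<Omega>\<close>;
  \<open>fin \<phi> x\<close> says that \<open>\<G>\<phi>(x)\<close> is well defined and finite.\<close>

definition visc_sub ::
  "real \<Rightarrow> (('a::euclidean_space \<Rightarrow> real) \<Rightarrow> 'a \<Rightarrow> bool) \<Rightarrow> (('a \<Rightarrow> real) \<Rightarrow> 'a \<Rightarrow> real) \<Rightarrow>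
   real \<Rightarrow> ('a \<Rightarrow> real \<Rightarrow> real) \<Rightarrow> 'a set \<Rightarrow> ('a \<Rightarrow> real) \<Rightarrow> bool" where
  "visc_sub s fin \<G> \<mu> H \<Omega> u \<longleftrightarrow>
     usc_on (closure \<Omega>) u \<and>
     (\<forall>\<phi> \<in> C1_L1w s \<Omega>. \<forall>x0\<in>\<Omega>.
        (\<forall>y. u y - \<phi> y \<le> u x0 - \<phi> x0) \<and> fin \<phi> x0 \<longrightarrow> \<mu> * u x0 + H x0 (\<G> \<phi> x0) \<le> 0)"

definition visc_super ::
  "real \<Rightarrow> (('a::euclidean_space \<Rightarrow> real) \<Rightarrow> 'a \<Rightarrow> bool) \<Rightarrow> (('a \<Rightarrow> real) \<Rightarrow> 'a \<Rightarrow> real) \<Rightarrow>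
   real \<Rightarrow> ('a \<Rightarrow> real \<Rightarrow> real) \<Rightarrow> 'a set \<Rightarrow> ('a \<Rightarrow> real) \<Rightarrow> bool" where
  "visc_super s fin \<G> \<mu> H \<Omega> u \<longleftrightarrow>
     lsc_on (closure \<Omega>) u \<and>
     (\<forall>\<phi> \<in> C1_L1w s \<Omega>. \<forall>x0\<in>\<Omega>.
        (\<forall>y. u x0 - \<phi> x0 \<le> u y - \<phi> y) \<and> fin \<phi> x0 \<longrightarrow> 0 \<le> \<mu> * u x0 + H x0 (\<G> \<phi> x0))"

end

theory Submission
  imports Defs
begin

text \<open>
  Suppose \<open>u1 - u2\<close> is positive somewhere. Maximising
  \<open>u1 x - u2 y - K (1 - 1 / (1 + n\<^sup>2 \<bar>x - y\<bar>\<^sup>2))\<close> over pairs of points of the closure of \<open>\<Omega>\<close> gives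
  interior points \<open>x\<close>, \<open>y\<close> with \<open>\<bar>x - y\<bar> \<le> 1/n\<close> at which \<open>u1\<close> and \<open>- u2\<close> are touched from above
  inside \<open>\<Omega>\<close>, and \<open>u1 x - u1 z \<ge> u2 y - u2 z\<close> for all \<open>z\<close>. It remains to find test functions at
  \<open>x\<close> and \<open>y\<close> whose values \<open>p\<close>, \<open>q\<close> of the nonlocal operator are (almost) equal: then subtracting
  the two viscosity inequalities contradicts the continuity assumption on \<open>H\<close>. This uses that a
  test function may be enlarged away from the touching point.

  In case (a), enlarging the test function on the complement of \<open>\<Omega>\<close> realises every sufficiently
  large value of \<open>D\<^sub>s\<close> at both points; since the penalisation is \<open>(1 + s)/2\<close>-Hoelder with constant
  of order \<open>n\<^bsup>(1 + s)/2\<^esup>\<close>, one common value of this order can be taken, and \<open>(1 + s)/2 < 1\<close>.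

  In case (b), let \<open>h x\<close> be neither the maximum nor the minimum of \<open>h\<close>. Adding a bump to the test
  function where \<open>h < h x\<close> or \<open>h > h x\<close> realises every real value at \<open>x\<close>, so \<open>p = q\<close> is possible;
  likewise for \<open>y\<close>. Otherwise, for large \<open>n\<close>, \<open>x\<close> and \<open>y\<close> are both maxima or both minima of \<open>h\<close>. There
  the increments of \<open>h\<close> are of second order, so \<open>\<B>(u1,h)(x)\<close> and \<open>\<B>(u2,h)(y)\<close> are finite and are limits of values
  at test functions; by the inequality between the increments of \<open>u1\<close> and \<open>u2\<close> they are ordered, up
  to \<open>O(\<bar>x - y\<bar>\<^bsup>1 - s\<^esup>)\<close>, in the direction that the bumps can correct.
\<close>

subsection \<open>Integrability of the fractional kernels\<close>

lemma distr_lborel_minus: "distr lborel borel (\<lambda>z::'a::euclidean_space. x - z) = lborel"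
  using lborel_affine[of "-1::real" x] by (simp add: density_1)

lemma
  fixes f :: "'a::euclidean_space \<Rightarrow> real"
  assumes "f \<in> borel_measurable borel"
  shows integral_lborel_reflect: "(LINT z|lborel. f (x - z)) = (LINT z|lborel. f z)"
    and integrable_lborel_reflect: "integrable lborel (\<lambda>z. f (x - z)) \<longleftrightarrow> integrable lborel f"
  using integral_distr[of "\<lambda>z. x - z" lborel borel f] integrable_distr_eq[of "\<lambda>z. x - z" lborel borel f]
    assms by (simp_all add: distr_lborel_minus)

text \<open>Countably many balls replace polar coordinates: wherever \<open>f\<close> is nonzero one
  constant \<open>c k\<close> on its ball dominates it, hence so does the sum over all
  \<open>k\<close>. That sum integrates to the volume of the unit ball times the assumed
  series.\<close>

lemma integrable_dominated_by_cballs: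
  fixes f :: "'a::euclidean_space \<Rightarrow> real"
  assumes f: "f \<in> borel_measurable borel" "\<And>w. 0 \<le> f w"
    and c: "\<And>k. 0 \<le> c k" and r: "\<And>k. 0 \<le> r k"
    and sum: "summable (\<lambda>k::nat. c k * r k ^ DIM('a))"
    and dom: "\<And>w. f w \<noteq> 0 \<Longrightarrow> \<exists>k. norm w \<le> r k \<and> f w \<le> c k"
  shows "integrable lborel f"
proof (rule integrableI_bounded)
  show "f \<in> borel_measurable lborel" using f by simp
  let ?v = "unit_ball_vol (real DIM('a))"
  have bound: "ennreal (norm (f w)) \<le> (\<Sum>k. ennreal (c k) * indicator (cball 0 (r k)) w)" for w
  proof (cases "f w = 0")
    case False
    then obtain k where k: "norm w \<le> r k" "f w \<le> c k" using dom by blast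
    have "ennreal (norm (f w)) \<le> ennreal (c k) * indicator (cball 0 (r k)) w"
      using k f(2)[of w] by (simp add: ennreal_leI)
    also have "\<dots> \<le> (\<Sum>k. ennreal (c k) * indicator (cball 0 (r k)) w)"
      using sum_le_suminf[OF summableI, of "{k}" "\<lambda>k. ennreal (c k) * indicator (cball 0 (r k)) w"]
      by (simp del: sum_mult_indicator)
    finally show ?thesis .
  qed simp
  have "(\<integral>\<^sup>+w. ennreal (norm (f w)) \<partial>lborel) \<le> (\<integral>\<^sup>+w. (\<Sum>k. ennreal (c k) * indicator (cball 0 (r k)) (w::'a)) \<partial>lborel)"
    by (intro nn_integral_mono bound)
  also have "\<dots> = (\<Sum>k. \<integral>\<^sup>+w. ennreal (c k) * indicator (cball 0 (r k)) (w::'a) \<partial>lborel)"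
    by (intro nn_integral_suminf borel_measurable_times_ennreal borel_measurable_indicator) auto
  also have "\<dots> = (\<Sum>k. ennreal (?v * (c k * r k ^ DIM('a))))"
    by (subst nn_integral_cmult_indicator)
      (simp_all add: emeasure_cball r ennreal_mult'[symmetric] c  algebra_simps)
  also have "\<dots> < \<infinity>"
  proof -
    have "summable (\<lambda>k. ?v * (c k * r k ^ DIM('a)))" using sum by (rule summable_mult)
    then show ?thesis
      using c r by (subst suminf_ennreal2) (auto simp: unit_ball_vol_nonneg)
  qed
  finally show "(\<integral>\<^sup>+w. ennreal (norm (f w)) \<partial>lborel) < \<infinity>" .
qed

text \<open>Dyadic shells shrinking to the origin: on each shell the power is comparable to its
  value at the outer radius, and the resulting series is geometric with ratio 2 to the power
  \<open>\<gamma> - DIM('a)\<close>, which is below 1.\<close>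

lemma integrable_norm_powr_cball:
  assumes "0 < R" and \<gamma>: "\<gamma> < real DIM('a::euclidean_space)"
  shows "integrable lborel (\<lambda>w::'a. indicator (cball 0 R) w * norm w powr (-\<gamma>))"
proof -
  \<comment> \<open>The factor \<open>2 powr \<bar>\<gamma>\<bar>\<close> serves both signs of
    \<open>\<gamma>\<close>: for positive \<open>\<gamma>\<close> the power is largest at the inner
    radius, half the outer one, and for negative \<open>\<gamma>\<close> at the outer
    radius.\<close>
  define c where "c k = 2 powr \<bar>\<gamma>\<bar> * (R * (1/2) ^ k) powr (-\<gamma>)" for k :: nat
  define r where "r k = R * (1/2) ^ k" for k :: nat
  have rpos: "0 < r k" for k using assms by (simp add: r_def)
  have *: "c k * r k ^ DIM('a) = (2 powr \<bar>\<gamma>\<bar> * R powr (DIM('a) - \<gamma>)) * ((1/2) powr (DIM('a) - \<gamma>)) ^ k" for k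
  proof -
    have "r k powr (-\<gamma>) * r k ^ DIM('a) = r k powr (DIM('a) - \<gamma>)"
      using rpos[of k] by (simp add: powr_realpow[symmetric] powr_add[symmetric])
    also have "\<dots> = R powr (DIM('a) - \<gamma>) * ((1/2)^k) powr (DIM('a) - \<gamma>)"
      unfolding r_def using assms by (simp add: powr_mult)
    also have "((1/2::real)^k) powr (DIM('a) - \<gamma>) = ((1/2) powr (DIM('a) - \<gamma>)) ^ k"
      by (simp add: powr_realpow[symmetric] powr_powr mult.commute)
    finally show ?thesis by (simp add: c_def r_def[symmetric])
  qed
  have "summable (\<lambda>k. c k * r k ^ DIM('a))"
    unfolding * using \<gamma> by (intro summable_mult summable_geometric) (simp add: powr_divide gr_one_powr)
  moreover have "\<exists>k. norm w \<le> r k \<and> indicator (cball 0 R) w * norm w powr (-\<gamma>) \<le> c k"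
    if "indicator (cball 0 R) w * norm w powr (-\<gamma>) \<noteq> 0" for w :: 'a
  proof -
    from that have w: "norm w \<le> R" "0 < norm w" by (auto simp: indicator_def split: if_splits)
    obtain n where n: "(1/2)^n < norm w / R"
      using w assms real_arch_pow_inv[of "norm w / R" "1/2"] by auto
    then have "r n < norm w" using assms by (simp add: r_def field_simps)
    \<comment> \<open>The first dyadic radius below \<open>norm w\<close> has positive index because
      \<open>r 0 = R\<close>; its predecessor \<open>j\<close> is the shell that contains
      \<open>w\<close>.\<close>
    define k where "k = (LEAST n. r n < norm w)"
    have k: "r k < norm w" unfolding k_def by (rule LeastI) fact
    have "k \<noteq> 0"
    proof
      assume "k = 0"
      with k w show False by (simp add: r_def)
    qed
    then obtain j where j: "k = Suc j" by (cases k) auto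
    have "norm w \<le> r j" using not_less_Least[of j "\<lambda>n. r n < norm w"] j k_def by auto
    moreover have half: "r j / 2 < norm w" using k j by (simp add: r_def)
    moreover have "norm w powr (-\<gamma>) \<le> 2 powr \<bar>\<gamma>\<bar> * r j powr (-\<gamma>)"
    proof (cases "\<gamma> \<ge> 0")
      case True
      have "norm w powr (-\<gamma>) \<le> (r j / 2) powr (-\<gamma>)"
        using True half rpos[of j] by (intro powr_mono2') auto
      also have "\<dots> = 2 powr \<bar>\<gamma>\<bar> * r j powr (-\<gamma>)"
        using True rpos[of j] by (simp add: powr_divide powr_minus field_simps)
      finally show ?thesis .
    next
      case False
      have "norm w powr (-\<gamma>) \<le> r j powr (-\<gamma>)"
        using False \<open>norm w \<le> r j\<close> by (intro powr_mono2) auto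
      also have "\<dots> \<le> 2 powr \<bar>\<gamma>\<bar> * r j powr (-\<gamma>)"
        using ge_one_powr_ge_zero[of 2 "\<bar>\<gamma>\<bar>"] by (simp add: mult_le_cancel_right1)
      finally show ?thesis .
    qed
    ultimately show ?thesis using w by (intro exI[of _ j]) (simp add: c_def r_def)
  qed
  moreover have "(\<lambda>w::'a. indicator (cball 0 R) w * norm w powr (-\<gamma>)) \<in> borel_measurable borel"
    by (intro borel_measurable_times borel_measurable_indicator borel_closed) auto
  ultimately show ?thesis
    using assms by (intro integrable_dominated_by_cballs[of _ c r])
      (auto simp: c_def r_def less_imp_le)
qed

text \<open>The same dyadic argument with growing shells: \<open>c k\<close> is the kernel at the
  inner radius \<open>R * 2 ^ k\<close>, \<open>r k\<close> is the outer radius, and the geometric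
  ratio \<open>2 powr (DIM('a) - \<gamma>)\<close> is now below 1 because \<open>\<gamma>\<close>
  exceeds the dimension.\<close>

lemma integrable_norm_powr_outside_ball:
  assumes "0 < R" and \<gamma>: "real DIM('a::euclidean_space) < \<gamma>"
  shows "integrable lborel (\<lambda>w::'a. indicator (- ball 0 R) w * norm w powr (-\<gamma>))"
proof -
  define c where "c k = (R * 2 ^ k) powr (-\<gamma>)" for k :: nat
  define r where "r k = 2 * (R * 2 ^ k)" for k :: nat
  have rpos: "0 < r k" for k using assms by (simp add: r_def)
  have *: "c k * r k ^ DIM('a) = (2 ^ DIM('a) * R powr (DIM('a) - \<gamma>)) * (2 powr (DIM('a) - \<gamma>)) ^ k" for k
  proof -
    have "(R * 2 ^ k) powr (-\<gamma>) * (R * 2 ^ k) ^ DIM('a) = (R * 2 ^ k) powr (DIM('a) - \<gamma>)"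
      using assms by (simp add: powr_realpow[symmetric] powr_add[symmetric])
    also have "\<dots> = R powr (DIM('a) - \<gamma>) * (2^k) powr (DIM('a) - \<gamma>)"
      using assms by (simp add: powr_mult)
    also have "(2^k) powr (DIM('a) - \<gamma>) = (2 powr (DIM('a) - \<gamma>)) ^ k"
      by (simp add: powr_realpow[symmetric] powr_powr mult.commute)
    finally show ?thesis by (simp add: c_def r_def power_mult_distrib algebra_simps)
  qed
  have "summable (\<lambda>k. c k * r k ^ DIM('a))"
    unfolding * using \<gamma> by (intro summable_mult summable_geometric) (simp add: powr_less_one)
  moreover have "\<exists>k. norm w \<le> r k \<and> indicator (- ball 0 R) w * norm w powr (-\<gamma>) \<le> c k"
    if "indicator (- ball 0 R) w * norm w powr (-\<gamma>) \<noteq> 0" for w :: 'a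
  proof -
    from that have w: "R \<le> norm w" by (auto simp: indicator_def split: if_splits)
    obtain n where n: "norm w / R < 2 ^ n"
      using real_arch_pow[of 2 "norm w / R"] by auto
    then have "norm w < R * 2 ^ n" using assms by (simp add: field_simps)
    define k where "k = (LEAST n. norm w < R * 2 ^ n)"
    have k: "norm w < R * 2 ^ k" unfolding k_def by (rule LeastI) fact
    have "k \<noteq> 0"
    proof
      assume "k = 0"
      with k w show False by simp
    qed
    then obtain j where j: "k = Suc j" by (cases k) auto
    have "R * 2 ^ j \<le> norm w" using not_less_Least[of j "\<lambda>n. norm w < R * 2 ^ n"] j k_def by auto
    then have "norm w powr (-\<gamma>) \<le> (R * 2 ^ j) powr (-\<gamma>)"
      using assms by (intro powr_mono2') auto
    then show ?thesis using w k j by (intro exI[of _ j]) (simp add: c_def r_def)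
  qed
  moreover have "(\<lambda>w::'a. indicator (- ball 0 R) w * norm w powr (-\<gamma>)) \<in> borel_measurable borel"
    by measurable
  ultimately show ?thesis
    using assms by (intro integrable_dominated_by_cballs[of _ c r])
      (auto simp: c_def r_def less_imp_le)
qed

lemma integrable_weight:
  assumes "0 < s"
  shows "integrable lborel (weight s :: 'a::euclidean_space \<Rightarrow> real)"
proof -
  let ?\<alpha> = "real DIM('a) + 2 * s"
  have 1: "integrable lborel (\<lambda>w::'a. indicator (cball 0 1) w * norm w powr (-0))"
    by (rule integrable_norm_powr_cball) auto
  have 2: "integrable lborel (\<lambda>w::'a. indicator (- ball 0 1) w * norm w powr (-?\<alpha>))"
    by (rule integrable_norm_powr_outside_ball) (use assms in auto)
  \<comment> \<open>The kernel with exponent 0 plays the role of the constant 1 on the unit ball.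
    Since \<open>0 powr 0\<close> is 0, it misses the origin, and the indicator of
    \<open>{0}\<close> fills this point in.\<close>
  show ?thesis
  proof (rule Bochner_Integration.integrable_bound[OF Bochner_Integration.integrable_add[OF Bochner_Integration.integrable_add[OF 1 2]
        integrable_real_indicator[of "{0}" lborel]]])
    show "weight s \<in> borel_measurable lborel" unfolding weight_def by simp
    have "weight s w \<le> indicator (cball 0 1) w * norm w powr (-0)
        + indicator (- ball 0 1) w * norm w powr (-?\<alpha>) + indicator {0} w" for w :: 'a
    proof (cases "norm w < 1")
      case True
      have "1 / (1 + norm w powr ?\<alpha>) \<le> 1" by (simp add: divide_le_eq_1 add_pos_nonneg)
      with True show ?thesis by (auto simp: weight_def indicator_def)
    next
      case False
      then have "1 / (1 + norm w powr ?\<alpha>) \<le> 1 / norm w powr ?\<alpha>"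
        by (intro divide_left_mono) (auto intro!: mult_pos_pos add_pos_nonneg)
      with False show ?thesis by (auto simp: weight_def indicator_def powr_minus_divide simp del: minus_add_distrib)
    qed
    moreover have "0 \<le> weight s w" for w :: 'a by (simp add: weight_def)
    ultimately show "AE w in lborel. norm (weight s w) \<le> norm (indicator (cball 0 1) w * norm w powr (-0)
        + indicator (- ball 0 1) w * norm w powr (-?\<alpha>) + indicator {0::'a} w)" 
      by (intro AE_I2) (smt (verit) real_norm_def)
  qed auto
qed

lemma weight_nonneg: "0 \<le> weight s x" by (simp add: weight_def)

lemma weight_measurable [measurable]: "weight s \<in> borel_measurable borel"
  unfolding weight_def by simp

lemma bounded_in_L1w:
  fixes u :: "'a::euclidean_space \<Rightarrow> real"
  assumes "0 < s" "u \<in> borel_measurable lebesgue" "\<And>x. \<bar>u x\<bar> \<le> M"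
  shows "u \<in> L1w s"
proof -
  have "integrable lebesgue (\<lambda>x::'a. M * weight s x)"
    using integrable_weight[OF assms(1), where 'a='a] by (auto simp: integrable_completion)
  then have "integrable lebesgue (\<lambda>x. u x * weight s x)"
  proof (rule Bochner_Integration.integrable_bound)
    show "(\<lambda>x. u x * weight s x) \<in> borel_measurable lebesgue"
      by (intro borel_measurable_times assms(2) measurable_completion) simp
    have "\<bar>u x\<bar> * weight s x \<le> \<bar>M\<bar> * weight s x" for x
      using assms(3)[of x] by (intro mult_right_mono weight_nonneg) auto
    then show "AE x in lebesgue. norm (u x * weight s x) \<le> norm (M * weight s x)"
      by (intro AE_I2) (simp add: abs_mult weight_nonneg)
  qed
  then show ?thesis by (simp add: L1w_def)
qed

section \<open>Pointwise estimates for the kernel\<close>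

lemma powr_minus_diff_le_aux:
  fixes a b :: real
  assumes "0 < a" "a \<le> b" "b - a \<le> d" "0 < \<tau>" "\<tau> \<le> 1" "0 < \<alpha>"
  shows "\<bar>a powr (-\<alpha>) - b powr (-\<alpha>)\<bar> \<le> (\<alpha> * d) powr \<tau> * a powr (-(\<alpha> + \<tau>))"
proof -
  \<comment> \<open>\<open>e\<close> is the relative drop of the power between \<open>a\<close> and
    \<open>b\<close>. It is at most 1 and at most \<open>\<alpha> * X\<close>, hence at most
    \<open>(\<alpha> * X) powr \<tau>\<close>, which interpolates between the two bounds.\<close>
  define X where "X = (b - a) / a"
  define e where "e = 1 - (a / b) powr \<alpha>"
  have b: "0 < b" and X: "0 \<le> X" using assms by (auto simp: X_def)
  have 1: "1 + \<alpha> * ln (a / b) \<le> exp (\<alpha> * ln (a / b))" by (rule exp_ge_add_one_self)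
  have "- X \<le> ln (a / b)"
    using ln_le_minus_one[of "b / a"] assms b by (simp add: X_def ln_div diff_divide_distrib)
  then have "- (\<alpha> * X) \<le> \<alpha> * ln (a / b)"
    using assms mult_left_mono[of "-X" "ln (a / b)" \<alpha>] by simp
  then have "1 - exp (\<alpha> * ln (a / b)) \<le> \<alpha> * X" using 1 by linarith
  then have e1: "e \<le> \<alpha> * X"
    using assms b unfolding e_def powr_def by simp
  have e2: "e \<le> 1" by (simp add: e_def)
  have e0: "0 \<le> e" using assms b by (simp add: e_def powr_le1)
  have "e \<le> (\<alpha> * X) powr \<tau>"
  proof (cases "\<alpha> * X \<ge> 1")
    case True
    then show ?thesis using e2 assms ge_one_powr_ge_zero[of "\<alpha> * X" \<tau>] by simp
  next
    case False
    then have "(\<alpha> * X) powr 1 \<le> (\<alpha> * X) powr \<tau>"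
      using assms X by (intro powr_mono') auto
    then show ?thesis using e1 X assms by simp
  qed
  also have "\<dots> \<le> (\<alpha> * d / a) powr \<tau>"
    using assms X by (intro powr_mono2) (auto simp: X_def divide_right_mono mult_left_mono)
  also have "\<dots> = (\<alpha> * d) powr \<tau> * a powr (-\<tau>)"
    using assms by (simp add: powr_divide powr_minus_divide)
  finally have e: "e \<le> (\<alpha> * d) powr \<tau> * a powr (-\<tau>)" .
  have "a powr (-\<alpha>) - b powr (-\<alpha>) = a powr (-\<alpha>) * e"
    using assms b by (simp add: e_def powr_divide powr_minus field_simps)
  moreover have "0 \<le> a powr (-\<alpha>) * e" using e0 by simp
  ultimately have "\<bar>a powr (-\<alpha>) - b powr (-\<alpha>)\<bar> = a powr (-\<alpha>) * e" by simp
  also have "\<dots> \<le> a powr (-\<alpha>) * ((\<alpha> * d) powr \<tau> * a powr (-\<tau>))"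
    using e by (intro mult_left_mono) auto
  also have "\<dots> = (\<alpha> * d) powr \<tau> * a powr (-(\<alpha> + \<tau>))"
    by (simp add: powr_add[symmetric] algebra_simps del: powr_minus)
  finally show ?thesis .
qed

lemma powr_minus_diff_le:
  fixes a b :: real
  assumes "0 < a" "0 < b" "\<bar>a - b\<bar> \<le> d" "0 < \<tau>" "\<tau> \<le> 1" "0 < \<alpha>"
  shows "\<bar>a powr (-\<alpha>) - b powr (-\<alpha>)\<bar>
    \<le> (\<alpha> * d) powr \<tau> * (a powr (-(\<alpha> + \<tau>)) + b powr (-(\<alpha> + \<tau>)))"
proof (cases "a \<le> b")
  case True
  have "\<bar>a powr (-\<alpha>) - b powr (-\<alpha>)\<bar> \<le> (\<alpha> * d) powr \<tau> * a powr (-(\<alpha> + \<tau>))"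
    using assms True by (intro powr_minus_diff_le_aux) auto
  also have "\<dots> \<le> (\<alpha> * d) powr \<tau> * (a powr (-(\<alpha> + \<tau>)) + b powr (-(\<alpha> + \<tau>)))"
    by (intro mult_left_mono) auto
  finally show ?thesis .
next
  case False
  have "\<bar>b powr (-\<alpha>) - a powr (-\<alpha>)\<bar> \<le> (\<alpha> * d) powr \<tau> * b powr (-(\<alpha> + \<tau>))"
    using assms False by (intro powr_minus_diff_le_aux) auto
  also have "\<dots> \<le> (\<alpha> * d) powr \<tau> * (a powr (-(\<alpha> + \<tau>)) + b powr (-(\<alpha> + \<tau>)))"
    by (intro mult_left_mono) auto
  finally show ?thesis by (simp add: abs_minus_commute)
qed

text \<open>At distance at least \<open>r\<close> from \<open>x\<close> one has
  \<open>norm z \<le> (1 + R / r) * norm (x - z)\<close>, so \<open>1 + norm z powr \<alpha>\<close>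
  is at most a constant times \<open>norm (x - z) powr \<alpha>\<close>. The constant is uniform
  over \<open>norm x \<le> R\<close>, so membership in \<open>L1w\<close> controls every tail at
  once.\<close>

lemma norm_powr_le_weight:
  fixes x z :: "'a::euclidean_space"
  assumes "0 < s" "norm x \<le> R" "0 < r" "r \<le> norm (x - z)"
  shows "norm (x - z) powr (-(real DIM('a) + 2 * s))
    \<le> (r powr (-(real DIM('a) + 2 * s)) + (1 + R / r) powr (real DIM('a) + 2 * s)) * weight s z"
proof -
  define \<alpha> where "\<alpha> = real DIM('a) + 2 * s"
  have \<alpha>: "0 < \<alpha>" using assms by (simp add: \<alpha>_def add_nonneg_pos)
  let ?t = "norm (x - z)"
  have t: "0 < ?t" using assms by linarith
  have R: "0 \<le> R" using assms norm_ge_zero[of x] by linarith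
  have "norm z \<le> norm x + ?t" using norm_triangle_ineq4[of x "x - z"] by simp
  also have "\<dots> \<le> (1 + R / r) * ?t"
  proof -
    have "R * r \<le> R * ?t" using assms R by (intro mult_left_mono) auto
    then have "R \<le> R / r * ?t" using assms by (simp add: field_simps)
    then show ?thesis using assms by (simp add: algebra_simps)
  qed
  finally have "norm z powr \<alpha> \<le> ((1 + R / r) * ?t) powr \<alpha>"
    using \<alpha> by (intro powr_mono2) auto
  also have "\<dots> = (1 + R / r) powr \<alpha> * ?t powr \<alpha>"
    using R assms by (simp add: powr_mult)
  finally have 1: "norm z powr \<alpha> \<le> (1 + R / r) powr \<alpha> * ?t powr \<alpha>" .
  have "r powr \<alpha> \<le> ?t powr \<alpha>" using assms \<alpha> by (intro powr_mono2) auto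
  then have "1 \<le> r powr (-\<alpha>) * ?t powr \<alpha>" using assms by (simp add: powr_minus field_simps)
  with 1 have "1 + norm z powr \<alpha> \<le> (r powr (-\<alpha>) + (1 + R / r) powr \<alpha>) * ?t powr \<alpha>"
    by (simp add: algebra_simps)
  then have "?t powr (-\<alpha>) * (1 + norm z powr \<alpha>) \<le> r powr (-\<alpha>) + (1 + R / r) powr \<alpha>"
    using t by (simp add: powr_minus field_simps)
  moreover have "0 < 1 + norm z powr \<alpha>" by (simp add: add_pos_nonneg)
  ultimately show ?thesis unfolding weight_def \<alpha>_def[symmetric]
    by (simp add: field_simps)
qed

section \<open>Uniform bounds for singular integrals\<close>

lemma L1w_measurable:
  assumes "h \<in> L1w s" shows "h \<in> borel_measurable lebesgue"
proof -
  have "(\<lambda>x. h x * weight s x) \<in> borel_measurable lebesgue"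
    using assms by (auto simp: L1w_def)
  moreover have "weight s \<in> borel_measurable lebesgue"
    by (intro measurable_completion) simp
  ultimately have "(\<lambda>x. h x * weight s x / weight s x) \<in> borel_measurable lebesgue"
    by (rule borel_measurable_divide)
  moreover have "weight s x \<noteq> 0" for x :: 'a
    using add_pos_nonneg[of 1 "norm x powr (real DIM('a) + 2 * s)"] by (simp add: weight_def)
  ultimately show ?thesis by simp
qed

lemma norm_powr_measurable [measurable]:
  "(\<lambda>z::'a::euclidean_space. norm (x - z) powr c) \<in> borel_measurable lebesgue"
  by (intro measurable_completion) simp

text \<open>Near \<open>x\<close> the quadratic decay of \<open>g\<close> leaves a singularity of
  order \<open>DIM('a) + 2 * s + \<tau> - 2\<close>, which is below the dimension because
  \<open>\<tau> < 2 - 2 * s\<close>; far from \<open>x\<close> the weight takes over.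
  \<open>D\<close> is independent of \<open>x\<close> and \<open>g\<close>. The spare exponent
  \<open>\<tau>\<close> is what later buys a power of \<open>norm (x - y)\<close> when two kernels
  are compared.\<close>

lemma kernel_bound:
  fixes h :: "'a::euclidean_space \<Rightarrow> real"
  assumes s: "0 < s" and \<tau>: "0 \<le> \<tau>" "\<tau> < 2 - 2 * s" and r: "0 < r"
    and C: "0 \<le> C" and A: "0 \<le> A" and h: "h \<in> L1w s"
  shows "\<exists>D. \<forall>x g. norm x \<le> R \<longrightarrow> g \<in> borel_measurable lebesgue \<longrightarrow>
      (\<forall>z. 0 \<le> g z \<and> g z \<le> A + \<bar>h z\<bar>) \<longrightarrow> (\<forall>z. norm (x - z) < r \<longrightarrow> g z \<le> C * norm (x - z) ^ 2) \<longrightarrow>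
      integrable lebesgue (\<lambda>z. g z * norm (x - z) powr (-(real DIM('a) + 2 * s + \<tau>))) \<and>
      (LINT z|lebesgue. g z * norm (x - z) powr (-(real DIM('a) + 2 * s + \<tau>))) \<le> D"
proof -
  define \<alpha> where "\<alpha> = real DIM('a) + 2 * s"
  define C0 where "C0 = r powr (-\<tau>) * (r powr (-\<alpha>) + (1 + R / r) powr \<alpha>)"
  define j where "j w = indicator (cball 0 r) w * norm w powr (-(\<alpha> + \<tau> - 2))" for w :: 'a
  have C0: "0 \<le> C0" by (simp add: C0_def)
  have j: "integrable lborel j"
    unfolding j_def by (rule integrable_norm_powr_cball) (use r \<tau> in \<open>auto simp: \<alpha>_def\<close>)
  then have jm: "j \<in> borel_measurable borel" by simp
  have jx: "integrable lebesgue (\<lambda>z. j (x - z))" for x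
    using integrable_lborel_reflect[OF jm, of x] j jm by (subst integrable_completion) auto
  \<comment> \<open>Reflection invariance of Lebesgue measure makes the singular part independent of
    \<open>x\<close>, which gives the uniformity.\<close>
  have jI: "(LINT z|lebesgue. j (x - z)) = (LINT z|lborel. j z)" for x
    using integral_lborel_reflect[OF jm, of x] jm by (subst integral_completion) auto
  have w: "integrable lebesgue (weight s :: 'a \<Rightarrow> real)"
    using integrable_weight[OF s] by (subst integrable_completion) auto
  have hw: "integrable lebesgue (\<lambda>z. \<bar>h z\<bar> * weight s z)"
    using h Bochner_Integration.integrable_abs[of lebesgue "\<lambda>z. h z * weight s z"]
    by (simp add: L1w_def abs_mult weight_nonneg)
  define D where "D = C * (LINT z|lborel. j z)
     + C0 * (A * (LINT z|lebesgue. weight s (z::'a)) + (LINT z|lebesgue. \<bar>h z\<bar> * weight s z))"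
  show ?thesis
  proof (intro exI[of _ D] allI impI)
    fix x g
    assume x: "norm x \<le> R" and g0: "g \<in> borel_measurable lebesgue" "\<forall>z. 0 \<le> g z \<and> g z \<le> A + \<bar>h z\<bar>"
      "\<forall>z. norm (x - z) < r \<longrightarrow> g z \<le> C * norm (x - z) ^ 2"
    then have g: "g \<in> borel_measurable lebesgue" "\<And>z. 0 \<le> g z"
      "\<And>z. g z \<le> A + \<bar>h z\<bar>" "\<And>z. norm (x - z) < r \<Longrightarrow> g z \<le> C * norm (x - z) ^ 2" by auto
    let ?f = "\<lambda>z. C * j (x - z) + C0 * (A * weight s z + \<bar>h z\<bar> * weight s z)"
    have f: "integrable lebesgue ?f"
      by (intro Bochner_Integration.integrable_add integrable_mult_right jx w hw)
    have fI: "integral\<^sup>L lebesgue ?f = D"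
      by (simp add: D_def jx w hw jI)
    have bound: "g z * norm (x - z) powr (-(\<alpha> + \<tau>)) \<le> ?f z" for z
    proof (cases "norm (x - z) < r")
      case True
      have nn: "0 \<le> C0 * (A * weight s z + \<bar>h z\<bar> * weight s z)"
        using C0 A by (simp add: weight_nonneg)
      have "g z * norm (x - z) powr (-(\<alpha> + \<tau>)) \<le> C * norm (x - z) ^ 2 * norm (x - z) powr (-(\<alpha> + \<tau>))"
        using g(4)[OF True] by (intro mult_right_mono) auto
      also have "\<dots> = C * j (x - z)"
      proof (cases "x = z")
        case False
        then have "norm (x - z) ^ 2 * norm (x - z) powr (-(\<alpha> + \<tau>)) = norm (x - z) powr (2 + -(\<alpha> + \<tau>))"
          unfolding powr_add by simp
        also have "2 + -(\<alpha> + \<tau>) = -(\<alpha> + \<tau> - 2)" by simp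
        finally have "norm (x - z) ^ 2 * norm (x - z) powr (-(\<alpha> + \<tau>)) = norm (x - z) powr (-(\<alpha> + \<tau> - 2))" .
        then show ?thesis using True by (simp add: j_def)
      qed (simp add: j_def)
      finally show ?thesis using nn by linarith
    next
      case False
      then have t: "r \<le> norm (x - z)" by simp
      have "norm (x - z) powr (-(\<alpha> + \<tau>)) = norm (x - z) powr (-\<tau>) * norm (x - z) powr (-\<alpha>)"
      proof -
        have "-(\<alpha> + \<tau>) = -\<tau> + -\<alpha>" by simp
        then show ?thesis by (simp only: powr_add)
      qed
      also have "\<dots> \<le> r powr (-\<tau>) * ((r powr (-\<alpha>) + (1 + R / r) powr \<alpha>) * weight s z)"
        using norm_powr_le_weight[OF s x r t] r t \<tau>
        by (intro mult_mono powr_mono2') (auto simp: \<alpha>_def)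
      also have "\<dots> = C0 * weight s z" by (simp add: C0_def)
      finally have "g z * norm (x - z) powr (-(\<alpha> + \<tau>)) \<le> (A + \<bar>h z\<bar>) * (C0 * weight s z)"
        using g A by (intro mult_mono) auto
      also have "\<dots> \<le> ?f z" using C by (simp add: j_def algebra_simps)
      finally show ?thesis .
    qed
    have int: "integrable lebesgue (\<lambda>z. g z * norm (x - z) powr (-(\<alpha> + \<tau>)))"
    proof (rule Bochner_Integration.integrable_bound[OF f])
      show "(\<lambda>z. g z * norm (x - z) powr (-(\<alpha> + \<tau>))) \<in> borel_measurable lebesgue"
        by (intro borel_measurable_times g(1) norm_powr_measurable)
      have "norm (g z * norm (x - z) powr (-(\<alpha> + \<tau>))) \<le> norm (?f z)" for z
        using bound[of z] g(2)[of z] by (simp add: abs_mult)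
      then show "AE z in lebesgue. norm (g z * norm (x - z) powr (-(\<alpha> + \<tau>))) \<le> norm (?f z)"
        by blast
    qed
    moreover have "(LINT z|lebesgue. g z * norm (x - z) powr (-(\<alpha> + \<tau>))) \<le> D"
      unfolding fI[symmetric] by (rule integral_mono[OF int f bound])
    ultimately show "integrable lebesgue (\<lambda>z. g z * norm (x - z) powr (-(real DIM('a) + 2 * s + \<tau>))) \<and>
      (LINT z|lebesgue. g z * norm (x - z) powr (-(real DIM('a) + 2 * s + \<tau>))) \<le> D"
      by (simp add: \<alpha>_def)
  qed
qed

lemma L1w_cmult: "h \<in> L1w s \<Longrightarrow> (\<lambda>x. c * h x) \<in> L1w s"
  using Bochner_Integration.integrable_mult_right[of c lebesgue "\<lambda>x. h x * weight s x"]
  by (simp add: L1w_def mult.assoc)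

lemma B_integrand_powr:
  "B_integrand s u v (x::'a::euclidean_space) z
    = (u x - u z) * (v x - v z) * norm (x - z) powr (-(real DIM('a) + 2 * s))"
  by (simp add: B_integrand_def powr_minus_divide del: minus_add_distrib)

lemma B_finiteI:
  fixes h :: "'a::euclidean_space \<Rightarrow> real"
  assumes s: "0 < s" "s < 1" and r: "0 < r"
    and \<phi>: "\<phi> \<in> borel_measurable lebesgue" "\<And>z. \<bar>\<phi> z\<bar> \<le> M"
    and h: "h \<in> L1w s"
    and near: "\<And>z. norm (x - z) < r \<Longrightarrow> \<bar>(\<phi> x - \<phi> z) * (h x - h z)\<bar> \<le> C * norm (x - z) ^ 2"
  shows "B_finite s \<phi> h x"
proof -
  let ?g = "\<lambda>z. \<bar>(\<phi> x - \<phi> z) * (h x - h z)\<bar>"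
  have M: "0 \<le> M" using \<phi>(2)[of x] by linarith
  have hm: "h \<in> borel_measurable lebesgue" using h by (rule L1w_measurable)
  have gm: "(\<lambda>z. (\<phi> x - \<phi> z) * (h x - h z)) \<in> borel_measurable lebesgue"
    by (intro borel_measurable_times borel_measurable_diff \<phi>(1) hm) auto
  have bd: "?g z \<le> 2 * M * \<bar>h x\<bar> + \<bar>2 * M * h z\<bar>" for z
  proof -
    have "?g z \<le> (2 * M) * (\<bar>h x\<bar> + \<bar>h z\<bar>)"
      unfolding abs_mult using \<phi>(2)[of x] \<phi>(2)[of z] M by (intro mult_mono) auto
    then show ?thesis using M by (simp add: abs_mult algebra_simps)
  qed
  have nr: "?g z \<le> \<bar>C\<bar> * norm (x - z) ^ 2" if "norm (x - z) < r" for z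
    by (rule order_trans[OF near[OF that]]) (intro mult_right_mono, auto)
  have "integrable lebesgue (\<lambda>z. ?g z * norm (x - z) powr (-(real DIM('a) + 2 * s + 0)))"
    \<comment> \<open>The bounded factor is absorbed into the data: \<open>kernel_bound\<close> is
      used with \<open>2 * M * h\<close> in place of \<open>h\<close>,
      \<open>2 * M * \<bar>h x\<bar>\<close> in place of \<open>A\<close>, and
      \<open>\<tau> = 0\<close>.\<close>
    using kernel_bound[OF s(1) order_refl _ r abs_ge_zero, of "2 * M * \<bar>h x\<bar>" "\<lambda>z. 2 * M * h z" "norm x" C]
      s M L1w_cmult[OF h] borel_measurable_abs[OF gm] bd nr by fastforce
  then have "integrable lebesgue (\<lambda>z. (\<phi> x - \<phi> z) * (h x - h z) * norm (x - z) powr (-(real DIM('a) + 2 * s)))"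
    by (rule Bochner_Integration.integrable_bound)
      (intro borel_measurable_times norm_powr_measurable borel_measurable_diff \<phi>(1) hm, auto simp: abs_mult)
  then show ?thesis by (simp add: B_finite_def B_integrand_powr[abs_def])
qed

text \<open>The difference of the two kernels is at most \<open>norm (x - y) powr (1 - s)\<close>,
  up to a constant, times the sum of the kernels with exponent raised by \<open>1 - s\<close>. Each
  of these is covered by \<open>kernel_bound\<close>; the equality \<open>h x = h y\<close> lets the
  same increments of \<open>h\<close> decay quadratically at both points.\<close>

lemma kernel_difference_bound:
  fixes h :: "'a::euclidean_space \<Rightarrow> real"
  assumes s: "0 < s" "s < 1" and r: "0 < r" and C: "0 \<le> C" and A: "0 \<le> A" and h: "h \<in> L1w s"
  shows "\<exists>D. \<forall>x y. norm x \<le> R \<longrightarrow> norm y \<le> R \<longrightarrow> h x = h y \<longrightarrow> \<bar>h x\<bar> \<le> A \<longrightarrow>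
      (\<forall>z. norm (x - z) < r \<longrightarrow> \<bar>h x - h z\<bar> \<le> C * norm (x - z) ^ 2) \<longrightarrow>
      (\<forall>z. norm (y - z) < r \<longrightarrow> \<bar>h y - h z\<bar> \<le> C * norm (y - z) ^ 2) \<longrightarrow>
      (LINT z|lebesgue. \<bar>h x - h z\<bar> * \<bar>norm (x - z) powr (-(real DIM('a) + 2 * s))
         - norm (y - z) powr (-(real DIM('a) + 2 * s))\<bar>) \<le> D * norm (x - y) powr (1 - s)"
proof -
  define \<alpha> where "\<alpha> = real DIM('a) + 2 * s"
  have \<alpha>: "0 < \<alpha>" using s by (simp add: \<alpha>_def add_nonneg_pos)
  \<comment> \<open>Half of the admissible range \<open>2 - 2 * s\<close>: positive, at most 1, and
    still integrable.\<close>
  define \<tau> where "\<tau> = 1 - s"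
  have hm: "h \<in> borel_measurable lebesgue" using h by (rule L1w_measurable)
  have \<tau>: "0 \<le> \<tau>" "\<tau> < 2 - 2 * s" "0 < \<tau>" "\<tau> \<le> 1" using s by (auto simp: \<tau>_def)
  obtain D where D: "\<forall>x g. norm x \<le> R \<longrightarrow> g \<in> borel_measurable lebesgue \<longrightarrow>
      (\<forall>z. 0 \<le> g z \<and> g z \<le> A + \<bar>h z\<bar>) \<longrightarrow> (\<forall>z. norm (x - z) < r \<longrightarrow> g z \<le> C * norm (x - z) ^ 2) \<longrightarrow>
      integrable lebesgue (\<lambda>z. g z * norm (x - z) powr (-(\<alpha> + \<tau>))) \<and>
      (LINT z|lebesgue. g z * norm (x - z) powr (-(\<alpha> + \<tau>))) \<le> D"
    unfolding \<alpha>_def using kernel_bound[OF s(1) \<tau>(1,2) r C A h, of R] ..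
  show ?thesis
  proof (intro exI[of _ "\<alpha> powr \<tau> * (D + D)"] allI impI)
    fix x y
    assume xy: "norm x \<le> R" "norm y \<le> R" "h x = h y" and A: "\<bar>h x\<bar> \<le> A"
      and x: "\<forall>z. norm (x - z) < r \<longrightarrow> \<bar>h x - h z\<bar> \<le> C * norm (x - z) ^ 2"
      and y: "\<forall>z. norm (y - z) < r \<longrightarrow> \<bar>h y - h z\<bar> \<le> C * norm (y - z) ^ 2"
    let ?g = "\<lambda>z. \<bar>h x - h z\<bar>"
    let ?k = "\<lambda>x z. ?g z * norm (x - z) powr (-(\<alpha> + \<tau>))"
    have g: "?g \<in> borel_measurable lebesgue" by (intro borel_measurable_abs borel_measurable_diff hm) auto
    have "?g z \<le> A + \<bar>h z\<bar>" for z using A by linarith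
    then have gA: "\<forall>z. 0 \<le> ?g z \<and> ?g z \<le> A + \<bar>h z\<bar>" by simp
    have Dx: "integrable lebesgue (?k x)" "integral\<^sup>L lebesgue (?k x) \<le> D"
      using D xy(1) g gA x by blast+
    have Dy: "integrable lebesgue (?k y)" "integral\<^sup>L lebesgue (?k y) \<le> D"
      using D xy(2) g gA y[folded xy(3)] by blast+
    let ?c = "(\<alpha> * norm (x - y)) powr \<tau>"
    let ?L = "\<lambda>z. ?g z * \<bar>norm (x - z) powr (-\<alpha>) - norm (y - z) powr (-\<alpha>)\<bar>"
    have i: "integrable lebesgue (\<lambda>z. ?c * (?k x z + ?k y z))"
      by (intro integrable_mult_right Bochner_Integration.integrable_add Dx Dy)
    have le: "?L z \<le> ?c * (?k x z + ?k y z)" for z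
    proof (cases "z = x \<or> z = y")
      case False
      have "\<bar>norm (x - z) - norm (y - z)\<bar> \<le> norm (x - y)"
        using norm_triangle_ineq3[of "x - z" "y - z"] by simp
      then have "\<bar>norm (x - z) powr (-\<alpha>) - norm (y - z) powr (-\<alpha>)\<bar>
          \<le> ?c * (norm (x - z) powr (-(\<alpha> + \<tau>)) + norm (y - z) powr (-(\<alpha> + \<tau>)))"
        using False \<tau> \<alpha> by (intro powr_minus_diff_le) auto
      then have "?L z \<le> ?g z * (?c * (norm (x - z) powr (-(\<alpha> + \<tau>)) + norm (y - z) powr (-(\<alpha> + \<tau>))))"
        by (intro mult_left_mono) auto
      also have "\<dots> = ?c * (?k x z + ?k y z)" by (simp only: distrib_left mult.assoc mult.left_commute)
      finally show ?thesis .
    qed (use xy in auto)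
    have "integrable lebesgue ?L"
    proof (rule Bochner_Integration.integrable_bound[OF i])
      show "?L \<in> borel_measurable lebesgue"
        by (intro borel_measurable_times borel_measurable_abs borel_measurable_diff g norm_powr_measurable)
      have "norm (?L z) \<le> norm (?c * (?k x z + ?k y z))" for z
        using le[of z] by (simp add: abs_mult)
      then show "AE z in lebesgue. norm (?L z) \<le> norm (?c * (?k x z + ?k y z))" by blast
    qed
    then have "integral\<^sup>L lebesgue ?L \<le> (LINT z|lebesgue. ?c * (?k x z + ?k y z))"
      by (intro integral_mono i le)
    also have "\<dots> = ?c * (integral\<^sup>L lebesgue (?k x) + integral\<^sup>L lebesgue (?k y))"
      using Dx(1) Dy(1) by simp
    also have "\<dots> \<le> ?c * (D + D)"
      using Dx(2) Dy(2) by (intro mult_left_mono) auto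
    also have "\<dots> = \<alpha> powr \<tau> * (D + D) * norm (x - y) powr (1 - s)"
      using \<alpha> by (simp add: powr_mult \<tau>_def)
    finally show "(LINT z|lebesgue. \<bar>h x - h z\<bar> * \<bar>norm (x - z) powr (-(real DIM('a) + 2 * s))
         - norm (y - z) powr (-(real DIM('a) + 2 * s))\<bar>)
         \<le> \<alpha> powr \<tau> * (D + D) * norm (x - y) powr (1 - s)"
      by (simp add: \<alpha>_def)
  qed
qed

subsection \<open>Functions of class \<open>C\<^sup>1\<close>\<close>

lemma Ck_on_1I:
  assumes "\<And>x. x \<in> S \<Longrightarrow> (f has_derivative f' x) (at x)"
    and "\<And>i. i \<in> Basis \<Longrightarrow> continuous_on S (\<lambda>x. f' x i)"
  shows "Ck_on 1 S f"
proof -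
  have "frechet_derivative f (at x) = f' x" if "x \<in> S" for x
    using frechet_derivative_at[OF assms(1)[OF that]] by simp
  then have "continuous_on S (\<lambda>x. frechet_derivative f (at x) i)" if "i \<in> Basis" for i
    using continuous_on_cong[OF refl, THEN iffD2, OF _ assms(2)[OF that]] by auto
  then show ?thesis
    using assms(1) by (auto simp: differentiable_def)
qed

lemma Ck_on_1E:
  assumes "Ck_on 1 S f"
  obtains f' where "\<And>x. x \<in> S \<Longrightarrow> (f has_derivative f' x) (at x)"
    "\<And>i. i \<in> Basis \<Longrightarrow> continuous_on S (\<lambda>x. f' x i)"
  using that[of "\<lambda>x. frechet_derivative f (at x)"] assms
  by (auto simp: frechet_derivative_works)

lemma Ck_on_1_imp_continuous_on: "Ck_on 1 S f \<Longrightarrow> continuous_on S f"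
  by (metis Ck_on_1E continuous_at_imp_continuous_on has_derivative_continuous)

lemma Ck_on_1_const: "Ck_on 1 S (\<lambda>x. c)"
  by (rule Ck_on_1I[where f'="\<lambda>x h. 0"]) auto

lemma Ck_on_1_bounded_linear: "bounded_linear f \<Longrightarrow> Ck_on 1 S f"
  by (rule Ck_on_1I[where f'="\<lambda>x. f"]) (auto intro: bounded_linear_imp_has_derivative)

lemma Ck_on_1_add:
  assumes "Ck_on 1 S f" "Ck_on 1 S g"
  shows "Ck_on 1 S (\<lambda>x. f x + g x)"
proof -
  obtain f' where f: "\<And>x. x \<in> S \<Longrightarrow> (f has_derivative f' x) (at x)"
    "\<And>i. i \<in> Basis \<Longrightarrow> continuous_on S (\<lambda>x. f' x i)" using Ck_on_1E[OF assms(1)] by blast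
  obtain g' where g: "\<And>x. x \<in> S \<Longrightarrow> (g has_derivative g' x) (at x)"
    "\<And>i. i \<in> Basis \<Longrightarrow> continuous_on S (\<lambda>x. g' x i)" using Ck_on_1E[OF assms(2)] by blast
  show ?thesis
    by (rule Ck_on_1I[where f'="\<lambda>x h. f' x h + g' x h"])
      (rule has_derivative_add continuous_on_add f g | assumption)+
qed

lemma Ck_on_1_mult:
  assumes "Ck_on 1 S f" "Ck_on 1 S g"
  shows "Ck_on 1 S (\<lambda>x. f x * g x)"
proof -
  obtain f' where f: "\<And>x. x \<in> S \<Longrightarrow> (f has_derivative f' x) (at x)"
    "\<And>i. i \<in> Basis \<Longrightarrow> continuous_on S (\<lambda>x. f' x i)" using Ck_on_1E[OF assms(1)] by blast
  obtain g' where g: "\<And>x. x \<in> S \<Longrightarrow> (g has_derivative g' x) (at x)"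
    "\<And>i. i \<in> Basis \<Longrightarrow> continuous_on S (\<lambda>x. g' x i)" using Ck_on_1E[OF assms(2)] by blast
  show ?thesis
    by (rule Ck_on_1I[where f'="\<lambda>x h. f x * g' x h + f' x h * g x"])
      (rule has_derivative_mult continuous_on_add continuous_on_mult f g
        Ck_on_1_imp_continuous_on assms | assumption)+
qed

lemma Ck_on_1_compose:
  fixes f :: "'a::euclidean_space \<Rightarrow> real"
  assumes "Ck_on 1 S f" "\<And>x. x \<in> S \<Longrightarrow> (\<phi> has_real_derivative \<phi>' (f x)) (at (f x))"
    and "continuous_on (f ` S) \<phi>'"
  shows "Ck_on 1 S (\<lambda>x. \<phi> (f x))"
proof -
  obtain f' where f: "\<And>x. x \<in> S \<Longrightarrow> (f has_derivative f' x) (at x)"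
    "\<And>i. i \<in> Basis \<Longrightarrow> continuous_on S (\<lambda>x. f' x i)" using Ck_on_1E[OF assms(1)] by blast
  have "continuous_on S (\<lambda>x. \<phi>' (f x))"
    using continuous_on_compose[OF Ck_on_1_imp_continuous_on[OF assms(1)] assms(3)] by (simp add: o_def)
  then show ?thesis
    by (intro Ck_on_1I[where f'="\<lambda>x h. \<phi>' (f x) * f' x h"])
      (rule continuous_on_mult f has_derivative_compose[OF f(1) assms(2)[unfolded has_field_derivative_def]]
        | assumption)+
qed

lemma Ck_on_1_cong:
  assumes "open S" "Ck_on 1 S f" "\<And>x. x \<in> S \<Longrightarrow> f x = g x"
  shows "Ck_on 1 S g"
proof -
  obtain f' where f: "\<And>x. x \<in> S \<Longrightarrow> (f has_derivative f' x) (at x)"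
    "\<And>i. i \<in> Basis \<Longrightarrow> continuous_on S (\<lambda>x. f' x i)" using Ck_on_1E[OF assms(2)] by blast
  show ?thesis
    by (rule Ck_on_1I[where f'=f'])
      (rule has_derivative_transform_within_open[OF f(1) assms(1)] f(2) assms(3) | assumption)+
qed

lemma Ck_on_1_real_polynomial_function:
  fixes p :: "'a::euclidean_space \<Rightarrow> real"
  shows "real_polynomial_function p \<Longrightarrow> Ck_on 1 S p"
  by (induction rule: real_polynomial_function.induct)
    (simp_all only: Ck_on_1_const Ck_on_1_bounded_linear Ck_on_1_add Ck_on_1_mult)

lemma Ck_on_1_norm_square: "Ck_on 1 S (\<lambda>z::'a::euclidean_space. (norm (z - y))\<^sup>2)"
  by (rule Ck_on_1I[where f'="\<lambda>x h. 2 * ((x - y) \<bullet> h)"])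
    (auto simp: power2_norm_eq_inner inner_commute intro!: derivative_eq_intros continuous_intros)

text \<open>Composed with a quadratic polynomial, this gives bumps of class \<open>C^1\<close>
  supported in a prescribed ball. At 0 the difference quotient is bounded by
  \<open>\<bar>t\<bar>\<close>.\<close>

lemma DERIV_pos_part_square: "((\<lambda>t. (max 0 t)\<^sup>2) has_real_derivative 2 * max 0 t) (at t)"
proof (cases t "0::real" rule: linorder_cases)
  case less
  have "((\<lambda>t. 0) has_real_derivative 2 * max 0 t) (at t)" using less by simp
  then show ?thesis
    by (rule has_field_derivative_transform_within_open[of _ _ _ "{..<0}"]) (use less in auto)
next
  case greater
  have "((\<lambda>t. t\<^sup>2) has_real_derivative 2 * max 0 t) (at t)"
    using greater by (auto intro!: derivative_eq_intros)
  then show ?thesis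
    by (rule has_field_derivative_transform_within_open[of _ _ _ "{0<..}"]) (use greater in auto)
next
  case equal
  have "((\<lambda>t::real. (max 0 t)\<^sup>2 / t) \<longlongrightarrow> 0) (at 0)"
  proof (rule Lim_null_comparison)
    show "((\<lambda>t::real. \<bar>t\<bar>) \<longlongrightarrow> 0) (at 0)" by (auto intro: tendsto_eq_intros)
    show "\<forall>\<^sub>F t in at 0. norm ((max 0 t)\<^sup>2 / t) \<le> \<bar>t::real\<bar>"
      by (intro always_eventually) (auto simp: max_def power2_eq_square)
  qed
  then show ?thesis using equal by (simp add: has_field_derivative_iff)
qed

lemma has_derivative_lipschitz_bound:
  fixes f :: "'a::euclidean_space \<Rightarrow> real"
  assumes "convex T" "\<And>x. x \<in> T \<Longrightarrow> (f has_derivative f' x) (at x)"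
    and "\<And>x. x \<in> T \<Longrightarrow> (\<Sum>i\<in>Basis. \<bar>f' x i\<bar>) \<le> B" "x \<in> T" "y \<in> T"
  shows "\<bar>f x - f y\<bar> \<le> B * norm (x - y)"
proof -
  have "norm (f x - f y) \<le> B * norm (x - y)"
  proof (rule differentiable_bound[OF assms(1)])
    fix z assume z: "z \<in> T"
    show "(f has_derivative f' z) (at z within T)"
      using assms(2)[OF z] by (rule has_derivative_at_withinI)
    show "onorm (f' z) \<le> B"
      using onorm_componentwise[OF has_derivative_bounded_linear[OF assms(2)[OF z]]] assms(3)[OF z]
      by simp
  qed (use assms in auto)
  then show ?thesis by simp
qed

lemma Ck_on_1_lipschitz:
  fixes f :: "'a::euclidean_space \<Rightarrow> real"
  assumes "Ck_on 1 S f" "T \<subseteq> S" "compact T" "convex T"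
  obtains L where "0 \<le> L" "\<And>x y. x \<in> T \<Longrightarrow> y \<in> T \<Longrightarrow> \<bar>f x - f y\<bar> \<le> L * norm (x - y)"
proof -
  obtain f' where f: "\<And>x. x \<in> S \<Longrightarrow> (f has_derivative f' x) (at x)"
    "\<And>i. i \<in> Basis \<Longrightarrow> continuous_on S (\<lambda>x. f' x i)" using Ck_on_1E[OF assms(1)] by blast
  have "continuous_on T (\<lambda>x. \<Sum>i\<in>Basis. \<bar>f' x i\<bar>)"
    using assms(2) f(2) by (intro continuous_intros) (auto intro: continuous_on_subset)
  then have "bounded ((\<lambda>x. \<Sum>i\<in>Basis. \<bar>f' x i\<bar>) ` T)"
    using assms(3) by (intro compact_imp_bounded compact_continuous_image)
  then obtain B where "\<forall>w\<in>(\<lambda>x. \<Sum>i\<in>Basis. \<bar>f' x i\<bar>) ` T. norm w \<le> B"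
    unfolding bounded_iff ..
  then have B: "(\<Sum>i\<in>Basis. \<bar>f' x i\<bar>) \<le> B" if "x \<in> T" for x
    using that by force
  show thesis
  proof (rule that[of "max 0 B"])
    fix x y assume "x \<in> T" "y \<in> T"
    then show "\<bar>f x - f y\<bar> \<le> max 0 B * norm (x - y)"
      using B f(1) assms by (intro has_derivative_lipschitz_bound[of T f f']) (auto intro: max.coboundedI2)
  qed simp
qed

text \<open>At a global extremum the gradient vanishes. Its components are Lipschitz on bounded
  sets, so on the ball around \<open>x\<close> through \<open>z\<close> the gradient is at most
  \<open>C * norm (x - z)\<close>, and the mean value inequality contributes the second
  factor.\<close>

lemma Ck_on_2_extremum_bound:
  fixes h :: "'a::euclidean_space \<Rightarrow> real"
  assumes "Ck_on 2 UNIV h"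
  obtains C where "0 \<le> C" "\<And>x z. norm x \<le> R \<Longrightarrow> (\<forall>z. h z \<le> h x) \<or> (\<forall>z. h x \<le> h z) \<Longrightarrow>
    norm (x - z) < 1 \<Longrightarrow> \<bar>h x - h z\<bar> \<le> C * (norm (x - z))\<^sup>2"
proof -
  define h' where "h' x = frechet_derivative h (at x)" for x
  have h: "(h has_derivative h' x) (at x)" for x
    using assms by (simp add: numeral_2_eq_2 frechet_derivative_works h'_def)
  have Ck: "Ck_on 1 UNIV (\<lambda>x. h' x i)" if "i \<in> Basis" for i
    using assms that by (simp add: numeral_2_eq_2 h'_def)
  \<comment> \<open>The radius \<open>R + 1\<close> contains every point within distance 1 of
    \<open>cball 0 R\<close>, so a single \<open>C\<close> serves all extrema there.\<close>
  have "\<exists>L. 0 \<le> L \<and> (\<forall>x\<in>cball 0 (R + 1). \<forall>y\<in>cball 0 (R + 1). \<bar>h' x i - h' y i\<bar> \<le> L * norm (x - y))"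
    if "i \<in> Basis" for i
    by (rule Ck_on_1_lipschitz[OF Ck[OF that], of "cball 0 (R + 1)"]) auto
  then obtain L where L: "\<And>i. i \<in> Basis \<Longrightarrow> 0 \<le> L i"
    "\<And>i x y. i \<in> Basis \<Longrightarrow> x \<in> cball 0 (R + 1) \<Longrightarrow> y \<in> cball 0 (R + 1) \<Longrightarrow> \<bar>h' x i - h' y i\<bar> \<le> L i * norm (x - y)"
    by metis
  define C where "C = (\<Sum>i\<in>Basis. L i)"
  have C: "0 \<le> C" unfolding C_def by (intro sum_nonneg L)
  show thesis
  proof (rule that[OF C])
    fix x z assume x: "norm x \<le> R" and ext: "(\<forall>z. h z \<le> h x) \<or> (\<forall>z. h x \<le> h z)" and z: "norm (x - z) < 1"
    have zero: "h' x = (\<lambda>v. 0)"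
      using differential_zero_maxmin[of x UNIV h "h' x"] h ext by auto
    have "\<bar>h x - h z\<bar> \<le> (C * norm (x - z)) * norm (x - z)"
    proof (rule has_derivative_lipschitz_bound[of "cball x (norm (x - z))" h h'])
      fix w assume "w \<in> cball x (norm (x - z))"
      then have w: "norm (w - x) \<le> norm (x - z)" by (simp add: dist_norm norm_minus_commute)
      have "norm w \<le> R + 1" using w x z norm_triangle_ineq2[of w x] by linarith
      then have "\<bar>h' w i\<bar> \<le> L i * norm (x - z)" if "i \<in> Basis" for i
        using L(2)[OF that, of w x] zero x mult_left_mono[OF w L(1)[OF that]] by simp
      then have "(\<Sum>i\<in>Basis. \<bar>h' w i\<bar>) \<le> (\<Sum>i\<in>Basis. L i * norm (x - z))" by (rule sum_mono)
      then show "(\<Sum>i\<in>Basis. \<bar>h' w i\<bar>) \<le> C * norm (x - z)" by (simp add: C_def sum_distrib_right)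
    qed (use h in \<open>auto simp: dist_norm\<close>)
    then show "\<bar>h x - h z\<bar> \<le> C * (norm (x - z))\<^sup>2" by (simp add: power2_eq_square)
  qed
qed

text \<open>Differentiation only changes the amplitude and shifts the phase by
  \<open>pi / 2\<close>, so the family is closed under partial derivatives and the induction
  generalises over \<open>c\<close> and \<open>b\<close>. Such functions later serve as explicit
  choices of \<open>h\<close>.\<close>

lemma smooth_cos: "smooth (\<lambda>z::'a::euclidean_space. c * cos (a \<bullet> z + b))"
proof -
  have "Ck_on k UNIV (\<lambda>z. c * cos (a \<bullet> z + b))" for k
  proof (induction k arbitrary: c b)
    case 0
    show ?case by (auto intro!: continuous_intros)
  next
    case (Suc k)
    have D: "((\<lambda>z. c * cos (a \<bullet> z + b)) has_derivative (\<lambda>i. (c * (a \<bullet> i)) * cos (a \<bullet> x + (b + pi / 2)))) (at x)"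
      for x
      by (auto intro!: derivative_eq_intros simp: cos_add sin_add algebra_simps)
    have "frechet_derivative (\<lambda>z. c * cos (a \<bullet> z + b)) (at x) = (\<lambda>i. (c * (a \<bullet> i)) * cos (a \<bullet> x + (b + pi / 2)))" for x
      using frechet_derivative_at[OF D] by simp
    then show ?case using D Suc.IH by (auto simp: differentiable_def)
  qed
  then show ?thesis by (simp add: smooth_def)
qed

subsection \<open>Test functions for \<open>D\<^sub>s\<close>\<close>

text \<open>A rational profile of width \<open>1 / n\<close>. Unlike a quadratic penalty,
  \<open>K * (1 - bump n y z)\<close> stays bounded by \<open>K\<close>, so the test functions built
  from it are bounded.\<close>

definition bump :: "real \<Rightarrow> 'a::euclidean_space \<Rightarrow> 'a \<Rightarrow> real" where
  "bump n y z = 1 / (1 + n\<^sup>2 * (norm (z - y))\<^sup>2)"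

lemma bump_bounds: "0 < bump n y z" "bump n y z \<le> 1"
  by (auto simp: bump_def add_pos_nonneg divide_le_eq_1)

lemma bump_self [simp]: "bump n y y = 1"
  by (simp add: bump_def)

lemma bump_commute: "bump n y z = bump n z y"
  by (simp add: bump_def norm_minus_commute)

lemma Ck_on_1_bump: "Ck_on 1 S (bump n (y::'a::euclidean_space))"
proof -
  have "Ck_on 1 S (\<lambda>z. 1 + n\<^sup>2 * (norm (z - y))\<^sup>2)"
    by (rule Ck_on_1_add Ck_on_1_const Ck_on_1_mult Ck_on_1_norm_square)+
  then show ?thesis unfolding bump_def[abs_def]
  proof (rule Ck_on_1_compose[where \<phi>="\<lambda>t. 1 / t" and \<phi>'="\<lambda>t. - (1 / t\<^sup>2)"])
    have pos: "1 + n\<^sup>2 * (norm (z - y))\<^sup>2 \<noteq> 0" for z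
      using add_pos_nonneg[of 1 "n\<^sup>2 * (norm (z - y))\<^sup>2"] by simp
    show "((\<lambda>t. 1 / t) has_real_derivative - (1 / (1 + n\<^sup>2 * (norm (z - y))\<^sup>2)\<^sup>2))
        (at (1 + n\<^sup>2 * (norm (z - y))\<^sup>2))" for z
      using pos[of z] by (auto intro!: derivative_eq_intros simp: power2_eq_square)
    show "continuous_on ((\<lambda>z. 1 + n\<^sup>2 * (norm (z - y))\<^sup>2) ` S) (\<lambda>t. - (1 / t\<^sup>2))"
      using pos by (intro continuous_intros) auto
  qed
qed

lemma continuous_on_bump [continuous_intros]:
  "continuous_on S f \<Longrightarrow> continuous_on S g \<Longrightarrow> continuous_on S (\<lambda>x. bump n (f x) (g x))"
  unfolding bump_def
  by (intro continuous_intros) (auto simp: add_pos_nonneg less_imp_neq[symmetric])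

text \<open>In the scaled distances \<open>a\<close> and \<open>b\<close> the difference factors as
  \<open>b - a\<close> times a quotient, and \<open>2 * t \<le> 1 + t\<^sup>2\<close> bounds this
  quotient by 1.\<close>

lemma bump_diff_le:
  assumes "0 \<le> n"
  shows "\<bar>bump n y z - bump n y z'\<bar> \<le> n * norm (z - z')"
proof -
  define a b where "a = n * norm (z - y)" and "b = n * norm (z' - y)"
  have ab: "0 \<le> a" "0 \<le> b" using assms by (auto simp: a_def b_def)
  have pos: "0 < 1 + a\<^sup>2" "0 < 1 + b\<^sup>2" by (auto simp: add_pos_nonneg)
  have "bump n y z - bump n y z' = (b - a) * ((a + b) / ((1 + a\<^sup>2) * (1 + b\<^sup>2)))"
  proof -
    have "bump n y z - bump n y z' = 1 / (1 + a\<^sup>2) - 1 / (1 + b\<^sup>2)"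
      by (simp add: bump_def a_def b_def power_mult_distrib)
    also have "\<dots> = (b\<^sup>2 - a\<^sup>2) / ((1 + a\<^sup>2) * (1 + b\<^sup>2))"
      using pos by (simp add: field_simps)
    also have "b\<^sup>2 - a\<^sup>2 = (b - a) * (a + b)" by (simp add: power2_eq_square algebra_simps)
    finally show ?thesis by simp
  qed
  moreover have "(a + b) / ((1 + a\<^sup>2) * (1 + b\<^sup>2)) \<le> 1"
  proof -
    have "0 \<le> (a - 1)\<^sup>2" "0 \<le> (b - 1)\<^sup>2" by auto
    then have "2 * a \<le> 1 + a\<^sup>2" "2 * b \<le> 1 + b\<^sup>2" by (simp_all add: power2_diff)
    moreover have "0 \<le> a\<^sup>2" "0 \<le> b\<^sup>2" "0 \<le> a\<^sup>2 * b\<^sup>2" by auto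
    moreover have "(1 + a\<^sup>2) * (1 + b\<^sup>2) = 1 + a\<^sup>2 + b\<^sup>2 + a\<^sup>2 * b\<^sup>2" by (simp add: algebra_simps)
    ultimately have "a + b \<le> (1 + a\<^sup>2) * (1 + b\<^sup>2)" by linarith
    then show ?thesis using pos by (simp add: divide_le_eq_1)
  qed
  moreover have "0 \<le> (a + b) / ((1 + a\<^sup>2) * (1 + b\<^sup>2))" using ab pos by simp
  ultimately have "\<bar>bump n y z - bump n y z'\<bar> \<le> \<bar>b - a\<bar>"
    unfolding abs_mult by (simp only: abs_mult abs_of_nonneg mult_left_le abs_ge_zero)
  also have "\<bar>b - a\<bar> = n * \<bar>norm (z' - y) - norm (z - y)\<bar>"
    using assms by (simp add: a_def b_def abs_mult right_diff_distrib[symmetric])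
  also have "\<dots> \<le> n * norm (z - z')"
    using norm_triangle_ineq3[of "z' - y" "z - y"] assms
    by (intro mult_left_mono) (auto simp: norm_minus_commute)
  finally show ?thesis .
qed

text \<open>Interpolation between the Lipschitz bound at small scaled distance and the trivial bound
  1 at large distance. A smaller exponent means slower growth in \<open>n\<close>.\<close>

lemma bump_diff_le_powr:
  assumes "0 \<le> n" "0 \<le> a" "a \<le> 1"
  shows "\<bar>bump n y z - bump n y z'\<bar> \<le> (n * norm (z - z')) powr a"
proof (cases "n * norm (z - z') = 0")
  case True
  then show ?thesis using bump_diff_le[OF assms(1), of y z z'] by auto
next
  case False
  then have pos: "0 < n * norm (z - z')" using assms by (simp add: less_le)
  show ?thesis
  proof (cases "n * norm (z - z') \<le> 1")
    case True
    then have "(n * norm (z - z')) powr 1 \<le> (n * norm (z - z')) powr a"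
      using assms pos by (intro powr_mono') auto
    then show ?thesis using bump_diff_le[OF assms(1), of y z z'] pos by simp
  next
    case False
    then have "1 \<le> (n * norm (z - z')) powr a" using assms by (intro ge_one_powr_ge_zero) auto
    moreover have "\<bar>bump n y z - bump n y z'\<bar> \<le> 1"
      using bump_bounds[of n y z] bump_bounds[of n y z'] by linarith
    ultimately show ?thesis by linarith
  qed
qed

text \<open>A vanishing integral would make \<open>f\<close> zero almost everywhere, but a nonempty
  open set is not null.\<close>

lemma integral_pos_open:
  fixes f :: "'a::euclidean_space \<Rightarrow> real"
  assumes f: "integrable lebesgue f" "\<And>z. 0 \<le> f z" and U: "open U" "U \<noteq> {}" "\<And>z. z \<in> U \<Longrightarrow> 0 < f z"
  shows "0 < (LINT z|lebesgue. f z)"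
proof (rule ccontr)
  assume "\<not> 0 < (LINT z|lebesgue. f z)"
  moreover have "0 \<le> (LINT z|lebesgue. f z)"
    by (rule Bochner_Integration.integral_nonneg) (rule f(2))
  ultimately have "(LINT z|lebesgue. f z) = 0" by linarith
  then have "AE z in lebesgue. f z = 0"
    using integral_nonneg_eq_0_iff_AE[OF f(1)] f(2) by simp
  then have "AE z in lebesgue. z \<notin> U"
    by eventually_elim (use U(3) in force)
  then have "U \<in> null_sets lebesgue"
    using AE_iff_null_sets[of U lebesgue] U(1) by simp
  then show False using open_not_negligible[OF U(1,2)] by (simp add: negligible_iff_null_sets)
qed

lemma frac_lap_const_pos:
  assumes "0 < s" "s < 1" "0 < N" shows "0 < frac_lap_const N s"
  unfolding frac_lap_const_def using assms
  by (intro divide_pos_pos mult_pos_pos Gamma_real_pos) auto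

lemma C1_L1w_uminus: "\<phi> \<in> C1_L1w s \<Omega> \<Longrightarrow> (\<lambda>z. - \<phi> z) \<in> C1_L1w s \<Omega>"
  using Ck_on_1_mult[OF Ck_on_1_const, of \<Omega> \<phi> "-1"] L1w_cmult[of \<phi> s "-1"]
  by (simp add: C1_L1w_def)

text \<open>Regularity is a local property on the open set \<open>\<Omega>\<close>, so exterior
  values can be prescribed freely among bounded measurable ones, even with a jump across the
  boundary.\<close>

lemma C1_L1w_piecewise:
  fixes \<Omega> :: "'a::euclidean_space set"
  assumes "0 < s" "open \<Omega>" "Ck_on 1 \<Omega> g" "u \<in> borel_measurable lebesgue"
    and "\<And>z. z \<in> \<Omega> \<Longrightarrow> \<bar>g z\<bar> \<le> M" "\<And>z. z \<notin> \<Omega> \<Longrightarrow> \<bar>u z\<bar> \<le> M"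
  defines "\<phi> \<equiv> \<lambda>z. if z \<in> \<Omega> then g z else u z"
  shows "\<phi> \<in> borel_measurable lebesgue" "\<And>z. \<bar>\<phi> z\<bar> \<le> M" "\<phi> \<in> C1_L1w s \<Omega>"
proof -
  have O: "\<Omega> \<in> sets lebesgue" using assms(2) by simp
  have g: "(\<lambda>z. g z * indicator \<Omega> z) \<in> borel_measurable lebesgue"
  proof -
    have "(\<lambda>z. indicator \<Omega> z *\<^sub>R g z) \<in> borel_measurable borel"
      using Ck_on_1_imp_continuous_on[OF assms(3)] assms(2)
      by (intro borel_measurable_continuous_on_indicator) auto
    then show ?thesis by (intro measurable_completion) (simp add: mult.commute)
  qed
  have "(\<lambda>z. g z * indicator \<Omega> z + u z * indicator (- \<Omega>) z) \<in> borel_measurable lebesgue"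
    by (intro borel_measurable_add g borel_measurable_times assms(4) borel_measurable_indicator O
        Compl_in_sets_lebesgue[THEN iffD2])
  moreover have "\<phi> = (\<lambda>z. g z * indicator \<Omega> z + u z * indicator (- \<Omega>) z)"
    by (auto simp: \<phi>_def indicator_def)
  ultimately show m: "\<phi> \<in> borel_measurable lebesgue" by simp
  show b: "\<bar>\<phi> z\<bar> \<le> M" for z using assms(5,6) by (simp add: \<phi>_def)
  have "Ck_on 1 \<Omega> \<phi>" by (rule Ck_on_1_cong[OF assms(2,3)]) (simp add: \<phi>_def)
  then show "\<phi> \<in> C1_L1w s \<Omega>"
    using bounded_in_L1w[OF assms(1) m b] by (simp add: C1_L1w_def)
qed

text \<open>The ball inside \<open>\<Omega>\<close> keeps the singularity away from the complement,
  so the mass of the kernel there has a bound depending on \<open>\<delta>\<close> but not on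
  \<open>x\<close>. It is positive because the complement contains the exterior of a large
  ball.\<close>

lemma kernel_outside:
  fixes \<Omega> :: "'a::euclidean_space set"
  assumes s: "0 < s" and \<delta>: "0 < \<delta>" and \<Omega>: "open \<Omega>" "bounded \<Omega>" and x: "ball x \<delta> \<subseteq> \<Omega>"
  shows "integrable lebesgue (\<lambda>z. indicator (- \<Omega>) z * norm (x - z) powr (-(real DIM('a) + 2 * s)))"
    "(LINT z|lebesgue. indicator (- \<Omega>) z * norm (x - z) powr (-(real DIM('a) + 2 * s)))
      \<le> (LINT w|lborel. indicator (- ball 0 \<delta>) (w::'a) * norm w powr (-(real DIM('a) + 2 * s)))"
    "0 < (LINT z|lebesgue. indicator (- \<Omega>) z * norm (x - z) powr (-(real DIM('a) + 2 * s)))"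
proof -
  let ?\<alpha> = "real DIM('a) + 2 * s"
  let ?f = "\<lambda>z. indicator (- \<Omega>) z * norm (x - z) powr (-?\<alpha>)"
  define j where "j w = indicator (- ball 0 \<delta>) w * norm w powr (-?\<alpha>)" for w :: 'a
  have j: "integrable lborel j"
    unfolding j_def by (rule integrable_norm_powr_outside_ball) (use s \<delta> in auto)
  then have jm: "j \<in> borel_measurable borel" by simp
  have jx: "integrable lebesgue (\<lambda>z. j (x - z))"
    using integrable_lborel_reflect[OF jm, of x] j jm by (subst integrable_completion) auto
  have jI: "(LINT z|lebesgue. j (x - z)) = (LINT z|lborel. j z)"
    using integral_lborel_reflect[OF jm, of x] jm by (subst integral_completion) auto
  have le: "?f z \<le> j (x - z)" for z
    using x by (auto simp: j_def indicator_def dist_norm subset_iff norm_minus_commute)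
  show int: "integrable lebesgue ?f"
  proof (rule Bochner_Integration.integrable_bound[OF jx])
    show "?f \<in> borel_measurable lebesgue"
      using \<Omega> by (intro borel_measurable_times norm_powr_measurable borel_measurable_indicator) auto
    have "norm (?f z) \<le> norm (j (x - z))" for z using le[of z] by (simp add: j_def)
    then show "AE z in lebesgue. norm (?f z) \<le> norm (j (x - z))" by blast
  qed
  have "integral\<^sup>L lebesgue ?f \<le> (LINT z|lebesgue. j (x - z))" by (rule integral_mono[OF int jx le])
  then show "integral\<^sup>L lebesgue ?f \<le> (LINT w|lborel. indicator (- ball 0 \<delta>) (w::'a) * norm w powr (-?\<alpha>))"
    unfolding jI unfolding j_def .
  obtain B where B: "\<Omega> \<subseteq> cball 0 B" using \<Omega>(2) by (auto simp: bounded_iff subset_iff)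
  show "0 < integral\<^sup>L lebesgue ?f"
  proof (rule integral_pos_open[OF int, of "- cball (0::'a) B"])
    show "- cball (0::'a) B \<noteq> {}"
      using bounded_cball[of "0::'a" B] not_bounded_UNIV by (metis Compl_empty_eq double_complement)
    fix z :: 'a assume "z \<in> - cball 0 B"
    moreover have "x \<in> \<Omega>" using x \<delta> by auto
    ultimately have "z \<notin> \<Omega>" "x \<noteq> z" using B by auto
    then show "0 < ?f z" by simp
  qed auto
qed

text \<open>Raising a test function outside \<open>\<Omega>\<close> keeps it a test function and only increases
  \<open>D\<^sub>s\<close>, so every sufficiently large value is attained.\<close>

lemma Ds_test_function:
  fixes \<Omega> :: "'a::euclidean_space set"
  assumes s: "0 < s" "s < 1" and \<Omega>: "open \<Omega>" "bounded \<Omega>" and \<delta>: "0 < \<delta>" and K: "0 \<le> K"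
    and u: "\<And>z. \<bar>u z\<bar> \<le> M"
  shows "\<exists>D. \<forall>n x y P. 1 \<le> n \<longrightarrow> ball x \<delta> \<subseteq> \<Omega> \<longrightarrow>
      (\<forall>z\<in>\<Omega>. u z - K * (1 - bump n y z) \<le> u x - K * (1 - bump n y x)) \<longrightarrow>
      D * (1 + n powr (1 + s)) \<le> P \<longrightarrow>
      (\<exists>\<phi>\<in>C1_L1w s \<Omega>. (\<forall>z. u z - \<phi> z \<le> u x - \<phi> x) \<and> Ds_finite s \<phi> x \<and> Ds s \<phi> x = sqrt P)"
proof -
  define \<alpha> where "\<alpha> = real DIM('a) + 2 * s"
  define \<kappa> where "\<kappa> = frac_lap_const DIM('a) s / 2"
  have \<kappa>: "0 < \<kappa>" using frac_lap_const_pos[OF s, of "DIM('a)"] by (simp add: \<kappa>_def)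
  obtain B where B: "\<And>z. z \<in> \<Omega> \<Longrightarrow> norm z \<le> B" using \<Omega>(2) by (auto simp: bounded_iff)
  define R where "R = 2 * \<bar>B\<bar> + 1"
  have R: "0 < R" by (simp add: R_def)
  define j where "j w = indicator (cball 0 R) w * norm w powr (-(\<alpha> - (1 + s)))" for w :: 'a
  have j: "integrable lborel j"
    unfolding j_def by (rule integrable_norm_powr_cball) (use s R in \<open>auto simp: \<alpha>_def\<close>)
  then have jm: "j \<in> borel_measurable borel" by simp
  define J where "J = (LINT z|lborel. j z)"
  have J: "0 \<le> J" unfolding J_def by (intro integral_nonneg_AE) (auto simp: j_def)
  define T0 where "T0 = (LINT w|lborel. indicator (- ball 0 \<delta>) (w::'a) * norm w powr (-\<alpha>))"
  have T0: "0 \<le> T0" unfolding T0_def by (intro integral_nonneg_AE) auto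
  have M: "0 \<le> M" using u[of undefined] by linarith
  \<comment> \<open>The first term bounds the energy of the penalty inside \<open>\<Omega>\<close>,
    up to the factor \<open>n powr (1 + s)\<close>; the second is the energy of an exterior jump of
    height \<open>2 * M\<close>.\<close>
  define D where "D = \<kappa> * (K\<^sup>2 * J + (2 * M)\<^sup>2 * T0)"
  show ?thesis
  proof (rule exI[of _ D], intro allI impI)
    fix n :: real and x y P
    assume n: "1 \<le> n" and ball: "ball x \<delta> \<subseteq> \<Omega>" and P: "D * (1 + n powr (1 + s)) \<le> P"
      and touch: "\<forall>z\<in>\<Omega>. u z - K * (1 - bump n y z) \<le> u x - K * (1 - bump n y x)"
    have x: "x \<in> \<Omega>" using ball \<delta> by auto
    let ?T = "\<lambda>z. indicator (- \<Omega>) z * norm (x - z) powr (-\<alpha>)"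
    let ?A = "\<lambda>z. indicator \<Omega> z * ((K * (bump n y x - bump n y z))\<^sup>2 * norm (x - z) powr (-\<alpha>))"
    define T where "T = integral\<^sup>L lebesgue ?T"
    define A where "A = integral\<^sup>L lebesgue ?A"
    have T: "integrable lebesgue ?T" "T \<le> T0" "0 < T"
      using kernel_outside[OF s(1) \<delta> \<Omega> ball] by (auto simp: \<alpha>_def T_def T0_def)
    have jx: "integrable lebesgue (\<lambda>z. j (x - z))"
      using integrable_lborel_reflect[OF jm, of x] j jm by (subst integrable_completion) auto
    have jI: "(LINT z|lebesgue. j (x - z)) = J"
      using integral_lborel_reflect[OF jm, of x] jm by (subst integral_completion) (auto simp: J_def)
    have Ale: "?A z \<le> (K\<^sup>2 * n powr (1 + s)) * j (x - z)" for z
    proof (cases "z \<in> \<Omega> \<and> z \<noteq> x")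
      case True
      then have z: "norm (x - z) \<le> R" "0 < norm (x - z)"
        using B[OF x] B[of z] norm_triangle_ineq4[of x z] by (auto simp: R_def)
      \<comment> \<open>After squaring, the exponent is \<open>1 + s\<close>: above
        \<open>2 * s\<close>, which makes the kernel integrable, and below 2, which keeps the square
        root of the energy of lower order than \<open>n\<close>.\<close>
      have "\<bar>bump n y x - bump n y z\<bar> \<le> (n * norm (x - z)) powr ((1 + s) / 2)"
        using n s by (intro bump_diff_le_powr) auto
      then have "\<bar>bump n y x - bump n y z\<bar>\<^sup>2 \<le> ((n * norm (x - z)) powr ((1 + s) / 2))\<^sup>2"
        by (intro power_mono) auto
      also have "\<dots> = (n * norm (x - z)) powr (1 + s)"
      proof -
        have "(1 + s) / 2 + (1 + s) / 2 = 1 + s" by (rule field_sum_of_halves)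
        then show ?thesis by (simp only: power2_eq_square powr_add[symmetric])
      qed
      also have "\<dots> = n powr (1 + s) * norm (x - z) powr (1 + s)"
        using n by (simp add: powr_mult)
      finally have "(K * (bump n y x - bump n y z))\<^sup>2 \<le> K\<^sup>2 * (n powr (1 + s) * norm (x - z) powr (1 + s))"
        by (simp add: power_mult_distrib mult_left_mono)
      then have "?A z \<le> K\<^sup>2 * (n powr (1 + s) * norm (x - z) powr (1 + s)) * norm (x - z) powr (-\<alpha>)"
        using True by (simp add: mult_right_mono)
      also have "\<dots> = K\<^sup>2 * n powr (1 + s) * norm (x - z) powr (1 + s + - \<alpha>)"
        by (simp only: powr_add mult.assoc)
      also have "1 + s + - \<alpha> = -(\<alpha> - (1 + s))" by simp
      finally show ?thesis using z by (simp add: j_def)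
    qed (use K in \<open>auto simp: j_def\<close>)
    have jn: "integrable lebesgue (\<lambda>z. (K\<^sup>2 * n powr (1 + s)) * j (x - z))"
      by (intro Bochner_Integration.integrable_mult_right jx)
    \<comment> \<open>\<open>c\<close> is the height of the exterior jump; it solves
      \<open>\<kappa> * (A + c\<^sup>2 * T) = P\<close>.\<close>
    define c where "c = sqrt ((P / \<kappa> - A) / T)"
    define \<phi> where "\<phi> z = (if z \<in> \<Omega> then K * (1 - bump n y z) else K * (1 - bump n y x) + c)" for z
    have Aint: "integrable lebesgue ?A"
    proof (rule Bochner_Integration.integrable_bound[OF jn])
      have "(\<lambda>z. bump n y z) \<in> borel_measurable borel"
        by (intro borel_measurable_continuous_onI continuous_intros)
      then have "bump n y \<in> borel_measurable lebesgue" by (intro measurable_completion) simp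
      then show "?A \<in> borel_measurable lebesgue"
        using \<Omega> by (intro borel_measurable_times norm_powr_measurable borel_measurable_indicator
            borel_measurable_power borel_measurable_diff) auto
      have "norm (?A z) \<le> norm ((K\<^sup>2 * n powr (1 + s)) * j (x - z))" for z
        using Ale[of z] by (simp add: j_def abs_mult)
      then show "AE z in lebesgue. norm (?A z) \<le> norm ((K\<^sup>2 * n powr (1 + s)) * j (x - z))" by blast
    qed
    have "A \<le> (LINT z|lebesgue. (K\<^sup>2 * n powr (1 + s)) * j (x - z))"
      unfolding A_def by (rule integral_mono[OF Aint jn Ale])
    then have A: "A \<le> K\<^sup>2 * J * n powr (1 + s)" by (simp add: jI mult_ac)
    have A0: "0 \<le> A" unfolding A_def by (intro integral_nonneg_AE) auto
    have "\<kappa> * (A + (2 * M)\<^sup>2 * T) \<le> \<kappa> * ((K\<^sup>2 * J + (2 * M)\<^sup>2 * T0) * (1 + n powr (1 + s)))"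
    proof -
      have "(2 * M)\<^sup>2 * T \<le> (2 * M)\<^sup>2 * T0" using T by (intro mult_left_mono) auto
      moreover have "0 \<le> K\<^sup>2 * J" "0 \<le> (2 * M)\<^sup>2 * T0 * n powr (1 + s)" using J T0 by auto
      ultimately have "A + (2 * M)\<^sup>2 * T \<le> (K\<^sup>2 * J + (2 * M)\<^sup>2 * T0) * (1 + n powr (1 + s))"
        using A by (simp add: algebra_simps)
      then show ?thesis using \<kappa> by (intro mult_left_mono) auto
    qed
    also have "\<dots> \<le> P" using P by (simp add: D_def)
    finally have P1: "\<kappa> * (A + (2 * M)\<^sup>2 * T) \<le> P" .
    then have P2: "(2 * M)\<^sup>2 \<le> (P / \<kappa> - A) / T" using \<kappa> T by (simp add: field_simps)
    \<comment> \<open>A jump of at least the oscillation of \<open>u\<close> ensures touching from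
      above outside \<open>\<Omega>\<close>.\<close>
    then have c: "2 * M \<le> c" unfolding c_def by (rule real_le_rsqrt)
    have "0 \<le> (P / \<kappa> - A) / T" using P2 zero_le_power2[of "2 * M"] by linarith
    then have csq: "c\<^sup>2 = (P / \<kappa> - A) / T" by (simp add: c_def)
    have touch': "u z - \<phi> z \<le> u x - \<phi> x" for z
      using touch u[of x] u[of z] c x by (auto simp: \<phi>_def)
    have Kb: "\<bar>K * (1 - bump n y z)\<bar> \<le> K" for z
      using bump_bounds[of n y z] K by (simp add: abs_mult mult_left_le)
    have Ck: "Ck_on 1 \<Omega> (\<lambda>z. K * (1 - bump n y z))"
    proof -
      have "Ck_on 1 \<Omega> (\<lambda>z. K * (1 + (-1) * bump n y z))"
        by (rule Ck_on_1_add Ck_on_1_const Ck_on_1_mult Ck_on_1_bump)+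
      then show ?thesis by simp
    qed
    have \<phi>: "\<phi> \<in> C1_L1w s \<Omega>"
      unfolding \<phi>_def[abs_def]
    proof (rule C1_L1w_piecewise(3)[OF s(1) \<Omega>(1) Ck, of _ "K + \<bar>c\<bar>"])
      show "\<bar>K * (1 - bump n y z)\<bar> \<le> K + \<bar>c\<bar>" for z using Kb[of z] by linarith
      show "\<bar>K * (1 - bump n y x) + c\<bar> \<le> K + \<bar>c\<bar>" using Kb[of x] by linarith
    qed auto
    have eq: "B_integrand s \<phi> \<phi> x = (\<lambda>z. ?A z + c\<^sup>2 * ?T z)"
      using x by (auto simp: fun_eq_iff B_integrand_powr \<phi>_def \<alpha>_def indicator_def power2_eq_square algebra_simps)
    have fin: "Ds_finite s \<phi> x"
      unfolding Ds_finite_def B_finite_def eq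
      by (intro Bochner_Integration.integrable_add Bochner_Integration.integrable_mult_right Aint T(1))
    have "(LINT z|lebesgue. B_integrand s \<phi> \<phi> x z) = A + c\<^sup>2 * T"
      unfolding eq using Aint T(1) by (simp add: A_def T_def)
    then have "Ds s \<phi> x = sqrt (\<kappa> * (A + c\<^sup>2 * T))"
      by (simp add: Ds_def Bform_def \<kappa>_def)
    also have "\<kappa> * (A + c\<^sup>2 * T) = P" using \<kappa> T by (simp add: csq)
    finally show "\<exists>\<phi>\<in>C1_L1w s \<Omega>. (\<forall>z. u z - \<phi> z \<le> u x - \<phi> x) \<and> Ds_finite s \<phi> x \<and> Ds s \<phi> x = sqrt P"
      using \<phi> touch' fin by blast
  qed
qed

subsection \<open>Test functions for \<open>\<B>(u,h)\<close>\<close>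

text \<open>Only touching from above is encoded. Touching \<open>u2\<close> from below is touching
  \<open>- u2\<close> from above by the negated function, which flips the sign of the form; hence
  \<open>- q\<close> in the statements about \<open>u2\<close>.\<close>

definition test_values ::
  "real \<Rightarrow> ('a::euclidean_space \<Rightarrow> real) \<Rightarrow> 'a set \<Rightarrow> ('a \<Rightarrow> real) \<Rightarrow> 'a \<Rightarrow> real set" where
  "test_values s h \<Omega> u x = {p. \<exists>\<phi>\<in>C1_L1w s \<Omega>. (\<forall>z. u z - \<phi> z \<le> u x - \<phi> x) \<and>
     B_finite s \<phi> h x \<and> Bform s \<phi> h x = p}"

lemma test_valuesI:
  assumes "\<phi> \<in> C1_L1w s \<Omega>" "\<And>z. u z - \<phi> z \<le> u x - \<phi> x" "B_finite s \<phi> h x"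
  shows "Bform s \<phi> h x \<in> test_values s h \<Omega> u x"
  using assms unfolding test_values_def by blast

text \<open>Contact is required inside \<open>\<Omega>\<close> only; the exterior part of a test
  function is supplied separately.\<close>

definition touched :: "('a::euclidean_space) set \<Rightarrow> ('a \<Rightarrow> real) \<Rightarrow> 'a \<Rightarrow> bool" where
  "touched \<Omega> u x \<longleftrightarrow> (\<exists>\<psi> M. Ck_on 1 \<Omega> \<psi> \<and> (\<forall>z\<in>\<Omega>. \<bar>\<psi> z\<bar> \<le> M) \<and> (\<forall>z\<in>\<Omega>. u z - \<psi> z \<le> u x - \<psi> x))"

lemma C1_L1w_add_cmult:
  assumes "\<phi> \<in> C1_L1w s \<Omega>" "\<psi> \<in> C1_L1w s \<Omega>"
  shows "(\<lambda>z. \<phi> z + t * \<psi> z) \<in> C1_L1w s \<Omega>"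
proof -
  have "Ck_on 1 \<Omega> (\<lambda>z. \<phi> z + t * \<psi> z)"
    using assms by (intro Ck_on_1_add Ck_on_1_mult Ck_on_1_const) (auto simp: C1_L1w_def)
  moreover have "integrable lebesgue (\<lambda>z. \<phi> z * weight s z + t * (\<psi> z * weight s z))"
    using assms by (intro Bochner_Integration.integrable_add Bochner_Integration.integrable_mult_right)
      (auto simp: C1_L1w_def L1w_def)
  ultimately show ?thesis by (simp add: C1_L1w_def L1w_def algebra_simps)
qed

lemma B_integrand_add_cmult:
  "B_integrand s (\<lambda>z. \<phi> z + t * \<psi> z) h x = (\<lambda>z. B_integrand s \<phi> h x z + t * B_integrand s \<psi> h x z)"
  by (simp add: B_integrand_powr fun_eq_iff algebra_simps)

lemma
  assumes "B_finite s \<phi> h x" "B_finite s \<psi> h x"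
  shows B_finite_add_cmult: "B_finite s (\<lambda>z. \<phi> z + t * \<psi> z) h x"
    and Bform_add_cmult: "Bform s (\<lambda>z. \<phi> z + t * \<psi> z) h x = Bform s \<phi> h x + t * Bform s \<psi> h x"
  using assms by (auto simp: B_finite_def Bform_def B_integrand_add_cmult algebra_simps)

lemma B_integrand_uminus:
  "B_integrand s (\<lambda>z. - \<phi> z) h x = (\<lambda>z. - B_integrand s \<phi> h x z)"
  "B_integrand s \<phi> (\<lambda>z. - h z) x = (\<lambda>z. - B_integrand s \<phi> h x z)"
  by (simp_all add: B_integrand_powr fun_eq_iff algebra_simps)

lemma Bform_uminus [simp]:
  "Bform s (\<lambda>z. - \<phi> z) h x = - Bform s \<phi> h x" "Bform s \<phi> (\<lambda>z. - h z) x = - Bform s \<phi> h x"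
  by (simp_all add: Bform_def B_integrand_uminus)

lemma B_finite_uminus [simp]:
  "B_finite s (\<lambda>z. - \<phi> z) h x \<longleftrightarrow> B_finite s \<phi> h x" "B_finite s \<phi> (\<lambda>z. - h z) x \<longleftrightarrow> B_finite s \<phi> h x"
  by (simp_all add: B_finite_def B_integrand_uminus)

lemma test_values_uminus: "p \<in> test_values s (\<lambda>z. - h z) \<Omega> u x \<longleftrightarrow> - p \<in> test_values s h \<Omega> u x"
  by (auto simp: test_values_def)

text \<open>Both factors are Lipschitz near \<open>x\<close>, so the product of their increments is
  quadratic there.\<close>

lemma B_finite_C1:
  fixes h :: "'a::euclidean_space \<Rightarrow> real"
  assumes s: "0 < s" "s < 1" and h: "h \<in> L1w s" "Ck_on 1 UNIV h"
    and \<phi>: "\<phi> \<in> borel_measurable lebesgue" "\<And>z. \<bar>\<phi> z\<bar> \<le> M" "Ck_on 1 \<Omega> \<phi>" "open \<Omega>" "x \<in> \<Omega>"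
  shows "B_finite s \<phi> h x"
proof -
  obtain r where r: "0 < r" "cball x r \<subseteq> \<Omega>" using \<phi>(4,5) open_contains_cball by blast
  obtain L1 where L1: "0 \<le> L1" "\<And>z w. z \<in> cball x r \<Longrightarrow> w \<in> cball x r \<Longrightarrow> \<bar>\<phi> z - \<phi> w\<bar> \<le> L1 * norm (z - w)"
    using Ck_on_1_lipschitz[OF \<phi>(3) r(2) compact_cball convex_cball] by blast
  obtain L2 where L2: "0 \<le> L2" "\<And>z w. z \<in> cball x r \<Longrightarrow> w \<in> cball x r \<Longrightarrow> \<bar>h z - h w\<bar> \<le> L2 * norm (z - w)"
    using Ck_on_1_lipschitz[OF h(2) subset_UNIV compact_cball convex_cball] by blast
  show ?thesis
  proof (rule B_finiteI[OF s r(1) \<phi>(1,2) h(1)])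
    fix z assume z: "norm (x - z) < r"
    then have "x \<in> cball x r" "z \<in> cball x r" using r by (auto simp: dist_norm)
    then have "\<bar>(\<phi> x - \<phi> z) * (h x - h z)\<bar> \<le> (L1 * norm (x - z)) * (L2 * norm (x - z))"
      unfolding abs_mult using L1 L2 by (intro mult_mono) auto
    then show "\<bar>(\<phi> x - \<phi> z) * (h x - h z)\<bar> \<le> (L1 * L2) * (norm (x - z))\<^sup>2"
      by (simp add: power2_eq_square mult_ac)
  qed
qed

lemma integrable_kernel:
  fixes h :: "'a::euclidean_space \<Rightarrow> real"
  assumes s: "0 < s" "s < 1" and h: "h \<in> L1w s"
    and near: "\<And>z. norm (x - z) < 1 \<Longrightarrow> \<bar>h x - h z\<bar> \<le> C * (norm (x - z))\<^sup>2"
  shows "integrable lebesgue (\<lambda>z. \<bar>h x - h z\<bar> * norm (x - z) powr (-(real DIM('a) + 2 * s)))"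
proof -
  let ?g = "\<lambda>z. \<bar>h x - h z\<bar>"
  have "h \<in> borel_measurable lebesgue" using h by (rule L1w_measurable)
  then have g: "?g \<in> borel_measurable lebesgue"
    by (intro borel_measurable_abs borel_measurable_diff) auto
  have near': "\<bar>h x - h z\<bar> \<le> \<bar>C\<bar> * (norm (x - z))\<^sup>2" if "norm (x - z) < 1" for z
    by (rule order_trans[OF near[OF that]]) (intro mult_right_mono, auto)
  have "integrable lebesgue (\<lambda>z. ?g z * norm (x - z) powr (-(real DIM('a) + 2 * s + 0)))"
    using kernel_bound[OF s(1) order_refl _ zero_less_one abs_ge_zero abs_ge_zero h, of "norm x" "h x" C]
      s g near' by fastforce
  then show ?thesis by simp
qed

text \<open>Add a multiple \<open>t \<ge> 0\<close> of a bump supported where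
  \<open>h < h x\<close>. The bump vanishes at \<open>x\<close>, so contact persists; it is
  nonnegative with the increments of \<open>h\<close> of one sign, so its own form at
  \<open>x\<close> is strictly negative, and a suitable \<open>t\<close> reaches any lower
  value.\<close>

lemma test_values_lower:
  fixes h :: "'a::euclidean_space \<Rightarrow> real"
  assumes s: "0 < s" "s < 1" and h: "h \<in> L1w s" "Ck_on 1 UNIV h"
    and z0: "h z0 < h x" and p: "p \<in> test_values s h \<Omega> u x" "p' \<le> p"
  shows "p' \<in> test_values s h \<Omega> u x"
proof -
  have "open {z. h z < h x}"
    using Ck_on_1_imp_continuous_on[OF h(2)] by (intro open_Collect_less) auto
  then obtain r where r: "0 < r" "ball z0 r \<subseteq> {z. h z < h x}"
    using z0 open_contains_ball by blast
  define b where "b z = (max 0 (r\<^sup>2 - (norm (z - z0))\<^sup>2))\<^sup>2" for z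
  have b0: "0 \<le> b z" for z by (simp add: b_def)
  have bpos: "0 < b z" if "z \<in> ball z0 r" for z
  proof -
    have "(norm (z - z0))\<^sup>2 < r\<^sup>2"
      using that r by (intro power_strict_mono) (auto simp: dist_norm norm_minus_commute)
    then show ?thesis by (simp add: b_def)
  qed
  have bout: "b z = 0" if "z \<notin> ball z0 r" for z
  proof -
    have "r\<^sup>2 \<le> (norm (z - z0))\<^sup>2"
      using that r by (intro power_mono) (auto simp: dist_norm norm_minus_commute)
    then show ?thesis by (simp add: b_def)
  qed
  have bx: "b x = 0" using r(2) by (intro bout) auto
  have bM: "\<bar>b z\<bar> \<le> (r\<^sup>2)\<^sup>2" for z
  proof -
    have "b z \<le> (r\<^sup>2)\<^sup>2" unfolding b_def by (intro power_mono) auto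
    then show ?thesis using b0 by simp
  qed
  have Ckb: "Ck_on 1 S b" for S
  proof -
    have "Ck_on 1 S (\<lambda>z. r\<^sup>2 + (- 1) * (norm (z - z0))\<^sup>2)"
      by (rule Ck_on_1_add Ck_on_1_const Ck_on_1_mult Ck_on_1_norm_square)+
    then have "Ck_on 1 S (\<lambda>z. (max 0 (r\<^sup>2 + (- 1) * (norm (z - z0))\<^sup>2))\<^sup>2)"
      by (rule Ck_on_1_compose[where \<phi>="\<lambda>t. (max 0 t)\<^sup>2" and \<phi>'="\<lambda>t. 2 * max 0 t"])
        (rule DERIV_pos_part_square, intro continuous_intros)
    then show ?thesis by (simp add: b_def[abs_def])
  qed
  have bm: "b \<in> borel_measurable lebesgue"
    using Ck_on_1_imp_continuous_on[OF Ckb[of UNIV]]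
    by (intro measurable_completion) (simp add: borel_measurable_continuous_onI)
  have bC: "b \<in> C1_L1w s \<Omega>"
    using Ckb bounded_in_L1w[OF s(1) bm bM] by (simp add: C1_L1w_def)
  have bfin: "B_finite s b h x"
    by (rule B_finite_C1[OF s h bm bM Ckb open_UNIV]) simp
  have "0 < (LINT z|lebesgue. - B_integrand s b h x z)"
  proof (rule integral_pos_open[of _ "ball z0 r"])
    show "integrable lebesgue (\<lambda>z. - B_integrand s b h x z)" using bfin by (simp add: B_finite_def)
    show "0 \<le> - B_integrand s b h x z" for z
    proof (cases "z \<in> ball z0 r")
      case True
      then have "h z < h x" using r by auto
      then show ?thesis using b0[of z] by (simp add: B_integrand_powr bx)
    qed (simp add: bout bx B_integrand_powr)
    fix z assume z: "z \<in> ball z0 r"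
    then have "h z < h x" using r by auto
    moreover from this have "x \<noteq> z" by auto
    ultimately show "0 < - B_integrand s b h x z"
      using bpos[OF z] by (simp add: B_integrand_powr bx)
  qed (use r in auto)
  then have \<beta>: "Bform s b h x < 0"
    using frac_lap_const_pos[OF s, of "DIM('a)"] by (simp add: Bform_def mult_less_0_iff)
  \<comment> \<open>Solves \<open>p + t * Bform s b h x = p'\<close>.\<close>
  define t where "t = (p' - p) / Bform s b h x"
  have t: "0 \<le> t" using \<beta> p(2) by (simp add: t_def divide_nonpos_neg)
  obtain \<phi> where \<phi>: "\<phi> \<in> C1_L1w s \<Omega>" "\<And>z. u z - \<phi> z \<le> u x - \<phi> x" "B_finite s \<phi> h x" "Bform s \<phi> h x = p"
    using p(1) by (auto simp: test_values_def)
  have le: "u z - (\<phi> z + t * b z) \<le> u x - (\<phi> x + t * b x)" for z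
    using \<phi>(2)[of z] mult_nonneg_nonneg[OF t b0[of z]] by (simp add: bx)
  have "Bform s (\<lambda>z. \<phi> z + t * b z) h x = p'"
    unfolding Bform_add_cmult[OF \<phi>(3) bfin] using \<beta> by (simp add: t_def \<phi>(4))
  then show ?thesis
    using test_valuesI[OF C1_L1w_add_cmult[OF \<phi>(1) bC] le B_finite_add_cmult[OF \<phi>(3) bfin]] by simp
qed

lemma Ck_on_1_uminus: "Ck_on 1 S f \<Longrightarrow> Ck_on 1 S (\<lambda>z. - f z)"
  using Ck_on_1_mult[OF Ck_on_1_const, of S f "-1"] by simp

lemma L1w_uminus: "h \<in> L1w s \<Longrightarrow> (\<lambda>z. - h z) \<in> L1w s"
  using L1w_cmult[of h s "-1"] by simp

lemma test_values_raise:
  fixes h :: "'a::euclidean_space \<Rightarrow> real"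
  assumes s: "0 < s" "s < 1" and h: "h \<in> L1w s" "Ck_on 1 UNIV h"
    and z0: "h x < h z0" and p: "p \<in> test_values s h \<Omega> u x" "p \<le> p'"
  shows "p' \<in> test_values s h \<Omega> u x"
  using test_values_lower[OF s L1w_uminus[OF h(1)] Ck_on_1_uminus[OF h(2)], of z0 x "-p" \<Omega> u "-p'"]
    z0 p by (simp add: test_values_uminus)

text \<open>The touching function, shifted to agree with \<open>u\<close> at \<open>x\<close>, is
  used inside \<open>\<Omega>\<close> and \<open>u\<close> itself outside.\<close>

lemma test_values_nonempty:
  fixes h :: "'a::euclidean_space \<Rightarrow> real"
  assumes s: "0 < s" "s < 1" and h: "h \<in> L1w s" "Ck_on 1 UNIV h"
    and \<Omega>: "open \<Omega>" "x \<in> \<Omega>" and u: "u \<in> borel_measurable lebesgue" "\<And>z. \<bar>u z\<bar> \<le> M"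
    and touch: "touched \<Omega> u x"
  obtains p where "p \<in> test_values s h \<Omega> u x"
proof -
  obtain \<psi> M' where \<psi>: "Ck_on 1 \<Omega> \<psi>" "\<And>z. z \<in> \<Omega> \<Longrightarrow> \<bar>\<psi> z\<bar> \<le> M'"
    "\<And>z. z \<in> \<Omega> \<Longrightarrow> u z - \<psi> z \<le> u x - \<psi> x"
    using touch unfolding touched_def by blast
  let ?g = "\<lambda>z. \<psi> z + (u x - \<psi> x)"
  have g: "Ck_on 1 \<Omega> ?g" by (intro Ck_on_1_add Ck_on_1_const \<psi>(1))
  have gb: "\<bar>?g z\<bar> \<le> 2 * M' + M" if "z \<in> \<Omega>" for z
    using \<psi>(2)[OF that] \<psi>(2)[OF \<Omega>(2)] u(2)[of x] by linarith
  have ub: "\<bar>u z\<bar> \<le> 2 * M' + M" for z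
    using \<psi>(2)[OF \<Omega>(2)] u(2)[of z] by linarith
  let ?\<phi> = "\<lambda>z. if z \<in> \<Omega> then ?g z else u z"
  note \<phi> = C1_L1w_piecewise[OF s(1) \<Omega>(1) g u(1) gb ub]
  have "B_finite s ?\<phi> h x"
    using \<phi>(3) by (intro B_finite_C1[OF s h \<phi>(1,2) _ \<Omega>]) (auto simp: C1_L1w_def)
  moreover have "u z - ?\<phi> z \<le> u x - ?\<phi> x" for z using \<psi>(3)[of z] \<Omega> by auto
  ultimately show thesis using \<phi>(3) by (intro that[OF test_valuesI])
qed

text \<open>Test functions decrease the gap to \<open>u\<close> everywhere except at the contact
  point, where they already agree with it. Quadratic increments of \<open>h\<close> make its kernel
  integrable without any help from \<open>u\<close>, so dominated convergence carries the forms to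
  \<open>Bform s u h x\<close>.\<close>

lemma test_values_approx:
  fixes h :: "'a::euclidean_space \<Rightarrow> real"
  assumes s: "0 < s" "s < 1" and h: "h \<in> L1w s" "Ck_on 1 UNIV h"
    and near: "\<And>z. norm (x - z) < 1 \<Longrightarrow> \<bar>h x - h z\<bar> \<le> C * (norm (x - z))\<^sup>2"
    and \<Omega>: "open \<Omega>" "x \<in> \<Omega>" "bounded \<Omega>" and u: "u \<in> borel_measurable lebesgue" "\<And>z. \<bar>u z\<bar> \<le> M"
    "continuous_on (closure \<Omega>) u"
    and touch: "touched \<Omega> u x" and \<epsilon>: "0 < \<epsilon>"
  obtains p where "p \<in> test_values s h \<Omega> u x" "\<bar>p - Bform s u h x\<bar> < \<epsilon>"
proof -
  obtain \<psi> M' where \<psi>: "Ck_on 1 \<Omega> \<psi>" "\<And>z. z \<in> \<Omega> \<Longrightarrow> \<bar>\<psi> z\<bar> \<le> M'"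
    "\<And>z. z \<in> \<Omega> \<Longrightarrow> u z - \<psi> z \<le> u x - \<psi> x"
    using touch unfolding touched_def by blast
  have M': "0 \<le> M'" using \<psi>(2)[OF \<Omega>(2)] by linarith
  \<comment> \<open>\<open>2 * M' + M\<close> bounds the shifted touching function \<open>g\<close>;
    the extra 2 covers the excess of \<open>G j\<close> over \<open>u\<close>.\<close>
  define M1 where "M1 = 2 * M' + M + 2"
  define g where "g z = \<psi> z + (u x - \<psi> x)" for z
  have g: "Ck_on 1 \<Omega> g" unfolding g_def[abs_def] by (intro Ck_on_1_add Ck_on_1_const \<psi>(1))
  have gb: "\<bar>g z\<bar> \<le> M1" if "z \<in> \<Omega>" for z
    using \<psi>(2)[OF that] \<psi>(2)[OF \<Omega>(2)] u(2)[of x] by (simp add: g_def M1_def)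
  have gu: "u z \<le> g z" if "z \<in> \<Omega>" for z using \<psi>(3)[OF that] by (simp add: g_def)
  have "\<exists>q. real_polynomial_function q \<and> (\<forall>z\<in>closure \<Omega>. \<bar>u z - q z\<bar> < 1 / real (Suc j))" for j
    using Stone_Weierstrass_real_polynomial_function[OF _ u(3), of "1 / real (Suc j)"] \<Omega>(3)
    by (metis compact_closure zero_less_divide_1_iff of_nat_0_less_iff zero_less_Suc)
  then obtain q where q: "\<And>j. real_polynomial_function (q j)"
    "\<And>j z. z \<in> closure \<Omega> \<Longrightarrow> \<bar>u z - q j z\<bar> < 1 / real (Suc j)"
    by metis
  \<comment> \<open>Raising the polynomial by its approximation error puts it above
    \<open>u\<close>.\<close>
  define G where "G j z = q j z + 1 / real (Suc j)" for j z
  have Gu: "u z \<le> G j z" "G j z \<le> u z + 2 / real (Suc j)" if "z \<in> \<Omega>" for j z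
    using q(2)[of z j] that closure_subset[of \<Omega>] by (auto simp: G_def subset_iff abs_if split: if_splits)
  have Gb: "\<bar>G j z\<bar> \<le> M1" if "z \<in> \<Omega>" for j z
  proof -
    have "2 / real (Suc j) \<le> 2" by (simp add: field_simps)
    then show ?thesis using Gu[OF that, of j] u(2)[of z] M' by (simp add: M1_def)
  qed
  \<comment> \<open>The weights concentrate at \<open>x\<close>: \<open>f j\<close> touches \<open>u\<close> at \<open>x\<close> like \<open>g\<close> does, but tends to \<open>u\<close>
    elsewhere.\<close>
  define f where "f j z = bump (real j) x z * g z + (1 - bump (real j) x z) * G j z" for j z
  have fC: "Ck_on 1 \<Omega> (f j)" for j
  proof -
    have "Ck_on 1 \<Omega> (\<lambda>z. bump (real j) x z * g z + (1 + (- 1) * bump (real j) x z) * (q j z + 1 / real (Suc j)))"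
      by (intro Ck_on_1_add Ck_on_1_mult Ck_on_1_const g Ck_on_1_bump
          Ck_on_1_real_polynomial_function q(1))
    then show ?thesis by (simp add: f_def[abs_def] G_def)
  qed
  have fu: "u z \<le> f j z" if "z \<in> \<Omega>" for j z
    using bump_bounds[of "real j" x z] gu[OF that] Gu(1)[OF that, of j]
      convex_bound_le[of "- g z" "- u z" "- G j z" "bump (real j) x z" "1 - bump (real j) x z"]
    by (simp add: f_def)
  have fb: "\<bar>f j z\<bar> \<le> M1" if "z \<in> \<Omega>" for j z
  proof -
    let ?b = "bump (real j) x z"
    have "\<bar>f j z\<bar> \<le> ?b * \<bar>g z\<bar> + (1 - ?b) * \<bar>G j z\<bar>"
      unfolding f_def using bump_bounds[of "real j" x z]
      by (intro order_trans[OF abs_triangle_ineq]) (simp add: abs_mult)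
    also have "\<dots> \<le> M1"
      using bump_bounds[of "real j" x z] gb[OF that] Gb[OF that, of j]
      by (intro convex_bound_le) auto
    finally show ?thesis .
  qed
  have ub: "\<bar>u z\<bar> \<le> M1" for z
    using M' u(2)[of z] by (simp add: M1_def)
  define \<phi> where "\<phi> j z = (if z \<in> \<Omega> then f j z else u z)" for j z
  have \<phi>: "\<phi> j \<in> borel_measurable lebesgue" "\<bar>\<phi> j z\<bar> \<le> M1" "\<phi> j \<in> C1_L1w s \<Omega>" for j z
    using C1_L1w_piecewise[OF s(1) \<Omega>(1) fC[of j] u(1) fb ub] by (auto simp: \<phi>_def[abs_def])
  have \<phi>x: "\<phi> j x = u x" for j using \<Omega> by (simp add: \<phi>_def f_def g_def)
  have \<phi>u: "u z \<le> \<phi> j z" for j z using fu by (simp add: \<phi>_def)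
  have fin: "B_finite s (\<phi> j) h x" for j
    using \<phi>(3) by (intro B_finite_C1[OF s h \<phi>(1,2) _ \<Omega>(1,2)]) (auto simp: C1_L1w_def)
  have tv: "Bform s (\<phi> j) h x \<in> test_values s h \<Omega> u x" for j
    using \<phi>u[where j=j] by (intro test_valuesI \<phi>(3) fin) (simp add: \<phi>x)
  have lim: "(\<lambda>j. \<phi> j z) \<longlonglongrightarrow> u z" if "z \<noteq> x" for z
  proof (cases "z \<in> \<Omega>")
    case True
    have b: "(\<lambda>j. bump (real j) x z) \<longlonglongrightarrow> 0"
    proof -
      have "filterlim (\<lambda>j. 1 + (real j)\<^sup>2 * (norm (z - x))\<^sup>2) at_top sequentially"
        using that by (intro filterlim_tendsto_add_at_top[OF tendsto_const]
            filterlim_at_top_mult_tendsto_pos[OF tendsto_const] filterlim_pow_at_top filterlim_real_sequentially) auto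
      then show ?thesis unfolding bump_def
        by (intro tendsto_divide_0[OF tendsto_const] filterlim_at_top_imp_at_infinity)
    qed
    have G: "(\<lambda>j. G j z) \<longlonglongrightarrow> u z"
    proof (rule tendsto_sandwich[OF _ _ tendsto_const])
      have "(\<lambda>j. u z + 2 * inverse (real (Suc j))) \<longlonglongrightarrow> u z + 2 * 0"
        by (intro tendsto_intros LIMSEQ_inverse_real_of_nat)
      then show "(\<lambda>j. u z + 2 / real (Suc j)) \<longlonglongrightarrow> u z" by (simp add: divide_inverse)
    qed (use Gu[OF True] in auto)
    have "(\<lambda>j. bump (real j) x z * g z + (1 - bump (real j) x z) * G j z) \<longlonglongrightarrow> 0 * g z + (1 - 0) * u z"
      by (intro tendsto_intros b G)
    then show ?thesis using True by (simp add: \<phi>_def f_def)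
  qed (simp add: \<phi>_def)
  have hm: "h \<in> borel_measurable lebesgue" using h(1) by (rule L1w_measurable)
  have Bm: "B_integrand s v h x \<in> borel_measurable lebesgue" if "v \<in> borel_measurable lebesgue" for v
    unfolding B_integrand_powr[abs_def]
    by (intro borel_measurable_times norm_powr_measurable borel_measurable_diff that hm) auto
  have "(\<lambda>j. LINT z|lebesgue. B_integrand s (\<phi> j) h x z) \<longlonglongrightarrow> (LINT z|lebesgue. B_integrand s u h x z)"
  proof (rule integral_dominated_convergence)
    show "integrable lebesgue (\<lambda>z. 2 * M1 * (\<bar>h x - h z\<bar> * norm (x - z) powr (-(real DIM('a) + 2 * s))))"
      by (intro Bochner_Integration.integrable_mult_right integrable_kernel[OF s h(1) near])
    have "(\<lambda>j. B_integrand s (\<phi> j) h x z) \<longlonglongrightarrow> B_integrand s u h x z" for z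
    proof (cases "z = x")
      case False
      show ?thesis unfolding B_integrand_powr \<phi>x by (intro tendsto_intros lim False)
    qed (simp add: B_integrand_powr)
    then show "AE z in lebesgue. (\<lambda>j. B_integrand s (\<phi> j) h x z) \<longlonglongrightarrow> B_integrand s u h x z" by blast
    fix j
    have "\<bar>\<phi> j x - \<phi> j z\<bar> * (\<bar>h x - h z\<bar> * norm (x - z) powr (-(real DIM('a) + 2 * s)))
        \<le> 2 * M1 * (\<bar>h x - h z\<bar> * norm (x - z) powr (-(real DIM('a) + 2 * s)))" for z
      using \<phi>(2)[of j x] \<phi>(2)[of j z] by (intro mult_right_mono) auto
    then show "AE z in lebesgue. norm (B_integrand s (\<phi> j) h x z)
        \<le> 2 * M1 * (\<bar>h x - h z\<bar> * norm (x - z) powr (-(real DIM('a) + 2 * s)))"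
      by (intro AE_I2) (simp add: B_integrand_powr abs_mult mult.assoc)
  qed (auto intro: Bm \<phi> u)
  then have "(\<lambda>j. Bform s (\<phi> j) h x) \<longlonglongrightarrow> Bform s u h x"
    unfolding Bform_def by (intro tendsto_intros)
  then obtain j where "dist (Bform s (\<phi> j) h x) (Bform s u h x) < \<epsilon>"
    using \<epsilon> unfolding lim_sequentially by blast
  then show thesis using tv[of j] by (intro that) (auto simp: dist_real_def)
qed

text \<open>Since \<open>h x\<close> is a maximum, the increments of \<open>h\<close> are
  nonnegative, and those of \<open>u1\<close> at \<open>x\<close> may be replaced by the smaller
  increments of \<open>u2\<close> at \<open>y\<close> without changing the kernel at
  \<open>x\<close>. What remains is a difference of kernels.\<close>

lemma Bform_difference_bound:
  fixes h u1 u2 :: "'a::euclidean_space \<Rightarrow> real"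
  assumes s: "0 < s" "s < 1" and h: "h \<in> L1w s" and C: "0 \<le> C" and A: "0 \<le> A"
    and u1: "u1 \<in> borel_measurable lebesgue" "\<And>z. \<bar>u1 z\<bar> \<le> M"
    and u2: "u2 \<in> borel_measurable lebesgue" "\<And>z. \<bar>u2 z\<bar> \<le> M"
  shows "\<exists>E. \<forall>x y. norm x \<le> R \<longrightarrow> norm y \<le> R \<longrightarrow> h x = h y \<longrightarrow> \<bar>h x\<bar> \<le> A \<longrightarrow> (\<forall>z. h z \<le> h x) \<longrightarrow>
      (\<forall>z. norm (x - z) < 1 \<longrightarrow> \<bar>h x - h z\<bar> \<le> C * (norm (x - z))\<^sup>2) \<longrightarrow>
      (\<forall>z. norm (y - z) < 1 \<longrightarrow> \<bar>h y - h z\<bar> \<le> C * (norm (y - z))\<^sup>2) \<longrightarrow>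
      (\<forall>z. u2 y - u2 z \<le> u1 x - u1 z) \<longrightarrow>
      Bform s u2 h y - Bform s u1 h x \<le> E * norm (x - y) powr (1 - s)"
proof -
  define \<alpha> where "\<alpha> = real DIM('a) + 2 * s"
  define \<kappa> where "\<kappa> = frac_lap_const DIM('a) s / 2"
  have \<kappa>: "0 < \<kappa>" using frac_lap_const_pos[OF s, of "DIM('a)"] by (simp add: \<kappa>_def)
  have M: "0 \<le> M" using u1(2)[of undefined] by linarith
  have fin: "B_finite s u h x" if u: "u \<in> borel_measurable lebesgue" "\<And>z. \<bar>u z\<bar> \<le> M"
    and near: "\<And>z. norm (x - z) < 1 \<Longrightarrow> \<bar>h x - h z\<bar> \<le> C * (norm (x - z))\<^sup>2" for u x
  proof (rule B_finiteI[OF s zero_less_one u h])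
    fix z assume "norm (x - z) < 1"
    then have "\<bar>(u x - u z) * (h x - h z)\<bar> \<le> (2 * M) * (C * (norm (x - z))\<^sup>2)"
      unfolding abs_mult using u(2)[of x] u(2)[of z] M by (intro mult_mono near) auto
    then show "\<bar>(u x - u z) * (h x - h z)\<bar> \<le> (2 * M * C) * (norm (x - z))\<^sup>2" by simp
  qed
  obtain D where D: "\<forall>x y. norm x \<le> R \<longrightarrow> norm y \<le> R \<longrightarrow> h x = h y \<longrightarrow> \<bar>h x\<bar> \<le> A \<longrightarrow>
      (\<forall>z. norm (x - z) < 1 \<longrightarrow> \<bar>h x - h z\<bar> \<le> C * norm (x - z) ^ 2) \<longrightarrow>
      (\<forall>z. norm (y - z) < 1 \<longrightarrow> \<bar>h y - h z\<bar> \<le> C * norm (y - z) ^ 2) \<longrightarrow>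
      (LINT z|lebesgue. \<bar>h x - h z\<bar> * \<bar>norm (x - z) powr (-(real DIM('a) + 2 * s))
         - norm (y - z) powr (-(real DIM('a) + 2 * s))\<bar>) \<le> D * norm (x - y) powr (1 - s)"
    using kernel_difference_bound[OF s zero_less_one C A h, of R] ..
  show ?thesis
  proof (intro exI[of _ "\<kappa> * (2 * M * D)"] allI impI)
    fix x y assume xy: "norm x \<le> R" "norm y \<le> R" "h x = h y" "\<bar>h x\<bar> \<le> A" and max: "\<forall>z. h z \<le> h x"
      and xq: "\<forall>z. norm (x - z) < 1 \<longrightarrow> \<bar>h x - h z\<bar> \<le> C * (norm (x - z))\<^sup>2"
      and yq: "\<forall>z. norm (y - z) < 1 \<longrightarrow> \<bar>h y - h z\<bar> \<le> C * (norm (y - z))\<^sup>2"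
      and u12: "\<forall>z. u2 y - u2 z \<le> u1 x - u1 z"
    note x = xq[rule_format] and y = yq[rule_format]
    let ?X = "\<lambda>z. norm (x - z) powr (-\<alpha>)" and ?Y = "\<lambda>z. norm (y - z) powr (-\<alpha>)"
    let ?L = "\<lambda>z. \<bar>h x - h z\<bar> * \<bar>?X z - ?Y z\<bar>"
    have i1: "integrable lebesgue (B_integrand s u1 h x)" using fin[OF u1 x] by (simp add: B_finite_def)
    have i2: "integrable lebesgue (B_integrand s u2 h y)" using fin[OF u2 y] by (simp add: B_finite_def)
    have "integrable lebesgue (\<lambda>z. \<bar>\<bar>h x - h z\<bar> * ?X z - \<bar>h y - h z\<bar> * ?Y z\<bar>)"
      unfolding \<alpha>_def
      by (intro Bochner_Integration.integrable_abs Bochner_Integration.integrable_diff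
          integrable_kernel[OF s h x] integrable_kernel[OF s h y])
    moreover have "(\<lambda>z. \<bar>\<bar>h x - h z\<bar> * ?X z - \<bar>h y - h z\<bar> * ?Y z\<bar>) = ?L"
      using xy(3) by (simp add: fun_eq_iff abs_mult right_diff_distrib[symmetric])
    ultimately have iL: "integrable lebesgue ?L" by simp
    have "(LINT z|lebesgue. B_integrand s u2 h y z - B_integrand s u1 h x z) \<le> (LINT z|lebesgue. 2 * M * ?L z)"
    proof (rule integral_mono)
      fix z
      have k: "0 \<le> h x - h z" using max by simp
      have "B_integrand s u2 h y z - B_integrand s u1 h x z
          \<le> (u2 y - u2 z) * (h x - h z) * ?Y z - (u2 y - u2 z) * (h x - h z) * ?X z"
        using u12[rule_format, of z] k xy(3) unfolding B_integrand_powr \<alpha>_def[symmetric]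
        by (auto intro!: mult_right_mono)
      also have "\<dots> = (u2 y - u2 z) * ((h x - h z) * (?Y z - ?X z))" by (simp add: algebra_simps)
      also have "\<dots> \<le> \<bar>u2 y - u2 z\<bar> * \<bar>(h x - h z) * (?Y z - ?X z)\<bar>"
        unfolding abs_mult[symmetric] by (rule abs_ge_self)
      also have "\<dots> \<le> (2 * M) * \<bar>(h x - h z) * (?Y z - ?X z)\<bar>"
        using u2(2)[of y] u2(2)[of z] by (intro mult_right_mono) auto
      also have "\<dots> = 2 * M * ?L z" by (simp add: abs_mult abs_minus_commute)
      finally show "B_integrand s u2 h y z - B_integrand s u1 h x z \<le> 2 * M * ?L z" .
    qed (intro Bochner_Integration.integrable_diff i1 i2 Bochner_Integration.integrable_mult_right iL)+
    also have "\<dots> \<le> 2 * M * (D * norm (x - y) powr (1 - s))"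
      using D[rule_format, OF xy x y] M by (simp add: \<alpha>_def mult_left_mono)
    finally have "\<kappa> * (LINT z|lebesgue. B_integrand s u2 h y z - B_integrand s u1 h x z)
        \<le> \<kappa> * (2 * M * (D * norm (x - y) powr (1 - s)))"
      using \<kappa> by (intro mult_left_mono) auto
    then show "Bform s u2 h y - Bform s u1 h x \<le> \<kappa> * (2 * M * D) * norm (x - y) powr (1 - s)"
      using i1 i2 by (simp add: Bform_def \<kappa>_def[symmetric] right_diff_distrib mult_ac)
  qed
qed

text \<open>At a maximum of \<open>h\<close> the value \<open>\<B>(\<phi>,h)(x)\<close> can be lowered but not raised by
  enlarging \<open>\<phi>\<close>; the comparison of \<open>\<B>(u1,h)(x)\<close> with \<open>\<B>(u2,h)(y)\<close> supplies
  the missing direction.\<close>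

lemma close_test_values_max:
  fixes h u1 u2 :: "'a::euclidean_space \<Rightarrow> real"
  assumes s: "0 < s" "s < 1" and h: "h \<in> L1w s" "Ck_on 1 UNIV h"
    and \<Omega>: "open \<Omega>" "bounded \<Omega>" and xy: "x \<in> \<Omega>" "y \<in> \<Omega>"
    and u1: "u1 \<in> borel_measurable lebesgue" "\<And>z. \<bar>u1 z\<bar> \<le> M" "continuous_on (closure \<Omega>) u1"
    and u2: "u2 \<in> borel_measurable lebesgue" "\<And>z. \<bar>u2 z\<bar> \<le> M" "continuous_on (closure \<Omega>) u2"
    and touch: "touched \<Omega> u1 x" "touched \<Omega> (\<lambda>z. - u2 z) y" and \<epsilon>: "0 < \<epsilon>"
    and max: "\<And>z. h z \<le> h x"
    and x: "\<And>z. norm (x - z) < 1 \<Longrightarrow> \<bar>h x - h z\<bar> \<le> C * (norm (x - z))\<^sup>2"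
    and y: "\<And>z. norm (y - z) < 1 \<Longrightarrow> \<bar>h y - h z\<bar> \<le> C * (norm (y - z))\<^sup>2"
    and diff: "Bform s u2 h y - Bform s u1 h x \<le> \<epsilon> / 3"
  shows "\<exists>p q. p \<in> test_values s h \<Omega> u1 x \<and> - q \<in> test_values s h \<Omega> (\<lambda>z. - u2 z) y \<and> \<bar>p - q\<bar> < \<epsilon>"
proof -
  have m2: "(\<lambda>z. - u2 z) \<in> borel_measurable lebesgue" "\<And>z. \<bar>- u2 z\<bar> \<le> M"
    "continuous_on (closure \<Omega>) (\<lambda>z. - u2 z)"
    using u2 by (auto intro: continuous_intros)
  have \<epsilon>3: "0 < \<epsilon> / 3" using \<epsilon> by simp
  obtain p where p: "p \<in> test_values s h \<Omega> u1 x" "\<bar>p - Bform s u1 h x\<bar> < \<epsilon> / 3"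
    using test_values_approx[OF s h x \<Omega>(1) xy(1) \<Omega>(2) u1 touch(1) \<epsilon>3] by blast
  obtain q where q: "q \<in> test_values s h \<Omega> (\<lambda>z. - u2 z) y" "\<bar>q - Bform s (\<lambda>z. - u2 z) h y\<bar> < \<epsilon> / 3"
    using test_values_approx[OF s h y \<Omega>(1) xy(2) \<Omega>(2) m2 touch(2) \<epsilon>3] by blast
  have q': "\<bar>- q - Bform s u2 h y\<bar> < \<epsilon> / 3" using q(2) unfolding Bform_uminus by linarith
  show ?thesis
  proof (cases "\<bar>p + q\<bar> < \<epsilon>")
    case True
    then show ?thesis using p(1) q(1) by (intro exI[of _ p] exI[of _ "-q"]) auto
  next
    case False
    \<comment> \<open>The three errors of \<open>\<epsilon> / 3\<close> already exclude
      \<open>- q \<ge> p + \<epsilon>\<close>, so values that are not close must be ordered this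
      way, and lowering \<open>p\<close> is the permitted direction.\<close>
    then have le: "- q \<le> p" using p(2) q' diff by linarith
    show ?thesis
    proof (cases "\<exists>z. h z < h x")
      case True
      then obtain z where "h z < h x" ..
      then have "- q \<in> test_values s h \<Omega> u1 x" using test_values_lower[OF s h _ p(1) le] by blast
      then show ?thesis using q(1) \<epsilon> by (intro exI[of _ "-q"]) auto
    next
      case False
      \<comment> \<open>No bump can lower anything for constant \<open>h\<close>, but then both
        forms vanish and \<open>p\<close>, \<open>- q\<close> were close from the start.\<close>
      then have const: "h z = h x" for z using max[of z] by (simp add: antisym not_less)
      have "B_integrand s u h w z = 0" for u w z
        unfolding B_integrand_powr using const[of w] const[of z] by simp
      then have "Bform s u h w = 0" for u w by (simp add: Bform_def)
      then show ?thesis using p(2) q' \<open>\<not> \<bar>p + q\<bar> < \<epsilon>\<close> by simp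
    qed
  qed
qed

lemma close_test_values:
  fixes h u1 u2 :: "'a::euclidean_space \<Rightarrow> real"
  assumes s: "0 < s" "s < 1" and h: "h \<in> L1w s" "smooth h"
    and \<Omega>: "open \<Omega>" "bounded \<Omega>"
    and u1: "u1 \<in> borel_measurable lebesgue" "\<And>z. \<bar>u1 z\<bar> \<le> M" "continuous_on (closure \<Omega>) u1"
    and u2: "u2 \<in> borel_measurable lebesgue" "\<And>z. \<bar>u2 z\<bar> \<le> M" "continuous_on (closure \<Omega>) u2"
    and \<epsilon>: "0 < \<epsilon>"
  shows "\<exists>\<delta>>0. \<forall>x\<in>\<Omega>. \<forall>y\<in>\<Omega>. norm (x - y) < \<delta> \<longrightarrow>
    touched \<Omega> u1 x \<longrightarrow> touched \<Omega> (\<lambda>z. - u2 z) y \<longrightarrow> (\<forall>z. u2 y - u2 z \<le> u1 x - u1 z) \<longrightarrow>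
    (\<exists>p q. p \<in> test_values s h \<Omega> u1 x \<and> - q \<in> test_values s h \<Omega> (\<lambda>z. - u2 z) y \<and> \<bar>p - q\<bar> < \<epsilon>)"
proof -
  have h1: "Ck_on 1 UNIV h" and h2: "Ck_on 2 UNIV h" using h(2) unfolding smooth_def by blast+
  obtain R where R: "\<And>x. x \<in> \<Omega> \<Longrightarrow> norm x \<le> R" using \<Omega>(2) by (auto simp: bounded_iff)
  obtain C where C: "0 \<le> C" "\<And>x z. norm x \<le> R \<Longrightarrow> (\<forall>z. h z \<le> h x) \<or> (\<forall>z. h x \<le> h z) \<Longrightarrow>
    norm (x - z) < 1 \<Longrightarrow> \<bar>h x - h z\<bar> \<le> C * (norm (x - z))\<^sup>2"
    using Ck_on_2_extremum_bound[OF h2] by blast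
  have hc: "continuous_on (closure \<Omega>) h"
    using Ck_on_1_imp_continuous_on[OF h1] continuous_on_subset by blast
  have "bounded (h ` closure \<Omega>)"
    using hc \<Omega>(2) by (intro compact_imp_bounded compact_continuous_image) auto
  then obtain A where A0: "\<And>x. x \<in> closure \<Omega> \<Longrightarrow> \<bar>h x\<bar> \<le> A" by (auto simp: bounded_iff)
  then have A: "\<bar>h x\<bar> \<le> \<bar>A\<bar>" if "x \<in> \<Omega>" for x
    using that closure_subset[of \<Omega>] by force
  \<comment> \<open>Stated for a generic \<open>g\<close> so that it applies to both
    \<open>h\<close> and \<open>- h\<close>, turning minima into maxima.\<close>
  have step: "\<exists>E. \<forall>x\<in>\<Omega>. \<forall>y\<in>\<Omega>. g x = g y \<longrightarrow> (\<forall>z. g z \<le> g x) \<longrightarrow> (\<forall>z. u2 y - u2 z \<le> u1 x - u1 z) \<longrightarrow>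
      Bform s u2 g y - Bform s u1 g x \<le> E * norm (x - y) powr (1 - s)"
    if g: "g \<in> L1w s" "\<And>x. \<bar>g x\<bar> = \<bar>h x\<bar>" "\<And>x y. \<bar>g x - g y\<bar> = \<bar>h x - h y\<bar>"
      and ext: "\<And>x. \<forall>z. g z \<le> g x \<Longrightarrow> (\<forall>z. h z \<le> h x) \<or> (\<forall>z. h x \<le> h z)" for g
  proof -
    obtain E where E: "\<forall>x y. norm x \<le> R \<longrightarrow> norm y \<le> R \<longrightarrow> g x = g y \<longrightarrow> \<bar>g x\<bar> \<le> \<bar>A\<bar> \<longrightarrow> (\<forall>z. g z \<le> g x) \<longrightarrow>
      (\<forall>z. norm (x - z) < 1 \<longrightarrow> \<bar>g x - g z\<bar> \<le> C * (norm (x - z))\<^sup>2) \<longrightarrow>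
      (\<forall>z. norm (y - z) < 1 \<longrightarrow> \<bar>g y - g z\<bar> \<le> C * (norm (y - z))\<^sup>2) \<longrightarrow>
      (\<forall>z. u2 y - u2 z \<le> u1 x - u1 z) \<longrightarrow>
      Bform s u2 g y - Bform s u1 g x \<le> E * norm (x - y) powr (1 - s)"
      using Bform_difference_bound[OF s g(1) C(1) abs_ge_zero[of A] u1(1,2) u2(1,2), of R] ..
    show ?thesis
    proof (intro exI[of _ E] ballI impI)
      fix x y assume *: "x \<in> \<Omega>" "y \<in> \<Omega>" "g x = g y" "\<forall>z. g z \<le> g x" "\<forall>z. u2 y - u2 z \<le> u1 x - u1 z"
      then have gy: "\<forall>z. g z \<le> g y" by simp
      show "Bform s u2 g y - Bform s u1 g x \<le> E * norm (x - y) powr (1 - s)"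
      proof (rule E[rule_format, OF R[OF *(1)] R[OF *(2)] *(3)])
        show "\<bar>g x\<bar> \<le> \<bar>A\<bar>" using A[OF *(1)] g(2) by simp
        show "\<bar>g x - g z\<bar> \<le> C * (norm (x - z))\<^sup>2" if "norm (x - z) < 1" for z
          using C(2)[OF R[OF *(1)] ext[OF *(4)] that] g(3) by simp
        show "\<bar>g y - g z\<bar> \<le> C * (norm (y - z))\<^sup>2" if "norm (y - z) < 1" for z
          using C(2)[OF R[OF *(2)] ext[OF gy] that] g(3) by simp
      qed (use * in auto)
    qed
  qed
  let ?h = "\<lambda>z. - h z"
  have h': "?h \<in> L1w s" "Ck_on 1 UNIV ?h" using L1w_uminus[OF h(1)] Ck_on_1_uminus[OF h1] .
  have "\<exists>E. \<forall>x\<in>\<Omega>. \<forall>y\<in>\<Omega>. h x = h y \<longrightarrow> (\<forall>z. h z \<le> h x) \<longrightarrow> (\<forall>z. u2 y - u2 z \<le> u1 x - u1 z) \<longrightarrow>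
      Bform s u2 h y - Bform s u1 h x \<le> E * norm (x - y) powr (1 - s)"
    by (rule step[OF h(1)]) auto
  then obtain E1 where E1: "\<And>x y. x \<in> \<Omega> \<Longrightarrow> y \<in> \<Omega> \<Longrightarrow> h x = h y \<Longrightarrow> \<forall>z. h z \<le> h x \<Longrightarrow>
      \<forall>z. u2 y - u2 z \<le> u1 x - u1 z \<Longrightarrow> Bform s u2 h y - Bform s u1 h x \<le> E1 * norm (x - y) powr (1 - s)"
    by blast
  have "\<exists>E. \<forall>x\<in>\<Omega>. \<forall>y\<in>\<Omega>. ?h x = ?h y \<longrightarrow> (\<forall>z. ?h z \<le> ?h x) \<longrightarrow> (\<forall>z. u2 y - u2 z \<le> u1 x - u1 z) \<longrightarrow>
      Bform s u2 ?h y - Bform s u1 ?h x \<le> E * norm (x - y) powr (1 - s)"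
    by (rule step[OF h'(1)]) auto
  then obtain E2 where E2: "\<And>x y. x \<in> \<Omega> \<Longrightarrow> y \<in> \<Omega> \<Longrightarrow> ?h x = ?h y \<Longrightarrow> \<forall>z. ?h z \<le> ?h x \<Longrightarrow>
      \<forall>z. u2 y - u2 z \<le> u1 x - u1 z \<Longrightarrow> Bform s u2 ?h y - Bform s u1 ?h x \<le> E2 * norm (x - y) powr (1 - s)"
    by blast
  define E where "E = \<bar>E1\<bar> + \<bar>E2\<bar> + 1"
  have E: "0 < E" "E1 \<le> E" "E2 \<le> E" by (auto simp: E_def)
  \<comment> \<open>Solves \<open>E * \<delta>1 powr (1 - s) = \<epsilon> / 3\<close>, the tolerance
    expected at a common extremum.\<close>
  define \<delta>1 where "\<delta>1 = (\<epsilon> / (3 * E)) powr (1 / (1 - s))"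
  have \<delta>1: "0 < \<delta>1" using \<epsilon> E by (simp add: \<delta>1_def)
  have small: "E' * d powr (1 - s) \<le> \<epsilon> / 3" if "0 \<le> d" "d < \<delta>1" "E' \<le> E" for d E'
  proof -
    have "d powr (1 - s) \<le> \<delta>1 powr (1 - s)" using that s by (intro powr_mono2) auto
    also have "\<dots> = \<epsilon> / (3 * E)" using s \<epsilon> E by (simp add: \<delta>1_def powr_powr)
    finally have "E * d powr (1 - s) \<le> \<epsilon> / 3" using E by (simp add: field_simps)
    moreover have "E' * d powr (1 - s) \<le> E * d powr (1 - s)" using that by (intro mult_right_mono) auto
    ultimately show ?thesis by linarith
  qed
  \<comment> \<open>Nearby points cannot be one a maximum and the other a minimum of a nonconstant
    \<open>h\<close>: then \<open>\<bar>h x - h y\<bar>\<close> would be its full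
    oscillation.\<close>
  have "\<exists>\<delta>2>0. \<forall>x\<in>\<Omega>. \<forall>y\<in>\<Omega>. norm (x - y) < \<delta>2 \<longrightarrow> (\<forall>a b. h a = h b) \<or> (\<exists>a b. \<bar>h x - h y\<bar> < h b - h a)"
  proof (cases "\<forall>a b. h a = h b")
    case False
    then obtain a b where ab: "h a < h b" by (metis linorder_neqE_linordered_idom)
    have "uniformly_continuous_on (closure \<Omega>) h"
      using hc \<Omega>(2) by (intro compact_uniformly_continuous) auto
    then obtain d where "0 < d" "\<forall>x\<in>closure \<Omega>. \<forall>y\<in>closure \<Omega>. dist y x < d \<longrightarrow> dist (h y) (h x) < h b - h a"
      unfolding uniformly_continuous_on_def using ab by (meson diff_gt_0_iff_gt)
    then show ?thesis
      using closure_subset[of \<Omega>] by (intro exI[of _ d]) (auto simp: dist_norm dist_real_def subset_iff, metis)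
  qed (auto intro: exI[of _ 1])
  then obtain \<delta>2 where \<delta>2: "0 < \<delta>2" "\<And>x y. x \<in> \<Omega> \<Longrightarrow> y \<in> \<Omega> \<Longrightarrow> norm (x - y) < \<delta>2 \<Longrightarrow>
      (\<forall>a b. h a = h b) \<or> (\<exists>a b. \<bar>h x - h y\<bar> < h b - h a)" by blast
  have m2: "(\<lambda>z. - u2 z) \<in> borel_measurable lebesgue" "\<And>z. \<bar>- u2 z\<bar> \<le> M"
    using u2 by auto
  show ?thesis
  proof (rule exI[of _ "min \<delta>1 \<delta>2"], intro conjI ballI impI)
    fix x y
    assume xy: "x \<in> \<Omega>" "y \<in> \<Omega>" and d: "norm (x - y) < min \<delta>1 \<delta>2"
      and touch: "touched \<Omega> u1 x" "touched \<Omega> (\<lambda>z. - u2 z) y" and u12: "\<forall>z. u2 y - u2 z \<le> u1 x - u1 z"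
    let ?Q = "\<lambda>p q. p \<in> test_values s h \<Omega> u1 x \<and> - q \<in> test_values s h \<Omega> (\<lambda>z. - u2 z) y \<and> \<bar>p - q\<bar> < \<epsilon>"
    obtain p where p: "p \<in> test_values s h \<Omega> u1 x"
      using test_values_nonempty[OF s h(1) h1 \<Omega>(1) xy(1) u1(1,2) touch(1)] by blast
    obtain q where q: "q \<in> test_values s h \<Omega> (\<lambda>z. - u2 z) y"
      using test_values_nonempty[OF s h(1) h1 \<Omega>(1) xy(2) m2 touch(2)] by blast
    have all: "p' \<in> test_values s h \<Omega> u w"
      if "h a < h w" "h w < h b" "p \<in> test_values s h \<Omega> u w" for p p' u w a b
      using test_values_lower[OF s h(1) h1 that(1,3)] test_values_raise[OF s h(1) h1 that(2,3)] linear by blast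
    have far: False if "\<not> (\<forall>a b. h a = h b)" "\<And>a b. h b - h a \<le> \<bar>h x - h y\<bar>"
      using \<delta>2(2)[OF xy] d that by (auto simp: not_less[symmetric])
    \<comment> \<open>If \<open>h\<close> takes values on both sides at one of the points, every
      real value is attained there and the other point dictates it. Otherwise both points are
      extrema, necessarily of the same kind.\<close>
    consider "\<exists>a b. h a < h x \<and> h x < h b" | "\<exists>a b. h a < h y \<and> h y < h b"
      | "\<forall>z. h z \<le> h x" "\<forall>z. h z \<le> h y" | "\<forall>z. h x \<le> h z" "\<forall>z. h y \<le> h z"
    proof -
      have "\<not> ((\<forall>z. h z \<le> h x) \<and> (\<forall>z. h y \<le> h z))" "\<not> ((\<forall>z. h x \<le> h z) \<and> (\<forall>z. h z \<le> h y))"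
        if "\<not> (\<forall>a b. h a = h b)"
        using far[OF that] by (smt (verit))+
      moreover have "(\<forall>z. h z \<le> h x) \<and> (\<forall>z. h z \<le> h y)" if "\<forall>a b. h a = h b"
        using that by (metis order_refl)
      ultimately show thesis using that by (meson not_less)
    qed
    then show "\<exists>p q. ?Q p q"
    proof cases
      case 1
      then have "- q \<in> test_values s h \<Omega> u1 x" using all p by blast
      then show ?thesis using q \<epsilon> by (intro exI[of _ "- q"]) auto
    next
      case 2
      then have "- p \<in> test_values s h \<Omega> (\<lambda>z. - u2 z) y" using all q by blast
      then show ?thesis using p \<epsilon> by (intro exI[of _ p]) auto
    next
      case 3
      then have eq: "h x = h y" by (meson antisym)
      show ?thesis
      proof (rule close_test_values_max[OF s h(1) h1 \<Omega> xy u1 u2 touch \<epsilon>])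
        show "\<bar>h x - h z\<bar> \<le> C * (norm (x - z))\<^sup>2" if "norm (x - z) < 1" for z
          using C(2)[OF R[OF xy(1)] _ that] 3 by blast
        show "\<bar>h y - h z\<bar> \<le> C * (norm (y - z))\<^sup>2" if "norm (y - z) < 1" for z
          using C(2)[OF R[OF xy(2)] _ that] 3 by blast
        have "Bform s u2 h y - Bform s u1 h x \<le> E1 * norm (x - y) powr (1 - s)"
          using E1[OF xy eq 3(1)] u12 by blast
        also have "\<dots> \<le> \<epsilon> / 3" using d E by (intro small) auto
        finally show "Bform s u2 h y - Bform s u1 h x \<le> \<epsilon> / 3" .
      qed (use 3 in auto)
    next
      case 4
      then have eq: "?h x = ?h y" by (simp add: antisym)
      have max: "\<forall>z. ?h z \<le> ?h x" using 4 by simp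
      have "\<exists>p q. p \<in> test_values s ?h \<Omega> u1 x \<and> - q \<in> test_values s ?h \<Omega> (\<lambda>z. - u2 z) y \<and> \<bar>p - q\<bar> < \<epsilon>"
      proof (rule close_test_values_max[OF s h' \<Omega> xy u1 u2 touch \<epsilon>])
        show "\<bar>?h x - ?h z\<bar> \<le> C * (norm (x - z))\<^sup>2" if "norm (x - z) < 1" for z
          using C(2)[OF R[OF xy(1)] _ that] 4 by auto
        show "\<bar>?h y - ?h z\<bar> \<le> C * (norm (y - z))\<^sup>2" if "norm (y - z) < 1" for z
          using C(2)[OF R[OF xy(2)] _ that] 4 by auto
        have "Bform s u2 ?h y - Bform s u1 ?h x \<le> E2 * norm (x - y) powr (1 - s)"
          using E2[OF xy eq max] u12 by blast
        also have "\<dots> \<le> \<epsilon> / 3" using d E by (intro small) auto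
        finally show "Bform s u2 ?h y - Bform s u1 ?h x \<le> \<epsilon> / 3" .
      qed (use max in auto)
      then obtain p q where "p \<in> test_values s ?h \<Omega> u1 x" "- q \<in> test_values s ?h \<Omega> (\<lambda>z. - u2 z) y" "\<bar>p - q\<bar> < \<epsilon>"
        by blast
      \<comment> \<open>Passing from \<open>- h\<close> back to \<open>h\<close> negates every test
        value, while the distance is unchanged.\<close>
      then have "?Q (- p) (- q)" unfolding test_values_uminus by (simp add: abs_minus_commute)
      then show ?thesis by blast
    qed
  qed (use \<delta>1 \<delta>2 in auto)
qed

subsection \<open>The comparison principle\<close>

text \<open>The continuity condition on \<open>H\<close> in case (b) involves one function
  \<open>v\<close> paired with two functions \<open>h1\<close>, \<open>h2\<close>. With
  \<open>v\<close> the indicator of the complement, a multiple of a cosine peaked at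
  \<open>x\<close> realises any given number as a value of the form, so the condition applies to
  arbitrary \<open>p\<close> and \<open>q\<close>.\<close>

lemma Bform_prescribed:
  fixes \<Omega> :: "'a::euclidean_space set"
  assumes s: "0 < s" "s < 1" and \<Omega>: "open \<Omega>" "bounded \<Omega>" and x: "x \<in> \<Omega>"
  obtains h where "smooth h" "h \<in> L1w s" "B_finite s (indicator (- \<Omega>)) h x"
    "Bform s (indicator (- \<Omega>)) h x = p"
proof -
  define v :: "'a \<Rightarrow> real" where "v = indicator (- \<Omega>)"
  have vm: "v \<in> borel_measurable lebesgue" and vb: "\<And>z. \<bar>v z\<bar> \<le> 1"
    using \<Omega>(1) by (auto simp: v_def indicator_def intro!: borel_measurable_indicator)
  obtain e :: 'a where e: "e \<in> Basis" using nonempty_Basis by blast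
  define g where "g c z = c * cos (e \<bullet> z + - (e \<bullet> x))" for c z
  have gm: "g c \<in> borel_measurable lebesgue" for c
    unfolding g_def[abs_def]
    by (intro measurable_completion) (simp add: borel_measurable_continuous_onI continuous_intros)
  have g: "smooth (g c)" "g c \<in> L1w s" for c
  proof -
    show "smooth (g c)" unfolding g_def[abs_def] by (rule smooth_cos)
    show "g c \<in> L1w s"
      by (rule bounded_in_L1w[OF s(1) gm, of c "\<bar>c\<bar>"]) (simp add: g_def abs_mult mult_left_le)
  qed
  obtain r where r: "0 < r" "ball x r \<subseteq> \<Omega>" using \<Omega>(1) x open_contains_ball by blast
  have fin: "B_finite s v (g c) x" for c
  \<comment> \<open>\<open>v\<close> is constant on \<open>\<Omega>\<close>, so the increments
    vanish near \<open>x\<close> and \<open>C = 0\<close> works.\<close>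
  proof (rule B_finiteI[OF s r(1) vm vb g(2), where C=0])
    fix z assume "norm (x - z) < r"
    then have "z \<in> \<Omega>" using r(2) by (auto simp: dist_norm)
    then show "\<bar>(v x - v z) * (g c x - g c z)\<bar> \<le> 0 * (norm (x - z))\<^sup>2" using x by (simp add: v_def)
  qed
  obtain B where B: "\<And>z. z \<in> \<Omega> \<Longrightarrow> norm z \<le> B" using \<Omega>(2) by (auto simp: bounded_iff)
  have "0 < (LINT z|lebesgue. - B_integrand s v (g 1) x z)"
  proof (rule integral_pos_open[of _ "- cball 0 B \<inter> {z. cos (e \<bullet> z + - (e \<bullet> x)) < 1}"])
    show "integrable lebesgue (\<lambda>z. - B_integrand s v (g 1) x z)" using fin by (simp add: B_finite_def)
    show "0 \<le> - B_integrand s v (g 1) x z" for z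
      using x by (auto simp: B_integrand_powr v_def g_def indicator_def)
    show "open (- cball 0 B \<inter> {z. cos (e \<bullet> z + - (e \<bullet> x)) < 1})"
      by (intro open_Int open_Collect_less continuous_intros) auto
    obtain k :: nat where k: "B + norm x < real k" using reals_Archimedean2 by blast
    \<comment> \<open>An odd multiple of \<open>pi\<close> along \<open>e\<close> makes the cosine
      \<open>-1\<close>, and \<open>k\<close> is large enough to leave the ball containing
      \<open>\<Omega>\<close>.\<close>
    let ?z = "x + ((2 * real k + 1) * pi) *\<^sub>R e"
    have "real k \<le> (2 * real k + 1) * 1" by simp
    also have "\<dots> \<le> (2 * real k + 1) * pi" using pi_gt3 by (intro mult_left_mono) auto
    also have "\<dots> = norm (((2 * real k + 1) * pi) *\<^sub>R e)" using e by (simp add: abs_mult)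
    also have "\<dots> \<le> norm ?z + norm x" using norm_triangle_ineq4[of ?z x] by simp
    finally have "?z \<in> - cball 0 B" using k by simp
    moreover have "cos (e \<bullet> ?z + - (e \<bullet> x)) = -1"
      using e cos_npi[of "2 * k + 1"] by (simp add: inner_add_right algebra_simps)
    ultimately show "- cball 0 B \<inter> {z. cos (e \<bullet> z + - (e \<bullet> x)) < 1} \<noteq> {}" by force
    fix z assume z: "z \<in> - cball 0 B \<inter> {z. cos (e \<bullet> z + - (e \<bullet> x)) < 1}"
    then have "z \<notin> \<Omega>" using B by auto
    moreover from this have "x \<noteq> z" using x by auto
    ultimately show "0 < - B_integrand s v (g 1) x z"
      using z x by (auto simp: B_integrand_powr v_def g_def intro!: mult_neg_pos)
  qed
  then have I: "Bform s v (g 1) x < 0"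
    using frac_lap_const_pos[OF s, of "DIM('a)"] by (simp add: Bform_def mult_less_0_iff)
  have eq: "B_integrand s v (g c) x = (\<lambda>z. c * B_integrand s v (g 1) x z)" for c
    by (simp add: B_integrand_powr g_def fun_eq_iff algebra_simps)
  have "Bform s v (g c) x = c * Bform s v (g 1) x" for c
    unfolding Bform_def eq[of c] by simp
  from this[of "p / Bform s v (g 1) x"] have "Bform s v (g (p / Bform s v (g 1) x)) x = p" using I by simp
  then show thesis using that[OF g fin[unfolded v_def]] unfolding v_def by blast
qed

lemma indicator_in_C1_L1w:
  fixes \<Omega> :: "'a::euclidean_space set"
  assumes "0 < s" "open \<Omega>"
  shows "indicator (- \<Omega>) \<in> C1_L1w s \<Omega>"
proof -
  have "(\<lambda>z. if z \<in> \<Omega> then 0 else 1 :: real) \<in> C1_L1w s \<Omega>"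
    by (rule C1_L1w_piecewise(3)[OF assms Ck_on_1_const, where u="\<lambda>_. 1" and M=1]) auto
  moreover have "indicator (- \<Omega>) = (\<lambda>z. if z \<in> \<Omega> then 0 else 1 :: real)"
    by (auto simp: indicator_def)
  ultimately show ?thesis by simp
qed

section \<open>Doubling of variables\<close>

lemma doubling_maximum:
  fixes u1 u2 :: "'a::euclidean_space \<Rightarrow> real"
  assumes T: "compact T" "x0 \<in> T" and u: "continuous_on T u1" "continuous_on T u2"
    and M: "\<And>z. \<bar>u2 z\<bar> \<le> M" and n: "0 < n"
  defines "K \<equiv> 4 * M + 1" \<comment> \<open>larger than \<open>4 M\<close>, so that the penalty is below \<open>K / 2\<close> at the maximum\<close>
  obtains x y where "x \<in> T" "y \<in> T" "n * norm (x - y) \<le> 1"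
    "\<And>z. z \<in> T \<Longrightarrow> u1 z - u2 z \<le> u1 x - u2 y"
    "\<And>z. z \<in> T \<Longrightarrow> u1 z - K * (1 - bump n y z) \<le> u1 x - K * (1 - bump n y x)"
    "\<And>z. z \<in> T \<Longrightarrow> - u2 z - K * (1 - bump n x z) \<le> - u2 y - K * (1 - bump n x y)"
proof -
  have M0: "0 \<le> M" using M[of x0] by linarith
  let ?F = "\<lambda>(x, y). u1 x - u2 y - K * (1 - bump n y x)"
  have "continuous_on (T \<times> T) (\<lambda>w. u1 (fst w) - u2 (snd w) - K * (1 - bump n (snd w) (fst w)))"
    by (intro continuous_intros continuous_on_compose2[OF u(1)] continuous_on_compose2[OF u(2)]) auto
  then have "continuous_on (T \<times> T) ?F" by (simp add: case_prod_beta)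
  then obtain w where w: "w \<in> T \<times> T" "\<And>w'. w' \<in> T \<times> T \<Longrightarrow> ?F w' \<le> ?F w"
    using continuous_attains_sup[of "T \<times> T" ?F] T compact_Times by blast
  obtain x y where wxy: "w = (x, y)" by force
  have xy: "x \<in> T" "y \<in> T" using w(1) wxy by auto
  have F: "u1 a - u2 b - K * (1 - bump n b a) \<le> u1 x - u2 y - K * (1 - bump n y x)"
    if "a \<in> T" "b \<in> T" for a b using w(2)[of "(a, b)"] that wxy by simp
  have K: "0 < K" using M0 by (simp add: K_def)
  \<comment> \<open>Comparison with the diagonal pair at \<open>x\<close> bounds the penalty by an
    increment of \<open>u2\<close>. It is thus below \<open>K / 2\<close>, so the bump exceeds
    \<open>1 / 2\<close>, which means \<open>n * norm (x - y) < 1\<close>.\<close>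
  have "K * (1 - bump n y x) \<le> 2 * M"
    using F[OF xy(1) xy(1)] M[of x] M[of y] by simp
  then have "K * (1 - bump n y x) < K * (1 / 2)" by (simp add: K_def)
  then have b: "1 / 2 < bump n y x" using K by (simp add: mult_less_cancel_left)
  have pos: "0 < 1 + n\<^sup>2 * (norm (x - y))\<^sup>2" by (simp add: add_pos_nonneg)
  have "(n * norm (x - y))\<^sup>2 < 1\<^sup>2"
    using b pos unfolding bump_def by (simp add: field_simps power_mult_distrib)
  then have "n * norm (x - y) < 1" by (rule power_less_imp_less_base) simp
  then have 1: "n * norm (x - y) \<le> 1" by simp
  \<comment> \<open>Comparison with the diagonal pair at \<open>z\<close>, where the penalty is 0.
    The two contact statements that follow come from freezing one variable.\<close>
  have 2: "u1 z - u2 z \<le> u1 x - u2 y" if "z \<in> T" for z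
  proof -
    have "0 \<le> K * (1 - bump n y x)" using K bump_bounds(2)[of n y x] by simp
    then show ?thesis using F[OF that that] unfolding bump_self diff_self mult_zero_right by linarith
  qed
  have 3: "u1 z - K * (1 - bump n y z) \<le> u1 x - K * (1 - bump n y x)" if "z \<in> T" for z
    using F[OF that xy(2)] by simp
  have 4: "- u2 z - K * (1 - bump n x z) \<le> - u2 y - K * (1 - bump n x y)" if "z \<in> T" for z
    using F[OF xy(1) that] by (simp add: bump_commute[of n x])
  show thesis using that[OF xy 1 2 3 4] .
qed

text \<open>If a ball left \<open>\<Omega>\<close>, some frontier point \<open>b\<close> would be
  close to both \<open>x\<close> and \<open>y\<close>. There \<open>u1 b \<le> u2 b\<close>, and
  uniform continuity would force \<open>u1 x - u2 y\<close> below \<open>\<theta>\<close>.\<close>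

lemma doubling_interior:
  fixes u1 u2 :: "'a::euclidean_space \<Rightarrow> real"
  assumes \<Omega>: "open \<Omega>" "bounded \<Omega>"
    and u: "continuous_on (closure \<Omega>) u1" "continuous_on (closure \<Omega>) u2"
    and ext: "\<And>x. x \<notin> \<Omega> \<Longrightarrow> u1 x \<le> u2 x" and \<theta>: "0 < \<theta>"
  obtains \<delta> where "0 < \<delta>" "\<And>x y. x \<in> closure \<Omega> \<Longrightarrow> y \<in> closure \<Omega> \<Longrightarrow> norm (x - y) < \<delta> \<Longrightarrow>
    \<theta> \<le> u1 x - u2 y \<Longrightarrow> ball x \<delta> \<subseteq> \<Omega> \<and> ball y \<delta> \<subseteq> \<Omega>"
proof -
  have uc: "uniformly_continuous_on (closure \<Omega>) u1" "uniformly_continuous_on (closure \<Omega>) u2"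
    using u \<Omega>(2) by (auto intro: compact_uniformly_continuous)
  obtain d1 where d1: "0 < d1" "\<And>a b. a \<in> closure \<Omega> \<Longrightarrow> b \<in> closure \<Omega> \<Longrightarrow> dist a b < d1 \<Longrightarrow> dist (u1 a) (u1 b) < \<theta> / 2"
    using uc(1) \<theta> unfolding uniformly_continuous_on_def by (meson half_gt_zero)
  obtain d2 where d2: "0 < d2" "\<And>a b. a \<in> closure \<Omega> \<Longrightarrow> b \<in> closure \<Omega> \<Longrightarrow> dist a b < d2 \<Longrightarrow> dist (u2 a) (u2 b) < \<theta> / 2"
    using uc(2) \<theta> unfolding uniformly_continuous_on_def by (meson half_gt_zero)
  \<comment> \<open>The frontier point is within \<open>\<delta>\<close> of one point and therefore
    within \<open>2 * \<delta>\<close> of the other.\<close>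
  define \<delta> where "\<delta> = min d1 d2 / 2"
  have \<delta>: "0 < \<delta>" using d1 d2 by (simp add: \<delta>_def)
  have frontier: False if "x \<in> closure \<Omega>" "y \<in> closure \<Omega>" "dist x b < 2 * \<delta>" "dist y b < 2 * \<delta>"
    "\<theta> \<le> u1 x - u2 y" "b \<in> frontier \<Omega>" for x y b
  proof -
    have b: "b \<in> closure \<Omega>" "b \<notin> \<Omega>" using that(6) \<Omega>(1) by (auto simp: frontier_def interior_open)
    have "dist (u1 x) (u1 b) < \<theta> / 2" using that by (intro d1 b) (auto simp: \<delta>_def)
    moreover have "dist (u2 y) (u2 b) < \<theta> / 2" using that by (intro d2 b) (auto simp: \<delta>_def)
    ultimately show False using ext[OF b(2)] that(5) by (simp add: dist_real_def abs_if split: if_splits)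
  qed
  have touch: "\<exists>b\<in>frontier \<Omega>. dist x b < \<delta>" if "x \<in> closure \<Omega>" "\<not> ball x \<delta> \<subseteq> \<Omega>" for x
  proof -
    have "ball x \<delta> \<inter> \<Omega> \<noteq> {}"
      using that(1) \<delta> by (metis centre_in_ball open_Int_closure_eq_empty open_ball disjoint_iff)
    moreover have "ball x \<delta> - \<Omega> \<noteq> {}" using that(2) by auto
    ultimately have "ball x \<delta> \<inter> frontier \<Omega> \<noteq> {}" by (intro connected_Int_frontier) auto
    then show ?thesis by auto
  qed
  show thesis
  proof (rule that[OF \<delta>], rule conjI)
    fix x y assume *: "x \<in> closure \<Omega>" "y \<in> closure \<Omega>" "norm (x - y) < \<delta>" "\<theta> \<le> u1 x - u2 y"
    show "ball x \<delta> \<subseteq> \<Omega>"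
    proof (rule ccontr)
      assume "\<not> ball x \<delta> \<subseteq> \<Omega>"
      then obtain b where b: "b \<in> frontier \<Omega>" "dist x b < \<delta>" using touch *(1) by blast
      then have "dist y b < 2 * \<delta>"
        using *(3) dist_triangle[of y b x] by (simp add: dist_norm norm_minus_commute)
      then show False using frontier[OF *(1,2) _ _ *(4) b(1)] b(2) \<delta> by simp
    qed
    show "ball y \<delta> \<subseteq> \<Omega>"
    proof (rule ccontr)
      assume "\<not> ball y \<delta> \<subseteq> \<Omega>"
      then obtain b where b: "b \<in> frontier \<Omega>" "dist y b < \<delta>" using touch *(2) by blast
      then have "dist x b < 2 * \<delta>"
        using *(3) dist_triangle[of x b y] by (simp add: dist_norm norm_minus_commute)
      then show False using frontier[OF *(1,2) _ _ *(4) b(1)] b(2) \<delta> by simp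
    qed
  qed
qed

section \<open>From contact to inequalities\<close>

lemma modulus_of_continuity_small:
  assumes "modulus_of_continuity \<omega>" "0 < (e::real)"
  obtains d where "0 < d" "\<And>t. 0 \<le> t \<Longrightarrow> t < d \<Longrightarrow> \<omega> t < e"
proof -
  have "continuous_on {0..} \<omega>" "\<omega> 0 = 0" using assms(1) by (auto simp: modulus_of_continuity_def)
  then obtain d where "0 < d" "\<forall>t\<in>{0..}. dist t 0 < d \<longrightarrow> dist (\<omega> t) (\<omega> 0) < e"
    using assms(2) unfolding continuous_on_iff by (metis atLeast_iff order_refl)
  then show thesis using \<open>\<omega> 0 = 0\<close> by (intro that[of d]) (auto simp: dist_real_def abs_less_iff)
qed

lemma touchedI_bump:
  fixes \<Omega> :: "'a::euclidean_space set"
  assumes "0 \<le> K" "\<And>z. z \<in> \<Omega> \<Longrightarrow> u z - K * (1 - bump n y z) \<le> u x - K * (1 - bump n y x)"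
  shows "touched \<Omega> u x"
proof -
  have "Ck_on 1 \<Omega> (\<lambda>z. K * (1 + (- 1) * bump n y z))"
    by (rule Ck_on_1_add Ck_on_1_const Ck_on_1_mult Ck_on_1_bump)+
  moreover have "\<bar>K * (1 + (- 1) * bump n y z)\<bar> \<le> K" for z
    using bump_bounds[of n y z] assms(1) by (simp add: abs_mult mult_left_le)
  ultimately show ?thesis
    unfolding touched_def using assms(2)
    by (intro exI[of _ "\<lambda>z. K * (1 + (- 1) * bump n y z)"] exI[of _ K]) auto
qed

lemma visc_super_B_test:
  assumes "visc_super s (\<lambda>u. B_finite s u h) (\<lambda>u. Bform s u h) \<mu> H \<Omega> u" "y \<in> \<Omega>"
    and "- q \<in> test_values s h \<Omega> (\<lambda>z. - u z) y"
  shows "0 \<le> \<mu> * u y + H y q"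
proof -
  obtain \<phi> where \<phi>: "\<phi> \<in> C1_L1w s \<Omega>" "\<And>z. - u z - \<phi> z \<le> - u y - \<phi> y" "B_finite s \<phi> h y" "Bform s \<phi> h y = - q"
    using assms(3) by (auto simp: test_values_def)
  have "u y - - \<phi> y \<le> u z - - \<phi> z" for z using \<phi>(2)[of z] by linarith
  then have "0 \<le> \<mu> * u y + H y (Bform s (\<lambda>z. - \<phi> z) h y)"
    using assms(1,2) C1_L1w_uminus[OF \<phi>(1)] \<phi>(3) unfolding visc_super_def by auto
  then show ?thesis using \<phi>(4) by simp
qed

lemma visc_sub_B_test:
  assumes "visc_sub s (\<lambda>u. B_finite s u h) (\<lambda>u. Bform s u h) \<mu> H \<Omega> u" "x \<in> \<Omega>"
    and "p \<in> test_values s h \<Omega> u x"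
  shows "\<mu> * u x + H x p \<le> 0"
  using assms unfolding visc_sub_def test_values_def by blast

lemma visc_super_Ds_test:
  assumes "visc_super s (Ds_finite s) (Ds s) \<mu> H \<Omega> u" "y \<in> \<Omega>"
    and "\<phi> \<in> C1_L1w s \<Omega>" "\<And>z. - u z - \<phi> z \<le> - u y - \<phi> y" "Ds_finite s \<phi> y"
  shows "0 \<le> \<mu> * u y + H y (Ds s \<phi> y)"
proof -
  have le: "\<forall>z. u y - - \<phi> y \<le> u z - - \<phi> z"
  proof
    show "u y - - \<phi> y \<le> u z - - \<phi> z" for z using assms(4)[of z] by linarith
  qed
  have "Ds_finite s (\<lambda>z. - \<phi> z) y" using assms(5) by (simp add: Ds_finite_def)
  then have "0 \<le> \<mu> * u y + H y (Ds s (\<lambda>z. - \<phi> z) y)"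
    using assms(1)[unfolded visc_super_def, THEN conjunct2, rule_format, OF C1_L1w_uminus[OF assms(3)] assms(2)] le
    by simp
  then show ?thesis by (simp add: Ds_def)
qed

text \<open>The square root grows like \<open>n powr ((1 + s) / 2)\<close>, so after division by
  \<open>n\<close> it decays like \<open>n powr ((s - 1) / 2)\<close>. This is the argument of the
  modulus in case (a), with \<open>norm (x - y) \<le> 1 / n\<close>.\<close>

lemma exists_large_scale:
  fixes D s :: real
  assumes "0 < s" "s < 1" "0 \<le> D" "0 < \<epsilon>"
  obtains n :: real where "1 \<le> n" "N \<le> n" "1 / n * (1 + sqrt (D * (1 + n powr (1 + s)))) < \<epsilon>"
proof -
  have "((\<lambda>n. 1 / n + sqrt (2 * D) * n powr ((s - 1) / 2)) \<longlongrightarrow> 0 + sqrt (2 * D) * 0) at_top"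
    using assms by (intro tendsto_intros tendsto_neg_powr tendsto_divide_0[OF tendsto_const]
        filterlim_at_top_imp_at_infinity filterlim_ident) auto
  then have "\<forall>\<^sub>F n in at_top. 1 / n + sqrt (2 * D) * n powr ((s - 1) / 2) < \<epsilon>"
    using assms(4) by (auto dest!: order_tendstoD(2))
  then have "\<forall>\<^sub>F n in at_top. 1 / n + sqrt (2 * D) * n powr ((s - 1) / 2) < \<epsilon> \<and> max 1 N \<le> n"
    by (intro eventually_conj eventually_ge_at_top)
  from eventually_happens[OF this]
  obtain n where n: "1 / n + sqrt (2 * D) * n powr ((s - 1) / 2) < \<epsilon>" "max 1 N \<le> n"
    by auto
  have "D * (1 + n powr (1 + s)) \<le> D * (2 * n powr (1 + s))"
    using n assms ge_one_powr_ge_zero[of n "1 + s"] by (intro mult_left_mono) auto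
  then have "sqrt (D * (1 + n powr (1 + s))) \<le> sqrt ((2 * D) * n powr (1 + s))"
    by (intro real_sqrt_le_mono) (simp add: mult_ac)
  also have "\<dots> = sqrt (2 * D) * n powr ((1 + s) / 2)"
    using n by (simp add: real_sqrt_mult powr_half_sqrt[symmetric] powr_powr)
  finally have "1 / n * (1 + sqrt (D * (1 + n powr (1 + s)))) \<le> 1 / n * (1 + sqrt (2 * D) * n powr ((1 + s) / 2))"
    using n by (intro mult_left_mono) auto
  also have "\<dots> = 1 / n + sqrt (2 * D) * (n powr (-1) * n powr ((1 + s) / 2))"
    using n by (simp add: powr_minus_divide algebra_simps)
  also have "n powr (-1) * n powr ((1 + s) / 2) = n powr ((s - 1) / 2)"
  proof -
    have "-1 + (1 + s) / 2 = (s - 1) / 2" by (simp add: field_simps)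
    then show ?thesis by (simp only: powr_add[symmetric])
  qed
  finally show thesis using n by (intro that[of n]) auto
qed

theorem theorem1p2:
  fixes s \<mu> :: real
    and \<Omega> :: "(real ^ 'n) set"
    and H :: "real ^ 'n \<Rightarrow> real \<Rightarrow> real"
    and u1 u2 :: "real ^ 'n \<Rightarrow> real"
  assumes s: "0 < s" "s < 1"
    and mu: "0 < \<mu>"
    and domain: "open \<Omega>" "connected \<Omega>" "\<Omega> \<noteq> {}" "bounded \<Omega>"
    and H_cont: "continuous_on UNIV (\<lambda>(x, p). H x p)"
    and u_bdd: "bounded (range u1)" "bounded (range u2)"
    and u_cont: "continuous_on (closure \<Omega>) u1" "continuous_on (closure \<Omega>) u2"
    and exterior: "\<And>x. x \<notin> \<Omega> \<Longrightarrow> u1 x \<le> u2 x"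
    and cases_a_b:
      "(visc_sub s (Ds_finite s) (Ds s) \<mu> H \<Omega> u1 \<and>
        visc_super s (Ds_finite s) (Ds s) \<mu> H \<Omega> u2 \<and>
        (\<exists>\<omega>1. modulus_of_continuity \<omega>1 \<and>
          (\<forall>x\<in>\<Omega>. \<forall>y\<in>\<Omega>. \<forall>v \<in> C1_L1w s \<Omega>. Ds_finite s v x \<longrightarrow>
             \<bar>H x (Ds s v x) - H y (Ds s v x)\<bar> \<le> \<omega>1 (norm (x - y) * (1 + Ds s v x)))))
       \<or>
       (\<exists>h. smooth h \<and> h \<in> L1w s \<and>
        u1 \<in> borel_measurable lebesgue \<and> u2 \<in> borel_measurable lebesgue \<and>
        visc_sub s (\<lambda>u. B_finite s u h) (\<lambda>u. Bform s u h) \<mu> H \<Omega> u1 \<and>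
        visc_super s (\<lambda>u. B_finite s u h) (\<lambda>u. Bform s u h) \<mu> H \<Omega> u2 \<and>
        (\<exists>\<omega>1. modulus_of_continuity \<omega>1 \<and>
          (\<forall>x\<in>\<Omega>. \<forall>y\<in>\<Omega>. \<forall>v \<in> C1_L1w s \<Omega>. \<forall>h1 h2.
             smooth h1 \<and> h1 \<in> L1w s \<and> smooth h2 \<and> h2 \<in> L1w s \<and>
             B_finite s v h1 x \<and> B_finite s v h2 y \<longrightarrow>
             \<bar>H x (Bform s v h1 x) - H y (Bform s v h2 y)\<bar>
               \<le> \<omega>1 (norm (x - y) + \<bar>Bform s v h1 x - Bform s v h2 y\<bar>))))"
  shows "\<forall>x\<in>\<Omega>. u1 x \<le> u2 x"
proof (rule ccontr)
  assume "\<not> (\<forall>x\<in>\<Omega>. u1 x \<le> u2 x)"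
  then obtain x0 where x0: "x0 \<in> \<Omega>" "u2 x0 < u1 x0" by (auto simp: not_le)
  define \<theta> where "\<theta> = u1 x0 - u2 x0"
  have \<theta>: "0 < \<theta>" using x0 by (simp add: \<theta>_def)
  obtain M1 where M1: "\<And>z. \<bar>u1 z\<bar> \<le> M1" using u_bdd(1) by (auto simp: bounded_iff)
  obtain M2 where M2: "\<And>z. \<bar>u2 z\<bar> \<le> M2" using u_bdd(2) by (auto simp: bounded_iff)
  define M where "M = max M1 M2"
  have M: "\<bar>u1 z\<bar> \<le> M" "\<bar>u2 z\<bar> \<le> M" "\<bar>- u2 z\<bar> \<le> M" for z
    using M1[of z] M2[of z] by (auto simp: M_def)
  define K where "K = 4 * M + 1"
  have K: "0 \<le> K" using M(1)[of undefined] by (simp add: K_def)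
  obtain \<delta> where \<delta>: "0 < \<delta>" "\<And>x y. x \<in> closure \<Omega> \<Longrightarrow> y \<in> closure \<Omega> \<Longrightarrow> norm (x - y) < \<delta> \<Longrightarrow>
    \<theta> \<le> u1 x - u2 y \<Longrightarrow> ball x \<delta> \<subseteq> \<Omega> \<and> ball y \<delta> \<subseteq> \<Omega>"
    using doubling_interior[OF domain(1,4) u_cont exterior \<theta>] by blast
  have double: "\<exists>x y. ball x \<delta> \<subseteq> \<Omega> \<and> ball y \<delta> \<subseteq> \<Omega> \<and> norm (x - y) \<le> 1 / n \<and> \<theta> \<le> u1 x - u2 y \<and>
      (\<forall>z. u2 y - u2 z \<le> u1 x - u1 z) \<and>
      (\<forall>z\<in>\<Omega>. u1 z - K * (1 - bump n y z) \<le> u1 x - K * (1 - bump n y x)) \<and>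
      (\<forall>z\<in>\<Omega>. - u2 z - K * (1 - bump n x z) \<le> - u2 y - K * (1 - bump n x y))"
    if n: "1 / \<delta> < n" for n
  proof -
    have n0: "0 < n" using n \<delta>(1) by (meson less_trans zero_less_divide_1_iff)
    have cl: "compact (closure \<Omega>)" "x0 \<in> closure \<Omega>"
      using domain(4) x0(1) closure_subset by (auto simp: compact_closure)
    obtain x y where xy: "x \<in> closure \<Omega>" "y \<in> closure \<Omega>" "n * norm (x - y) \<le> 1"
      "\<And>z. z \<in> closure \<Omega> \<Longrightarrow> u1 z - u2 z \<le> u1 x - u2 y"
      "\<And>z. z \<in> closure \<Omega> \<Longrightarrow> u1 z - K * (1 - bump n y z) \<le> u1 x - K * (1 - bump n y x)"
      "\<And>z. z \<in> closure \<Omega> \<Longrightarrow> - u2 z - K * (1 - bump n x z) \<le> - u2 y - K * (1 - bump n x y)"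
      using doubling_maximum[OF cl u_cont M(2) n0] unfolding K_def by metis
    have d: "norm (x - y) \<le> 1 / n" using xy(3) n0 by (simp add: field_simps)
    also have "1 / n < \<delta>" using n n0 \<delta>(1) by (simp add: field_simps)
    finally have d': "norm (x - y) < \<delta>" .
    have \<theta>le: "\<theta> \<le> u1 x - u2 y" using xy(4)[OF cl(2)] by (simp add: \<theta>_def)
    \<comment> \<open>Inside \<open>\<Omega>\<close> this is maximality on the diagonal; outside,
      \<open>u1 - u2\<close> is nonpositive while
      \<open>u1 x - u2 y \<ge> \<theta> > 0\<close>.\<close>
    have all: "u2 y - u2 z \<le> u1 x - u1 z" for z
    proof (cases "z \<in> \<Omega>")
      case True
      then show ?thesis using xy(4)[of z] closure_subset[of \<Omega>] by auto
    next
      case False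
      then show ?thesis using exterior[of z] \<theta> \<theta>le by simp
    qed
    show ?thesis
      using \<delta>(2)[OF xy(1,2) d' \<theta>le] d \<theta>le all xy(5,6) closure_subset[of \<Omega>]
      by (intro exI[of _ x] exI[of _ y]) blast
  qed
  have \<mu>\<theta>: "0 < \<mu> * \<theta>" using mu \<theta> by simp
  \<comment> \<open>Subtracting the two viscosity inequalities gives
    \<open>\<mu> * \<theta> \<le> H y q - H x p\<close>.\<close>
  have contra: False if "\<mu> * u1 x + H x p \<le> 0" "0 \<le> \<mu> * u2 y + H y q" "\<theta> \<le> u1 x - u2 y"
    "\<bar>H x p - H y q\<bar> \<le> r" "r < \<mu> * \<theta>" for x y p q r
  proof -
    have "\<mu> * \<theta> \<le> \<mu> * (u1 x - u2 y)" using that(3) mu by (intro mult_left_mono) auto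
    then show False using that by (simp add: right_diff_distrib)
  qed
  from cases_a_b show False
  proof (elim disjE exE conjE)
    fix \<omega>
    assume sub: "visc_sub s (Ds_finite s) (Ds s) \<mu> H \<Omega> u1"
      and super: "visc_super s (Ds_finite s) (Ds s) \<mu> H \<Omega> u2"
      and \<omega>: "modulus_of_continuity \<omega>"
      and H: "\<forall>x\<in>\<Omega>. \<forall>y\<in>\<Omega>. \<forall>v \<in> C1_L1w s \<Omega>. Ds_finite s v x \<longrightarrow>
             \<bar>H x (Ds s v x) - H y (Ds s v x)\<bar> \<le> \<omega> (norm (x - y) * (1 + Ds s v x))"
    obtain D1 where D1: "\<forall>n x y P. 1 \<le> n \<longrightarrow> ball x \<delta> \<subseteq> \<Omega> \<longrightarrow>
      (\<forall>z\<in>\<Omega>. u1 z - K * (1 - bump n y z) \<le> u1 x - K * (1 - bump n y x)) \<longrightarrow>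
      D1 * (1 + n powr (1 + s)) \<le> P \<longrightarrow>
      (\<exists>\<phi>\<in>C1_L1w s \<Omega>. (\<forall>z. u1 z - \<phi> z \<le> u1 x - \<phi> x) \<and> Ds_finite s \<phi> x \<and> Ds s \<phi> x = sqrt P)"
      using Ds_test_function[OF s domain(1,4) \<delta>(1) K M(1)] ..
    obtain D2 where D2: "\<forall>n x y P. 1 \<le> n \<longrightarrow> ball x \<delta> \<subseteq> \<Omega> \<longrightarrow>
      (\<forall>z\<in>\<Omega>. - u2 z - K * (1 - bump n y z) \<le> - u2 x - K * (1 - bump n y x)) \<longrightarrow>
      D2 * (1 + n powr (1 + s)) \<le> P \<longrightarrow>
      (\<exists>\<phi>\<in>C1_L1w s \<Omega>. (\<forall>z. - u2 z - \<phi> z \<le> - u2 x - \<phi> x) \<and> Ds_finite s \<phi> x \<and> Ds s \<phi> x = sqrt P)"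
      using Ds_test_function[OF s domain(1,4) \<delta>(1) K M(3)] ..
    \<comment> \<open>One constant dominates both thresholds, so the same \<open>P\<close> is
      attained at \<open>x\<close> and at \<open>y\<close>; nonnegativity keeps
      \<open>sqrt P\<close> meaningful.\<close>
    define D where "D = max 0 (max D1 D2)"
    obtain d where d: "0 < d" "\<And>t. 0 \<le> t \<Longrightarrow> t < d \<Longrightarrow> \<omega> t < \<mu> * \<theta>"
      using modulus_of_continuity_small[OF \<omega> \<mu>\<theta>] by blast
    obtain n where n: "1 \<le> n" "1 / \<delta> + 1 \<le> n" "1 / n * (1 + sqrt (D * (1 + n powr (1 + s)))) < d"
      using exists_large_scale[OF s _ d(1), of D "1 / \<delta> + 1"] by (auto simp: D_def)
    define P where "P = D * (1 + n powr (1 + s))"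
    have P: "D1 * (1 + n powr (1 + s)) \<le> P" "D2 * (1 + n powr (1 + s)) \<le> P" "0 \<le> P"
      unfolding P_def by (auto intro!: mult_right_mono simp: D_def)
    obtain x y where xy: "ball x \<delta> \<subseteq> \<Omega>" "ball y \<delta> \<subseteq> \<Omega>" "norm (x - y) \<le> 1 / n" "\<theta> \<le> u1 x - u2 y"
      "\<And>z. z \<in> \<Omega> \<Longrightarrow> u1 z - K * (1 - bump n y z) \<le> u1 x - K * (1 - bump n y x)"
      "\<And>z. z \<in> \<Omega> \<Longrightarrow> - u2 z - K * (1 - bump n x z) \<le> - u2 y - K * (1 - bump n x y)"
      using double[of n] n(2) by auto
    have x: "x \<in> \<Omega>" and y: "y \<in> \<Omega>" using xy(1,2) \<delta>(1) by auto
    obtain \<phi> where \<phi>: "\<phi> \<in> C1_L1w s \<Omega>" "\<And>z. u1 z - \<phi> z \<le> u1 x - \<phi> x" "Ds_finite s \<phi> x" "Ds s \<phi> x = sqrt P"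
      using D1[rule_format, OF n(1) xy(1,5) P(1)] by blast
    obtain \<psi> where \<psi>: "\<psi> \<in> C1_L1w s \<Omega>" "\<And>z. - u2 z - \<psi> z \<le> - u2 y - \<psi> y" "Ds_finite s \<psi> y" "Ds s \<psi> y = sqrt P"
      using D2[rule_format, OF n(1) xy(2,6) P(2)] by blast
    have 1: "\<mu> * u1 x + H x (sqrt P) \<le> 0"
      using sub x \<phi> unfolding visc_sub_def by metis
    have 2: "0 \<le> \<mu> * u2 y + H y (sqrt P)"
      using visc_super_Ds_test[OF super y \<psi>(1-3)] \<psi>(4) by simp
    \<comment> \<open>The hypothesis evaluates \<open>D\<^sub>s\<close> of a single function at
      \<open>x\<close> in both terms, so it is used with \<open>\<phi>\<close>; the equal value of
      \<open>\<psi>\<close> at \<open>y\<close> makes this match both inequalities.\<close>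
    have 3: "\<bar>H x (sqrt P) - H y (sqrt P)\<bar> \<le> \<omega> (norm (x - y) * (1 + sqrt P))"
      using H x y \<phi>(1,3,4) by metis
    have "norm (x - y) * (1 + sqrt P) \<le> 1 / n * (1 + sqrt P)"
      using xy(3) P(3) by (intro mult_right_mono) auto
    then have "\<omega> (norm (x - y) * (1 + sqrt P)) < \<mu> * \<theta>"
      using n(3) P(3) by (intro d(2)) (auto simp: P_def[symmetric])
    then show False using contra[OF 1 2 xy(4) 3] by blast
  next
    fix h \<omega>
    assume h: "smooth h" "h \<in> L1w s" and um: "u1 \<in> borel_measurable lebesgue" "u2 \<in> borel_measurable lebesgue"
      and sub: "visc_sub s (\<lambda>u. B_finite s u h) (\<lambda>u. Bform s u h) \<mu> H \<Omega> u1"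
      and super: "visc_super s (\<lambda>u. B_finite s u h) (\<lambda>u. Bform s u h) \<mu> H \<Omega> u2"
      and \<omega>: "modulus_of_continuity \<omega>"
      and H: "\<forall>x\<in>\<Omega>. \<forall>y\<in>\<Omega>. \<forall>v \<in> C1_L1w s \<Omega>. \<forall>h1 h2.
             smooth h1 \<and> h1 \<in> L1w s \<and> smooth h2 \<and> h2 \<in> L1w s \<and>
             B_finite s v h1 x \<and> B_finite s v h2 y \<longrightarrow>
             \<bar>H x (Bform s v h1 x) - H y (Bform s v h2 y)\<bar>
               \<le> \<omega> (norm (x - y) + \<bar>Bform s v h1 x - Bform s v h2 y\<bar>)"
    obtain d where d: "0 < d" "\<And>t. 0 \<le> t \<Longrightarrow> t < d \<Longrightarrow> \<omega> t < \<mu> * \<theta>"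
      using modulus_of_continuity_small[OF \<omega> \<mu>\<theta>] by blast
    then have d2: "0 < d / 2" by simp
    obtain \<eta> where \<eta>: "0 < \<eta>" "\<forall>x\<in>\<Omega>. \<forall>y\<in>\<Omega>. norm (x - y) < \<eta> \<longrightarrow>
      touched \<Omega> u1 x \<longrightarrow> touched \<Omega> (\<lambda>z. - u2 z) y \<longrightarrow> (\<forall>z. u2 y - u2 z \<le> u1 x - u1 z) \<longrightarrow>
      (\<exists>p q. p \<in> test_values s h \<Omega> u1 x \<and> - q \<in> test_values s h \<Omega> (\<lambda>z. - u2 z) y \<and> \<bar>p - q\<bar> < d / 2)"
      using close_test_values[OF s h(2,1) domain(1,4) um(1) M(1) u_cont(1) um(2) M(2) u_cont(2) d2] by blast
    \<comment> \<open>The three thresholds put \<open>1 / n\<close> below \<open>\<delta>\<close>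
      for interior points, below \<open>\<eta>\<close> for close test values, and below
      \<open>d / 2\<close> for the modulus.\<close>
    define n where "n = max (1 / \<delta>) (max (1 / \<eta>) (2 / d)) + 1"
    have n: "1 / \<delta> < n" "1 / \<eta> < n" "2 / d < n" by (auto simp: n_def)
    have n0: "0 < n" using n(3) d(1) by (meson less_trans zero_less_divide_iff zero_less_numeral)
    obtain x y where xy: "ball x \<delta> \<subseteq> \<Omega>" "ball y \<delta> \<subseteq> \<Omega>" "norm (x - y) \<le> 1 / n" "\<theta> \<le> u1 x - u2 y"
      "\<And>z. u2 y - u2 z \<le> u1 x - u1 z"
      "\<And>z. z \<in> \<Omega> \<Longrightarrow> u1 z - K * (1 - bump n y z) \<le> u1 x - K * (1 - bump n y x)"
      "\<And>z. z \<in> \<Omega> \<Longrightarrow> - u2 z - K * (1 - bump n x z) \<le> - u2 y - K * (1 - bump n x y)"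
      using double[OF n(1)] by blast
    have x: "x \<in> \<Omega>" and y: "y \<in> \<Omega>" using xy(1,2) \<delta>(1) by auto
    have small: "1 / n < \<eta>" "1 / n < d / 2" using n n0 \<eta>(1) d(1) by (auto simp: field_simps)
    obtain p q where pq: "p \<in> test_values s h \<Omega> u1 x" "- q \<in> test_values s h \<Omega> (\<lambda>z. - u2 z) y" "\<bar>p - q\<bar> < d / 2"
      using \<eta>(2)[rule_format, OF x y _ touchedI_bump[OF K xy(6)] touchedI_bump[OF K xy(7)] xy(5)] xy(3) small by force
    have 1: "\<mu> * u1 x + H x p \<le> 0" by (rule visc_sub_B_test[OF sub x pq(1)])
    have 2: "0 \<le> \<mu> * u2 y + H y q" by (rule visc_super_B_test[OF super y pq(2)])
    obtain h1 where h1: "smooth h1" "h1 \<in> L1w s" "B_finite s (indicator (- \<Omega>)) h1 x"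
      "Bform s (indicator (- \<Omega>)) h1 x = p"
      using Bform_prescribed[OF s domain(1,4) x] by blast
    obtain h2 where h2: "smooth h2" "h2 \<in> L1w s" "B_finite s (indicator (- \<Omega>)) h2 y"
      "Bform s (indicator (- \<Omega>)) h2 y = q"
      using Bform_prescribed[OF s domain(1,4) y] by blast
    \<comment> \<open>The common function \<open>v\<close> is the indicator of the complement;
      \<open>h1\<close> and \<open>h2\<close> were chosen to give \<open>p\<close> at
      \<open>x\<close> and \<open>q\<close> at \<open>y\<close>.\<close>
    have 3: "\<bar>H x p - H y q\<bar> \<le> \<omega> (norm (x - y) + \<bar>p - q\<bar>)"
      using H[rule_format, OF x y indicator_in_C1_L1w[OF s(1) domain(1)], of h1 h2] h1 h2 by auto
    have "\<omega> (norm (x - y) + \<bar>p - q\<bar>) < \<mu> * \<theta>"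
      using xy(3) small(2) pq(3) by (intro d(2)) auto
    then show False using contra[OF 1 2 xy(4) 3] by blast
  qed
qed

end
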